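(* Fix $\xi\in\mathbb{C}\setminus\{0\}$ and $1\leq p<2$. Let $\{f_{k}\}_{k\in\mathbb{Z}}$ be a bi-infinite sequence of functions on $\mathcal{X}$ such that $\|f_{k}\|_{L^{p^{\prime},\infty}(\mathcal{X})}\leq M$ for all $k\in\mathbb{Z}$ and for some $M>0$. Let $$\Phi_{p}(\xi)=(1-\gamma(i\delta_{p^{\prime}}))\left((\Re \xi)^{2}+\tanh^{2}(\delta_{p^{\prime}}\log q)(\Im \xi)^{2}\right)^{1/2},$$ and for $j=1,2$ let $\beta_{j}$ be the unique point of $(-\tau/2,\tau/2]$ satisfying $$\Phi_{p}(\xi)\cos(\beta_{j}\log q)=(-1)^{j}\,\Re\xi\,(1-\gamma(i\delta_{p^{\prime}})),\qquad \Phi_{p}(\xi)\sin(\beta_{j}\log q)=(-1)^{j}\,\Im\xi\;\Im\gamma(\tau/4+i\delta_{p^{\prime}}).$$ (i) If $\mathscr{H}_{\xi}f_{-k}=A\,f_{-k+1}$ for all $k\in\mathbb{N}=\{1,2,\ldots\}$ and for some $A\in\mathbb{C}$ satisfying $|A|=\exp\{\Re\xi+\Phi_{p}(\xi)\}$, then $\mathcal{L}f_{0}=\gamma(z_{1})f_{0}$, where $z_{1}=\beta_{1}+i\delta_{p^{\prime}}$. (ii) If $\mathscr{H}_{\xi}f_{k}=A\,f_{k+1}$ for all integers $k\geq 0$ and for some $A\in\mathbb{C}$ satisfying $|A|=\exp\{\Re\xi-\Phi_{p}(\xi)\}$, then $\mathcal{L}f_{0}=\gamma(z_{2})f_{0}$,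 where $z_{2}=\beta_{2}+i\delta_{p^{\prime}}$. In both cases, $f_{0}=\mathcal{P}_{z_{j}}F_{j}$ for a unique $F_{j}\in L^{p^{\prime}}(\Omega)$, where $j=1$ in case (i) and $j=2$ in case (ii).
   Context: Let $q\geq 2$ be an integer and let $\mathcal{X}$ be the homogeneous tree of degree $q+1$ (the connected graph without cycles in which every vertex has $q+1$ neighbours), identified with its set of vertices, with graph distance $d$, counting measure, a fixed reference vertex $o$, and $|x|=d(o,x)$. A function on $\mathcal{X}$ is radial if its value at $x$ depends only on $|x|$; for radial $k$ we write $k(n)$ for its value at vertices with $|x|=n$. For $k$ radial, $f\ast k(x)=\sum_{y\in\mathcal{X}}f(y)k(d(x,y))$. $p'$ is the conjugate exponent of $p$ ($p'=\infty$ if $p=1$). For $p\in(1,\infty)$ put $\delta_p=\frac1p-\frac12$; $\delta_1=\frac12=-\delta_\infty$. $S_p=\{z\in\mathbb{C}:|\Im z|\le|\delta_p|\}$ and $\tau=2\pi/\log q$. The Laplacian is $\mathcal{L}f(x)=f(x)-\frac{1}{q+1}\sum_{y:d(x,y)=1}f(y)$, and $\gamma(z)=1-\frac{q^{1/2+iz}+q^{1/2-iz}}{q+1}$ for $z\in\mathbb{C}$. For $r\in[1,\infty)$, $L^{r,\infty}(\mathcal{X})$ is the space of functions $f$ on $\mathcal X$ with $\|f\|_{L^{r,\infty}(\mathcal{X})}=\sup_{t>0}t\,(\#\{x:|f(x)|>t\})^{1/r}<\infty$; $L^{\infty,\infty}(\mathcal{X})=L^\infty(\mathcal{X})$. $\Omega$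 is the set of infinite geodesic rays $\omega=\{\omega_0,\omega_1,\dots\}$ starting at $\omega_0=o$; $c(x,\omega)$ is the last vertex of the geodesic path from $o$ to $x$ that lies on $\omega$. $\nu$ is the Borel probability measure on $\Omega$ giving mass $(q+1)^{-1}q^{-n+1}$ to each set $\{\omega:|c(x,\omega)|=|x|\}$ with $|x|=n\ge1$ (these sets, for $x\in\mathcal X$, form a basis of the topology); $L^r(\Omega)=L^r(\Omega,\nu)$. With $p(x,\omega)=q^{2|c(x,\omega)|-|x|}$, the Poisson transform of $F$ is $\mathcal{P}_zF(x)=\int_\Omega p^{1/2+iz}(x,\omega)F(\omega)\,d\nu(\omega)$, and $\phi_z=\mathcal{P}_z\mathbf{1}$ is the elementary spherical function. For radial $k$, $\widehat{k}(z)=\sum_{x\in\mathcal{X}}k(x)\phi_z(x)$. For $1\le p<2$, $\mathcal{S}_p(\mathcal{X})$ is the space of functions $\phi$ on $\mathcal{X}$ with $\sup_{x}(1+|x|)^m q^{|x|/p}|\phi(x)|<\infty$ for all integers $m\ge0$. The complex-time heat operator is $\mathscr{H}_{\xi}f=f\ast h_{\xi}$, where $h_\xi$ is the (unique) radial function, lying in $\mathcal{S}_p(\mathcal{X})$ for all $1\le p<2$, with $\widehat{h}_{\xi}(z)=e^{\xi\gamma(z)}$ on $S_p$. *)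

theory Defs
  imports "HOL-Analysis.Analysis"
begin

section \<open>Homogeneous trees\<close>

text \<open>
  A simple undirected graph is given by its adjacency relation on the type of vertices.
\<close>

definition graph_cycle :: "('a \<Rightarrow> 'a \<Rightarrow> bool) \<Rightarrow> 'a list \<Rightarrow> bool" where
  "graph_cycle adj vs \<longleftrightarrow>
     3 \<le> length vs \<and> distinct vs \<and> successively adj vs \<and> adj (last vs) (hd vs)"

text \<open>
  The degree condition forces the neighbourhoods to be finite, since the cardinality of
  an infinite set is \<open>0\<close>.
\<close>

definition homogeneous_tree :: "('a \<Rightarrow> 'a \<Rightarrow> bool) \<Rightarrow> nat \<Rightarrow> bool" where
  "homogeneous_tree adj q \<longleftrightarrow>
     symp adj \<and> irreflp adj \<and>
     (\<forall>x y. adj\<^sup>*\<^sup>* x y) \<and>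
     (\<nexists>vs. graph_cycle adj vs) \<and>
     (\<forall>x. card {y. adj x y} = q + 1)"

definition gdist :: "('a \<Rightarrow> 'a \<Rightarrow> bool) \<Rightarrow> 'a \<Rightarrow> 'a \<Rightarrow> nat" where
  "gdist adj x y = (LEAST n. (adj ^^ n) x y)"

definition radial :: "('a \<Rightarrow> 'a \<Rightarrow> bool) \<Rightarrow> 'a \<Rightarrow> ('a \<Rightarrow> complex) \<Rightarrow> bool" where
  "radial adj x0 k \<longleftrightarrow> (\<forall>x y. gdist adj x0 x = gdist adj x0 y \<longrightarrow> k x = k y)"

text \<open>For radial \<open>k\<close>, the value of \<open>k\<close> at the vertices at distance \<open>n\<close> from \<open>x0\<close>.\<close>

definition radial_value :: "('a \<Rightarrow> 'a \<Rightarrow> bool) \<Rightarrow> 'a \<Rightarrow> ('a \<Rightarrow> complex) \<Rightarrow> nat \<Rightarrow> complex" where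
  "radial_value adj x0 k n = k (SOME x. gdist adj x0 x = n)"

definition tree_conv ::
    "('a \<Rightarrow> 'a \<Rightarrow> bool) \<Rightarrow> 'a \<Rightarrow> ('a \<Rightarrow> complex) \<Rightarrow> ('a \<Rightarrow> complex) \<Rightarrow> 'a \<Rightarrow> complex" where
  "tree_conv adj x0 f k x = (\<Sum>\<^sub>\<infinity>y. f y * radial_value adj x0 k (gdist adj x y))"

definition laplacian :: "('a \<Rightarrow> 'a \<Rightarrow> bool) \<Rightarrow> nat \<Rightarrow> ('a \<Rightarrow> complex) \<Rightarrow> 'a \<Rightarrow> complex" where
  "laplacian adj q f x = f x - (\<Sum>y\<in>{y. gdist adj x y = 1}. f y) / of_nat (q + 1)"


section \<open>Exponents and function spaces\<close>

text \<open>
  Lebesgue exponents that may be infinite are of type \<^typ>\<open>ennreal\<close>, where \<open>1 / \<infinity> = 0\<close>.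
\<close>

definition conj_exponent :: "real \<Rightarrow> ennreal" where
  "conj_exponent p = (if p = 1 then \<infinity> else ennreal (p / (p - 1)))"

definition \<delta> :: "ennreal \<Rightarrow> real" where
  "\<delta> r = enn2real (1 / r) - 1 / 2"

definition strip :: "real \<Rightarrow> complex set" where
  "strip p = {z. \<bar>Im z\<bar> \<le> \<bar>\<delta> (ennreal p)\<bar>}"

definition \<tau> :: "nat \<Rightarrow> real" where
  "\<tau> q = 2 * pi / ln q"

definition \<gamma> :: "nat \<Rightarrow> complex \<Rightarrow> complex" where
  "\<gamma> q z = 1 - (of_nat q powr (1 / 2 + \<i> * z) + of_nat q powr (1 / 2 - \<i> * z)) / of_nat (q + 1)"

definition weak_norm :: "ennreal \<Rightarrow> ('a \<Rightarrow> complex) \<Rightarrow> ennreal" where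
  "weak_norm r f =
     (if r = \<infinity> then (SUP x. ennreal (cmod (f x)))
      else (SUP t\<in>{0<..}.
              if finite {x. t < cmod (f x)}
              then ennreal (t * real (card {x. t < cmod (f x)}) powr enn2real (1 / r))
              else \<infinity>))"

definition schwartz_space :: "('a \<Rightarrow> 'a \<Rightarrow> bool) \<Rightarrow> nat \<Rightarrow> 'a \<Rightarrow> real \<Rightarrow> ('a \<Rightarrow> complex) set" where
  "schwartz_space adj q x0 p =
     {k. \<forall>m::nat. bdd_above (range (\<lambda>x.
            (1 + real (gdist adj x0 x)) ^ m * real q powr (real (gdist adj x0 x) / p) * cmod (k x)))}"


section \<open>The boundary and the Poisson transform\<close>

definition rays :: "('a \<Rightarrow> 'a \<Rightarrow> bool) \<Rightarrow> 'a \<Rightarrow> (nat \<Rightarrow> 'a) set" where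
  "rays adj x0 = {\<omega>. \<omega> 0 = x0 \<and> (\<forall>m n. m \<le> n \<longrightarrow> gdist adj (\<omega> m) (\<omega> n) = n - m)}"

text \<open>
  The vertices \<open>v\<close> on the geodesic path from \<open>x0\<close> to \<open>x\<close> are those with
  \<open>d(x0,v) + d(v,x) = d(x0,x)\<close>; the last one on \<open>\<omega>\<close> is the one farthest from \<open>x0\<close>.
\<close>

definition confluent :: "('a \<Rightarrow> 'a \<Rightarrow> bool) \<Rightarrow> 'a \<Rightarrow> 'a \<Rightarrow> (nat \<Rightarrow> 'a) \<Rightarrow> 'a" where
  "confluent adj x0 x \<omega> =
     arg_max (gdist adj x0)
       (\<lambda>v. v \<in> range \<omega> \<and> gdist adj x0 v + gdist adj v x = gdist adj x0 x)"

definition boundary_sector :: "('a \<Rightarrow> 'a \<Rightarrow> bool) \<Rightarrow> 'a \<Rightarrow> 'a \<Rightarrow> (nat \<Rightarrow> 'a) set" where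
  "boundary_sector adj x0 x =
     {\<omega> \<in> rays adj x0. gdist adj x0 (confluent adj x0 x \<omega>) = gdist adj x0 x}"

text \<open>
  The sectors form a countable basis of the topology of the boundary, so the
  \<open>\<sigma>\<close>-algebra they generate is the Borel \<open>\<sigma>\<close>-algebra. They are closed under
  intersection up to the empty set, so their masses determine the measure.
  The sector of \<open>x0\<close> is the whole boundary and has mass \<open>1\<close>.
\<close>

definition boundary_measure :: "('a \<Rightarrow> 'a \<Rightarrow> bool) \<Rightarrow> nat \<Rightarrow> 'a \<Rightarrow> (nat \<Rightarrow> 'a) measure" where
  "boundary_measure adj q x0 =
     extend_measure (rays adj x0) UNIV (boundary_sector adj x0)
       (\<lambda>x. if x = x0 then 1
             else ennreal (1 / (real (q + 1) * real q ^ (gdist adj x0 x - 1))))"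

definition poisson_kernel :: "('a \<Rightarrow> 'a \<Rightarrow> bool) \<Rightarrow> nat \<Rightarrow> 'a \<Rightarrow> 'a \<Rightarrow> (nat \<Rightarrow> 'a) \<Rightarrow> real" where
  "poisson_kernel adj q x0 x \<omega> =
     real q powi (2 * int (gdist adj x0 (confluent adj x0 x \<omega>)) - int (gdist adj x0 x))"

definition poisson_transform ::
    "('a \<Rightarrow> 'a \<Rightarrow> bool) \<Rightarrow> nat \<Rightarrow> 'a \<Rightarrow> complex \<Rightarrow> ((nat \<Rightarrow> 'a) \<Rightarrow> complex) \<Rightarrow> 'a \<Rightarrow> complex" where
  "poisson_transform adj q x0 z F x =
     (\<integral>\<omega>. of_real (poisson_kernel adj q x0 x \<omega>) powr (1 / 2 + \<i> * z) * F \<omega>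
        \<partial>boundary_measure adj q x0)"

definition boundary_Lp ::
    "('a \<Rightarrow> 'a \<Rightarrow> bool) \<Rightarrow> nat \<Rightarrow> 'a \<Rightarrow> ennreal \<Rightarrow> ((nat \<Rightarrow> 'a) \<Rightarrow> complex) set" where
  "boundary_Lp adj q x0 r =
     {F \<in> borel_measurable (boundary_measure adj q x0).
        if r = \<infinity> then \<exists>C. AE \<omega> in boundary_measure adj q x0. cmod (F \<omega>) \<le> C
        else integrable (boundary_measure adj q x0) (\<lambda>\<omega>. cmod (F \<omega>) powr enn2real r)}"


section \<open>The heat operator with complex time\<close>

definition spherical_function ::
    "('a \<Rightarrow> 'a \<Rightarrow> bool) \<Rightarrow> nat \<Rightarrow> 'a \<Rightarrow> complex \<Rightarrow> 'a \<Rightarrow> complex" where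
  "spherical_function adj q x0 z = poisson_transform adj q x0 z (\<lambda>\<omega>. 1)"

definition spherical_transform ::
    "('a \<Rightarrow> 'a \<Rightarrow> bool) \<Rightarrow> nat \<Rightarrow> 'a \<Rightarrow> ('a \<Rightarrow> complex) \<Rightarrow> complex \<Rightarrow> complex" where
  "spherical_transform adj q x0 k z = (\<Sum>\<^sub>\<infinity>x. k x * spherical_function adj q x0 z x)"

definition heat_kernel :: "('a \<Rightarrow> 'a \<Rightarrow> bool) \<Rightarrow> nat \<Rightarrow> 'a \<Rightarrow> complex \<Rightarrow> 'a \<Rightarrow> complex" where
  "heat_kernel adj q x0 \<xi> =
     (THE h. radial adj x0 h \<and>
        (\<forall>p::real. 1 \<le> p \<and> p < 2 \<longrightarrow>
           h \<in> schwartz_space adj q x0 p \<and>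
           (\<forall>z\<in>strip p. spherical_transform adj q x0 h z = exp (\<xi> * \<gamma> q z))))"

definition heat_operator ::
    "('a \<Rightarrow> 'a \<Rightarrow> bool) \<Rightarrow> nat \<Rightarrow> 'a \<Rightarrow> complex \<Rightarrow> ('a \<Rightarrow> complex) \<Rightarrow> 'a \<Rightarrow> complex" where
  "heat_operator adj q x0 \<xi> f = tree_conv adj x0 f (heat_kernel adj q x0 \<xi>)"

text \<open>
  The number \<open>\<gamma>(i\<delta>)\<close> is real for real \<open>\<delta>\<close>; \<^const>\<open>Re\<close> only converts the type.
\<close>

definition \<Phi> :: "nat \<Rightarrow> real \<Rightarrow> complex \<Rightarrow> real" where
  "\<Phi> q p \<xi> =
     Re (1 - \<gamma> q (\<i> * \<delta> (conj_exponent p))) *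
     sqrt ((Re \<xi>)\<^sup>2 + (tanh (\<delta> (conj_exponent p) * ln q))\<^sup>2 * (Im \<xi>)\<^sup>2)"

definition \<beta> :: "nat \<Rightarrow> real \<Rightarrow> complex \<Rightarrow> nat \<Rightarrow> real" where
  "\<beta> q p \<xi> j =
     (THE b. b \<in> {- \<tau> q / 2 <.. \<tau> q / 2} \<and>
        \<Phi> q p \<xi> * cos (b * ln q) = (-1) ^ j * Re \<xi> * Re (1 - \<gamma> q (\<i> * \<delta> (conj_exponent p))) \<and>
        \<Phi> q p \<xi> * sin (b * ln q) = (-1) ^ j * Im \<xi> * Im (\<gamma> q (\<tau> q / 4 + \<i> * \<delta> (conj_exponent p))))"

definition z_extremal :: "nat \<Rightarrow> real \<Rightarrow> complex \<Rightarrow> nat \<Rightarrow> complex" where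
  "z_extremal q p \<xi> j = \<beta> q p \<xi> j + \<i> * \<delta> (conj_exponent p)"

text \<open>Uniqueness in \<open>L\<^sup>r\<close> is uniqueness up to null sets.\<close>

definition unique_poisson_representation ::
    "('a \<Rightarrow> 'a \<Rightarrow> bool) \<Rightarrow> nat \<Rightarrow> 'a \<Rightarrow> ennreal \<Rightarrow> complex \<Rightarrow> ('a \<Rightarrow> complex) \<Rightarrow> bool" where
  "unique_poisson_representation adj q x0 r z u \<longleftrightarrow>
     (\<exists>F\<in>boundary_Lp adj q x0 r. u = poisson_transform adj q x0 z F \<and>
        (\<forall>G\<in>boundary_Lp adj q x0 r. u = poisson_transform adj q x0 z G \<longrightarrow>
           (AE \<omega> in boundary_measure adj q x0. G \<omega> = F \<omega>)))"

end

theory Submission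
  imports Defs "HOL-Probability.Probability"
begin

text \<open>
  Let \<open>T\<close> be the sum over neighbours, so that the Laplacian is \<open>1 - T / (q + 1)\<close>. On
  bounded functions the heat operator is \<open>exp \<xi>\<close> times the exponential of \<open>\<kappa> T\<close> with
  \<open>\<kappa> = - \<xi> / (q + 1)\<close> (\<open>heat_operator_eq\<close>), and the eigenvalue of \<open>T\<close> belonging to \<open>z\<close> is
  \<open>\<lambda>(w) = sqrt q * (w + 1 / w)\<close> with \<open>w = q powr (\<i> z)\<close>. The line \<open>Im z = \<delta>\<close> of the conjugate
  exponent is the circle of radius \<open>\<rho> = q powr (1/p - 1/2)\<close> in \<open>w\<close>. On it \<open>Re (\<kappa> \<lambda>(w))\<close> equals
  \<open>\<Phi> cos (arg w - arg w1)\<close>, so its maximum \<open>\<Phi>\<close> is attained only at the point \<open>w1\<close> given by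
  \<open>z_extremal\<close> (\<open>extremal_point\<close>).

  In the first case, division of the heat operator by \<open>exp \<xi>\<close> gives \<open>f 0 = inverse (a ^ k) * exp(k \<kappa> T) f(-k)\<close>
  for every \<open>k\<close>, with \<open>|a| = exp \<Phi>\<close>. Let \<open>D = T - \<lambda>(w1)\<close> and expand \<open>D\<^sup>4 exp(k \<kappa> T)\<close> in the operators
  \<open>U m\<close> that sum a function over the points whose distance is at most \<open>m\<close> and has the parity of
  \<open>m\<close>; these are Chebyshev polynomials in \<open>T\<close>. The coefficients are Laurent coefficients of
  \<open>(\<lambda>(w) - \<lambda>(w1))\<^sup>4 exp(k \<kappa> \<lambda>(w))\<close>, up to a fixed factor. Cauchy's estimate on the circle of
  radius \<open>\<rho>\<close> bounds the coefficient of \<open>U m\<close> by a constant times \<open>|a|\<^sup>k q powr (- m/p)\<close> times the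
  supremum of \<open>y\<^sup>2 exp (- k \<Phi> y)\<close>, where \<open>y = 1 - cos (arg w - arg w1)\<close>, which is \<open>O(1/k\<^sup>2)\<close>; a
  larger circle shows that only \<open>m\<close> up to a multiple of \<open>k\<close> matter. Since the weak norm bounds
  \<open>U m f\<close> pointwise by a constant times \<open>q powr (m/p)\<close>, the whole sum is \<open>O(1/k)\<close> and \<open>D\<^sup>4 f 0 = 0\<close>
  (\<open>orbit_extremal_power\<close>). With the first power in place of the fourth this crude count would
  not suffice, but the lost powers come back for free: where \<open>D\<close> is nilpotent, the exponential
  produces polynomial growth along the orbit, which boundedness forbids
  (\<open>bounded_orbit_nilpotent\<close>). So \<open>D f 0 = 0\<close>. The second case is the first one for \<open>- \<xi>\<close>, with the
  sequence read backwards.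

  An eigenfunction in weak \<open>L\<^sup>r\<close>, where \<open>r\<close> is the conjugate exponent and the eigenvalue comes
  from the circle of radius \<open>\<rho>\<close>, is then a Poisson transform. It determines a finitely additive
  function on the sectors of the boundary, whose densities at successive levels form a
  martingale. The weak norm controls the \<open>r\<close>-th moments only up to a
  factor linear in the level when they are summed over levels; but the moments of a martingale
  increase with the level, so each is at most a later average and all are bounded
  (\<open>sphere_abs_dens_bounded\<close>). As \<open>r > 2\<close>, the martingale is bounded in \<open>L\<^sup>2\<close>, converges
  (\<open>child_additive_L2_limit\<close>), and its limit is the boundary function; for \<open>p = 1\<close> the
  martingale is bounded outright. Uniqueness holds because the Poisson transform determines
  the integrals over all sectors.

  The heat kernel and the boundary measure are given implicitly, by a spherical transform
  and by the masses of the sectors. They are identified in \<open>heat_kernel_eq\<close> and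
  \<open>emeasure_sector\<close>; the measure is realised as the law of a random walk that moves to a uniformly
  chosen child in each step.
\<close>

section \<open>Distances in a homogeneous tree\<close>

locale hom_tree =
  fixes adj :: "'a \<Rightarrow> 'a \<Rightarrow> bool" and q :: nat
  assumes q_ge_2: "q \<ge> 2"
    and tree: "homogeneous_tree adj q"
begin

abbreviation d :: "'a \<Rightarrow> 'a \<Rightarrow> nat" where "d \<equiv> gdist adj"

definition nbrs :: "'a \<Rightarrow> 'a set" where "nbrs x = {y. adj x y}"

lemma adj_sym: "adj x y \<Longrightarrow> adj y x"
  using tree by (auto simp: homogeneous_tree_def symp_def)

lemma adj_irrefl: "\<not> adj x x"
  using tree by (auto simp: homogeneous_tree_def irreflp_def)

lemma connected: "adj\<^sup>*\<^sup>* x y"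
  using tree by (auto simp: homogeneous_tree_def)

lemma no_cycle: "\<not> graph_cycle adj vs"
  using tree by (auto simp: homogeneous_tree_def)

lemma card_nbrs: "card (nbrs x) = q + 1"
  using tree by (auto simp: homogeneous_tree_def nbrs_def)

lemma finite_nbrs [simp]: "finite (nbrs x)"
  using card_nbrs[of x] by (metis card.infinite Suc_eq_plus1 nat.distinct(1))

lemma gdist_path: "(adj ^^ d x y) x y"
  unfolding gdist_def using rtranclp_imp_relpowp[OF connected] by (rule LeastI_ex)

lemma gdist_le: "(adj ^^ n) x y \<Longrightarrow> d x y \<le> n"
  unfolding gdist_def by (rule Least_le)

lemma relpowp_sym: "(adj ^^ n) x y \<Longrightarrow> (adj ^^ n) y x"
proof (induction n arbitrary: x y)
  case 0
  then show ?case by simp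
next
  case (Suc n)
  from Suc.prems obtain z where "(adj ^^ n) x z" "adj z y" by (rule relpowp_Suc_E)
  then show ?case using Suc.IH adj_sym by (meson relpowp_Suc_I2)
qed

lemma gdist_sym: "d x y = d y x"
  using gdist_le[OF relpowp_sym[OF gdist_path[of x y]]] gdist_le[OF relpowp_sym[OF gdist_path[of y x]]]
  by (rule antisym[rotated])

lemma gdist_refl [simp]: "d x x = 0"
  using gdist_le[of 0 x x] by simp

lemma gdist_eq_0 [simp]: "d x y = 0 \<longleftrightarrow> x = y"
  using gdist_path[of x y] by auto

lemma gdist_triangle: "d x z \<le> d x y + d y z"
proof (rule gdist_le)
  show "(adj ^^ (d x y + d y z)) x z"
    unfolding relpowp_add using gdist_path by blast
qed

lemma gdist_eq_1: "d x y = 1 \<longleftrightarrow> adj x y"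
proof
  assume "d x y = 1"
  then show "adj x y" using gdist_path[of x y] by auto
next
  assume "adj x y"
  then have "d x y \<le> 1" "x \<noteq> y" using gdist_le[of 1 x y] adj_irrefl by auto
  then show "d x y = 1" by (metis gdist_eq_0 le_neq_implies_less less_one)
qed

lemma gdist_adj: "adj y z \<Longrightarrow> d x z \<le> d x y + 1"
  using gdist_triangle[of x z y] gdist_eq_1[of y z] by simp

lemma exists_closer:
  assumes "d x y = Suc n"
  obtains z where "adj y z" "d x z = n"
proof -
  have "(adj ^^ Suc n) x y" using assms gdist_path[of x y] by simp
  then obtain z where z: "(adj ^^ n) x z" "adj z y"
    by (rule relpowp_Suc_E)
  from z(1) have "d x z \<le> n" by (rule gdist_le)
  moreover have "Suc n \<le> d x z + 1" using gdist_adj[OF z(2), of x] assms by simp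
  ultimately show ?thesis using that[of z] z(2) adj_sym by auto
qed

text \<open>
  Two distinct points at the same distance from \<open>x\<close> are joined by a path that does not go
  further out: follow both geodesics towards \<open>x\<close> until they meet. Closing such a path by an edge or
  by one further vertex gives a cycle, which is how acyclicity enters.
\<close>

lemma path_below:
  assumes "y \<noteq> y'" "d x y = n" "d x y' = n"
  shows "\<exists>vs. distinct vs \<and> successively adj vs \<and> vs \<noteq> [] \<and> hd vs = y \<and> last vs = y' \<and>
     3 \<le> length vs \<and> (\<forall>v\<in>set vs. d x v \<le> n)"
  using assms
proof (induction n arbitrary: y y')
  case 0
  then show ?case by auto
next
  case (Suc n)
  obtain z where z: "adj y z" "d x z = n" using Suc.prems(2) by (rule exists_closer)
  obtain z' where z': "adj y' z'" "d x z' = n" using Suc.prems(3) by (rule exists_closer)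
  have yz: "adj z' y'" using z' adj_sym by auto
  show ?case
  proof (cases "z = z'")
    case True
    have "y \<noteq> z" "z \<noteq> y'" using Suc.prems(2,3) z(2) by (metis n_not_Suc_n)+
    then show ?thesis
      using Suc.prems(1,2,3) z yz[folded True] by (intro exI[of _ "[y, z, y']"]) simp
  next
    case False
    obtain vs where vs: "distinct vs" "successively adj vs" "vs \<noteq> []" "hd vs = z" "last vs = z'"
      "3 \<le> length vs" "\<forall>v\<in>set vs. d x v \<le> n"
      using Suc.IH[OF False z(2) z'(2)] by blast
    have "y \<notin> set vs" "y' \<notin> set vs" using vs(7) Suc.prems by auto
    then show ?thesis
      using Suc.prems vs z z' yz
      by (intro exI[of _ "y # vs @ [y']"])
        (auto simp: successively_append_iff successively_Cons)
  qed
qed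

lemma adj_dist_neq:
  assumes "adj y z" shows "d x y \<noteq> d x z"
proof
  assume eq: "d x y = d x z"
  have "y \<noteq> z" using assms adj_irrefl by auto
  from path_below[OF this eq refl] obtain vs where
    "distinct vs" "successively adj vs" "hd vs = y" "last vs = z" "3 \<le> length vs" by blast
  then have "graph_cycle adj vs" using assms adj_sym by (simp add: graph_cycle_def)
  then show False using no_cycle by blast
qed

text \<open>
  Two such neighbours would close the path between them, which stays strictly nearer to \<open>x\<close>
  than \<open>z\<close>, to a cycle through \<open>z\<close>.
\<close>

lemma closer_unique:
  assumes "adj z y" "adj z y'" "d x y + 1 = d x z" "d x y' + 1 = d x z"
  shows "y = y'"
proof (rule ccontr)
  assume ne: "y \<noteq> y'"
  from path_below[OF ne refl, of x] assms obtain vs where vs: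
    "distinct vs" "successively adj vs" "hd vs = y" "last vs = y'" "3 \<le> length vs" "vs \<noteq> []"
     "\<forall>v\<in>set vs. d x v \<le> d x y" by force
  have "z \<notin> set vs" using vs(7) assms by fastforce
  then have "graph_cycle adj (vs @ [z])" using vs assms adj_sym
    by (auto simp: graph_cycle_def successively_append_iff)
  then show False using no_cycle by blast
qed

text \<open>
  Adjacent vertices at equal distance would close the path between them to a cycle. Together with
  \<open>closer_unique\<close> this is the local structure on which all counting rests.
\<close>

lemma nbr_dist_cases:
  assumes "adj y z"
  shows "d x z + 1 = d x y \<or> d x z = d x y + 1"
proof -
  have "d x z \<le> d x y + 1" "d x y \<le> d x z + 1"
    using gdist_adj assms adj_sym by blast+
  with adj_dist_neq[OF assms, of x] show ?thesis by linarith
qed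

lemma closer_nbr:
  assumes "y \<noteq> x"
  obtains p where "{z \<in> nbrs y. d x z + 1 = d x y} = {p}"
proof -
  have "d x y \<noteq> 0" using assms by auto
  then obtain n where n: "d x y = Suc n" by (meson not0_implies_Suc)
  then obtain p where p: "adj y p" "d x p = n" by (rule exists_closer)
  have "{z \<in> nbrs y. d x z + 1 = d x y} = {p}"
  proof -
    have "z = p" if "adj y z" "d x z + 1 = d x y" for z
      using closer_unique[OF that(1) p(1), of x] that(2) n p(2) by simp
    moreover have "d x p + 1 = d x y" using n p(2) by simp
    ultimately show ?thesis using p(1) unfolding nbrs_def by blast
  qed
  then show ?thesis by (rule that)
qed

lemma card_closer_nbrs: "y \<noteq> x \<Longrightarrow> card {z \<in> nbrs y. d x z + 1 = d x y} = 1"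
  using closer_nbr[of y x] by (metis card_1_singleton_iff One_nat_def)

lemma farther_nbrs_eq: "{z \<in> nbrs y. d x z = d x y + 1} = nbrs y - {z \<in> nbrs y. d x z + 1 = d x y}"
  using nbr_dist_cases[of y _ x] by (auto simp: nbrs_def)

lemma card_farther_nbrs: "y \<noteq> x \<Longrightarrow> card {z \<in> nbrs y. d x z = d x y + 1} = q"
  using card_closer_nbrs[of y x] unfolding farther_nbrs_eq
  by (subst card_Diff_subset) (auto simp: card_nbrs)

lemma finite_ball: "finite {y. d x y \<le> n}"
proof (induction n)
  case 0
  then show ?case by (simp add: )
next
  case (Suc n)
  have "{y. d x y \<le> Suc n} \<subseteq> {y. d x y \<le> n} \<union> (\<Union>z\<in>{y. d x y \<le> n}. nbrs z)"
  proof
    fix y assume "y \<in> {y. d x y \<le> Suc n}"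
    then consider "d x y \<le> n" | "d x y = Suc n" by force
    then show "y \<in> {y. d x y \<le> n} \<union> (\<Union>z\<in>{y. d x y \<le> n}. nbrs z)"
    proof cases
      case 2
      then obtain z where "adj y z" "d x z = n" by (rule exists_closer)
      then show ?thesis using adj_sym by (auto simp: nbrs_def)
    qed auto
  qed
  then show ?case by (rule finite_subset) (simp add: Suc.IH)
qed

section \<open>Sums over neighbours and parity balls\<close>

definition nbr_sum :: "('a \<Rightarrow> complex) \<Rightarrow> 'a \<Rightarrow> complex" where
  "nbr_sum f x = (\<Sum>y\<in>nbrs x. f y)"

text \<open>
  Summing over the points of one parity within distance \<open>m\<close>, rather than over the sphere of
  radius \<open>m\<close>, gives a three-term recurrence without an exceptional first step. The sums are the
  Chebyshev polynomials of the second kind in the neighbour sum, up to scaling.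
\<close>

definition parity_ball :: "'a \<Rightarrow> nat \<Rightarrow> 'a set" where
  "parity_ball x m = {y. d x y \<le> m \<and> even (m + d x y)}"

definition ball_sum :: "nat \<Rightarrow> ('a \<Rightarrow> complex) \<Rightarrow> 'a \<Rightarrow> complex" where
  "ball_sum m f x = (\<Sum>y\<in>parity_ball x m. f y)"

lemma finite_parity_ball [simp]: "finite (parity_ball x m)"
  by (rule finite_subset[OF _ finite_ball[of x m]]) (auto simp: parity_ball_def)

lemma parity_ball_0: "parity_ball x 0 = {x}" by (auto simp: parity_ball_def)

lemma parity_ball_1: "parity_ball x (Suc 0) = nbrs x"
proof -
  have "d x y \<le> Suc 0 \<and> even (Suc (d x y)) \<longleftrightarrow> d x y = 1" for y
    by (cases "d x y") auto
  then have "d x y \<le> Suc 0 \<and> even (Suc (d x y)) \<longleftrightarrow> adj x y" for y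
    unfolding gdist_eq_1 .
  then show ?thesis by (auto simp: parity_ball_def nbrs_def)
qed

lemma ball_sum_0: "ball_sum 0 f x = f x" by (simp add: ball_sum_def parity_ball_0)
lemma ball_sum_1: "ball_sum (Suc 0) f = nbr_sum f" by (simp add: ball_sum_def parity_ball_1 nbr_sum_def fun_eq_iff)

text \<open>
  Each neighbour of \<open>x\<close> changes the distance to \<open>y\<close> by one; so if \<open>y\<close> is inside the ball of radius
  \<open>m\<close> all \<open>q + 1\<close> neighbours count, and on the sphere of radius \<open>m + 2\<close> only the nearer one.
\<close>

lemma card_nbrs_parity_ball:
  "card {z \<in> nbrs x. y \<in> parity_ball z (Suc m)} =
    (if y \<in> parity_ball x (Suc (Suc m)) then 1 else 0) + q * (if y \<in> parity_ball x m then 1 else 0)"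
proof (cases "y = x")
  case True
  have "{z \<in> nbrs x. y \<in> parity_ball z (Suc m)} = (if even m then nbrs x else {})"
  proof -
    have "d z y = 1" if "adj x z" for z using that True gdist_eq_1[of z y] adj_sym[of x z] by simp
    then show ?thesis by (auto simp: parity_ball_def nbrs_def)
  qed
  then show ?thesis using True by (auto simp: parity_ball_def card_nbrs)
next
  case False
  have c1: "card {z \<in> nbrs x. d y z + 1 = d y x} = 1" "card {z \<in> nbrs x. d y z = d y x + 1} = q"
    using False card_closer_nbrs card_farther_nbrs by auto
  have cs: "d y z + 1 = d y x \<or> d y z = d y x + 1" if "z \<in> nbrs x" for z
    using nbr_dist_cases that by (auto simp: nbrs_def)
  have eqv: "y \<in> parity_ball z (Suc m) \<longleftrightarrow> even (m + d y x) \<and> d y z \<le> Suc m" if "z \<in> nbrs x" for z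
  proof -
    have "even (Suc m + d y z) \<longleftrightarrow> even (m + d y x)"
      using cs[OF that] by (metis add_Suc_right add_Suc_shift even_Suc Suc_eq_plus1)
    then show ?thesis by (auto simp: parity_ball_def gdist_sym[of z])
  qed
  consider "odd (m + d y x)" | "even (m + d y x)" "d y x \<le> m" | "even (m + d y x)" "d y x = m + 2"
    | "even (m + d y x)" "d y x > m + 2"
    by (cases "even (m + d y x)"; cases "d y x \<le> m"; cases "d y x = m + 2"; cases "d y x = m+1"; auto)
  then show ?thesis
  proof cases
    case 1
    then have "{z \<in> nbrs x. y \<in> parity_ball z (Suc m)} = {}" using eqv by auto
    with 1 show ?thesis by (auto simp: parity_ball_def gdist_sym[of x])
  next
    case 2
    then have "{z \<in> nbrs x. y \<in> parity_ball z (Suc m)} = nbrs x" using eqv cs by fastforce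
    with 2 show ?thesis by (auto simp: parity_ball_def gdist_sym[of x] card_nbrs)
  next
    case 3
    then have "{z \<in> nbrs x. y \<in> parity_ball z (Suc m)} = {z \<in> nbrs x. d y z + 1 = d y x}"
      using eqv cs by fastforce
    with 3 c1 show ?thesis by (auto simp: parity_ball_def gdist_sym[of x])
  next
    case 4
    then have "{z \<in> nbrs x. y \<in> parity_ball z (Suc m)} = {}" using eqv cs by fastforce
    with 4 show ?thesis by (auto simp: parity_ball_def gdist_sym[of x])
  qed
qed

lemma nbr_sum_ball_sum_Suc:
  "nbr_sum (ball_sum (Suc m) f) x = ball_sum (Suc (Suc m)) f x + of_nat q * ball_sum m f x"
proof -
  define K where "K = {y. d x y \<le> Suc (Suc m)}"
  have fK: "finite K" unfolding K_def by (rule finite_ball)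
  have sub: "parity_ball z (Suc m) \<subseteq> K" if "z \<in> nbrs x" for z
  proof
    fix y assume "y \<in> parity_ball z (Suc m)"
    moreover have "d x z = 1" using that gdist_eq_1 by (auto simp: nbrs_def)
    ultimately show "y \<in> K" using gdist_triangle[of x y z] by (auto simp: parity_ball_def K_def)
  qed
  have subs: "parity_ball x (Suc (Suc m)) \<subseteq> K" "parity_ball x m \<subseteq> K" by (auto simp: parity_ball_def K_def)
  have ind: "(\<Sum>y\<in>S. f y) = (\<Sum>y\<in>K. (if y \<in> S then 1 else 0) * f y)" if "S \<subseteq> K" for S
    using that fK by (simp add: if_distrib[of "\<lambda>c. c * _"] sum.If_cases Int_absorb1 cong: if_cong)
  have "nbr_sum (ball_sum (Suc m) f) x = (\<Sum>z\<in>nbrs x. \<Sum>y\<in>K. (if y \<in> parity_ball z (Suc m) then 1 else 0) * f y)"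
    unfolding nbr_sum_def ball_sum_def by (intro sum.cong refl ind sub)
  also have "\<dots> = (\<Sum>y\<in>K. (\<Sum>z\<in>nbrs x. (if y \<in> parity_ball z (Suc m) then 1 else 0)) * f y)"
    by (subst sum.swap) (simp add: sum_distrib_right)
  also have "\<dots> = (\<Sum>y\<in>K. of_nat (card {z \<in> nbrs x. y \<in> parity_ball z (Suc m)}) * f y)"
    by (intro sum.cong refl) (simp add: sum.If_cases Int_def)
  also have "\<dots> = (\<Sum>y\<in>K. (if y \<in> parity_ball x (Suc (Suc m)) then 1 else 0) * f y
        + of_nat q * ((if y \<in> parity_ball x m then 1 else 0) * f y))"
    by (intro sum.cong refl) (simp add: card_nbrs_parity_ball algebra_simps)
  also have "\<dots> = ball_sum (Suc (Suc m)) f x + of_nat q * ball_sum m f x"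
    unfolding sum.distrib sum_distrib_left[symmetric] ball_sum_def
    by (simp only: ind[OF subs(1)] ind[OF subs(2)])
  finally show ?thesis .
qed

lemma card_parity_ball: "real (card (parity_ball x m)) * (real q - 1) = real q ^ (m + 1) - 1"
proof -
  have c: "ball_sum m (\<lambda>_. 1) x = of_nat (card (parity_ball x m))" for m x by (simp add: ball_sum_def)
  have "\<forall>x. of_nat (card (parity_ball x m)) * (of_nat q - 1) = of_nat q ^ (m + 1) - (1::complex)"
  proof (induction m rule: induct_nat_012)
    case 0
    show ?case by (simp add: parity_ball_0)
  next
    case 1
    show ?case by (simp add: parity_ball_1 card_nbrs algebra_simps)
  next
    case (ge2 m)
    show ?case
    proof
      fix x
      have "(of_nat q - 1) * nbr_sum (ball_sum (Suc m) (\<lambda>_. 1)) x = (\<Sum>y\<in>nbrs x. of_nat q ^ (m + 2) - (1::complex))"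
        unfolding nbr_sum_def sum_distrib_left
        by (intro sum.cong refl) (use ge2(2) in \<open>simp add: c algebra_simps\<close>)
      also have "\<dots> = of_nat (q + 1) * (of_nat q ^ (m + 2) - 1)" by (simp add: card_nbrs)
      finally have "(of_nat q - 1) * (of_nat (card (parity_ball x (Suc (Suc m)))) + of_nat q * of_nat (card (parity_ball x m)))
        = of_nat (q + 1) * (of_nat q ^ (m + 2) - (1::complex))"
        unfolding nbr_sum_ball_sum_Suc c .
      moreover have "of_nat (card (parity_ball x m)) * (of_nat q - 1) = of_nat q ^ (m + 1) - (1::complex)"
        using ge2(1) by blast
      moreover have "of_nat (card (parity_ball x (Suc (Suc m)))) * (of_nat q - 1) =
         (of_nat q - 1) * (of_nat (card (parity_ball x (Suc (Suc m)))) + of_nat q * of_nat (card (parity_ball x m))) -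
         of_nat q * (of_nat (card (parity_ball x m)) * (of_nat q - (1::complex)))"
        by (simp add: algebra_simps)
      ultimately have "of_nat (card (parity_ball x (Suc (Suc m)))) * (of_nat q - 1) =
         of_nat (q + 1) * (of_nat q ^ (m + 2) - 1) - of_nat q * (of_nat q ^ (m + 1) - (1::complex))"
        by (simp only:)
      also have "\<dots> = of_nat q ^ (Suc (Suc m) + 1) - 1" by (simp add: algebra_simps)
      finally show "of_nat (card (parity_ball x (Suc (Suc m)))) * (of_nat q - 1) = of_nat q ^ (Suc (Suc m) + 1) - (1::complex)" .
    qed
  qed
  then have "complex_of_real (real (card (parity_ball x m)) * (real q - 1)) = of_real (real q ^ (m + 1) - 1)"
    by simp
  then show ?thesis by (simp only: of_real_eq_iff)
qed

lemma card_parity_ball_le: "real (card (parity_ball x m)) \<le> 2 * real q ^ m"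
proof -
  have q: "real q \<ge> 2" using q_ge_2 by simp
  have "real (card (parity_ball x m)) * (real q - 1) \<le> real q * real q ^ m"
    unfolding card_parity_ball by simp
  also have "\<dots> \<le> (2 * (real q - 1)) * real q ^ m" using q by (intro mult_right_mono) auto
  finally have "real (card (parity_ball x m)) * (real q - 1) \<le> (2 * real q ^ m) * (real q - 1)" by (simp add: algebra_simps)
  then show ?thesis using q by (simp add: mult_le_cancel_right)
qed

end

section \<open>Coefficient sequences\<close>

text \<open>
  The effect of the neighbour sum on coefficients: if \<open>T X\<^sub>0 = X\<^sub>1\<close> and
  \<open>T X\<^sub>m\<^sub>+\<^sub>1 = X\<^sub>m\<^sub>+\<^sub>2 + q X\<^sub>m\<close>, it sends the coefficients of \<open>\<Sum>m. c m * X\<^sub>m\<close> to those of its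
  image under \<open>T\<close>. It serves both the operators on the tree and the scalar Chebyshev functions.
\<close>

definition shift_coeff :: "nat \<Rightarrow> (nat \<Rightarrow> complex) \<Rightarrow> nat \<Rightarrow> complex" where
  "shift_coeff q c m = (if m = 0 then 0 else c (m - 1)) + of_nat q * c (Suc m)"

text \<open>
  Such decay makes all rearrangements below absolutely convergent, and the coefficients of the
  exponential have it.
\<close>

definition rapid :: "(nat \<Rightarrow> complex) \<Rightarrow> bool" where
  "rapid c \<longleftrightarrow> (\<forall>R\<ge>1. \<exists>C\<ge>0. \<forall>m. norm (c m) * R ^ m \<le> C)"

text \<open>
  The coefficients of the \<open>j\<close>-th power of the neighbour sum in terms of sums over parity balls.
\<close>

definition pow_coeff :: "nat \<Rightarrow> nat \<Rightarrow> nat \<Rightarrow> complex" where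
  "pow_coeff q j = (shift_coeff q ^^ j) (\<lambda>m. if m = 0 then 1 else 0)"

definition exp_coeff :: "nat \<Rightarrow> complex \<Rightarrow> nat \<Rightarrow> complex" where
  "exp_coeff q \<kappa> m = (\<Sum>j. \<kappa> ^ j / fact j * pow_coeff q j m)"

lemma shift_coeff_bound:
  assumes "R \<ge> 1" "\<And>m. norm (c m) * R ^ m \<le> C"
  shows "norm (shift_coeff q c m) * R ^ m \<le> (real q + 1) * R * C"
proof -
  have C: "C \<ge> 0" using order_trans[OF norm_ge_zero[of "c 0"], of C] assms(2)[of 0] by simp
  have 1: "norm (if m = 0 then 0 else c (m - 1)) * R ^ m \<le> R * C"
  proof (cases m)
    case (Suc n)
    then show ?thesis using mult_left_mono[OF assms(2)[of n], of R] assms(1) by (simp add: mult.left_commute)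
  qed (use C assms(1) in auto)
  have "norm (c (Suc m)) * R ^ m \<le> norm (c (Suc m)) * R ^ Suc m"
    using assms(1) by (intro mult_left_mono power_increasing) auto
  also have "\<dots> \<le> C" by (rule assms(2))
  also have "\<dots> \<le> R * C" using assms(1) C mult_right_mono[of 1 R C] by simp
  finally have "real q * (norm (c (Suc m)) * R ^ m) \<le> real q * (R * C)" by (intro mult_left_mono) auto
  then have 2: "norm (of_nat q * c (Suc m)) * R ^ m \<le> real q * R * C" by (simp add: norm_mult mult.assoc)
  have "norm (shift_coeff q c m) * R ^ m \<le> (norm (if m = 0 then 0 else c (m - 1)) + norm (of_nat q * c (Suc m))) * R ^ m"
    unfolding shift_coeff_def using assms(1) by (intro mult_right_mono norm_triangle_ineq) auto
  also have "\<dots> \<le> R * C + real q * R * C" using 1 2 by (simp add: distrib_right)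
  finally show ?thesis by (simp add: algebra_simps)
qed

lemma rapid_shift_coeff: assumes "rapid c" shows "rapid (shift_coeff q c)"
  unfolding rapid_def
proof (intro allI impI)
  fix R :: real assume R: "1 \<le> R"
  then obtain C where C: "C \<ge> 0" "\<And>m. norm (c m) * R ^ m \<le> C" using assms unfolding rapid_def by blast
  show "\<exists>C\<ge>0. \<forall>m. cmod (shift_coeff q c m) * R ^ m \<le> C"
    using shift_coeff_bound[OF R C(2)] C(1) R by (intro exI[of _ "(real q + 1) * R * C"]) auto
qed

lemma rapid_diff_scale:
  assumes "rapid c" "rapid c'" shows "rapid (\<lambda>m. c m - a * c' m)"
  unfolding rapid_def
proof (intro allI impI)
  fix R :: real assume R: "1 \<le> R"
  obtain C where C: "C \<ge> 0" "\<And>m. norm (c m) * R ^ m \<le> C" using assms R unfolding rapid_def by blast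
  obtain C' where C': "C' \<ge> 0" "\<And>m. norm (c' m) * R ^ m \<le> C'" using assms R unfolding rapid_def by blast
  show "\<exists>C\<ge>0. \<forall>m. cmod (c m - a * c' m) * R ^ m \<le> C"
  proof (intro exI[of _ "C + norm a * C'"] conjI allI)
    show "0 \<le> C + cmod a * C'" using C C' by simp
    fix m
    have "cmod (c m - a * c' m) * R ^ m \<le> (norm (c m) + norm a * norm (c' m)) * R ^ m"
      using R norm_triangle_ineq4[of "c m" "a * c' m"] by (intro mult_right_mono) (auto simp: norm_mult)
    also have "\<dots> \<le> C + norm a * C'"
      using C(2)[of m] mult_left_mono[OF C'(2)[of m], of "norm a"] by (simp add: algebra_simps)
    finally show "cmod (c m - a * c' m) * R ^ m \<le> C + cmod a * C'" .
  qed
qed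

lemma rapid_summable:
  assumes "rapid c" "R \<ge> 1" "\<And>m. norm (X m) \<le> C * R ^ m"
  shows "summable (\<lambda>m. norm (c m * X m))"
proof -
  obtain C' where C': "\<And>m. norm (c m) * (2 * R) ^ m \<le> C'"
    using assms(1,2) unfolding rapid_def by (metis (no_types, opaque_lifting) mult_2 add_increasing2 order_trans zero_le_one)
  have C: "C \<ge> 0" using order_trans[OF norm_ge_zero[of "X 0"], of C] assms(3)[of 0] by simp
  show ?thesis
  proof (rule summable_comparison_test')
    show "summable (\<lambda>m. C' * C * (1/2) ^ m)" by (intro summable_mult summable_geometric) auto
    fix m
    have "norm (c m * X m) \<le> norm (c m) * (C * R ^ m)" unfolding norm_mult by (intro mult_left_mono assms(3)) auto
    \<comment> \<open>Decay against the doubled radius leaves a summable geometric factor.\<close>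
    also have "\<dots> = (norm (c m) * (2 * R) ^ m) * (C * (1/2) ^ m)" by (simp add: power_mult_distrib power_one_over field_simps)
    also have "\<dots> \<le> C' * (C * (1/2) ^ m)" using C by (intro mult_right_mono C') auto
    finally show "norm (norm (c m * X m)) \<le> C' * C * (1/2) ^ m" by simp
  qed
qed

text \<open>
  Summation by parts; \<open>Y\<close> stands for the image of \<open>X\<close> under the neighbour sum.
\<close>

lemma shift_coeff_pairing:
  assumes "rapid c" "R \<ge> 1" "\<And>m. norm (X m) \<le> C * R ^ m"
    and "Y 0 = X (Suc 0)" "\<And>m. Y (Suc m) = X (Suc (Suc m)) + of_nat q * X m"
  shows "summable (\<lambda>m. c m * Y m)" "(\<Sum>m. shift_coeff q c m * X m) = (\<Sum>m. c m * Y m)"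
proof -
  have C: "C \<ge> 0" using order_trans[OF norm_ge_zero[of "X 0"], of C] assms(3)[of 0] by simp
  have b: "norm (X (Suc m)) \<le> (C * R) * R ^ m" for m using assms(3)[of "Suc m"] by (simp add: mult_ac)
  have s1: "summable (\<lambda>m. c m * X (Suc m))"
    by (rule summable_norm_cancel, rule rapid_summable[OF assms(1,2) b])
  have rs: "rapid (shift_coeff q c)" by (rule rapid_shift_coeff[OF assms(1)])
  have sc: "summable (\<lambda>m. shift_coeff q c m * X m)"
    by (rule summable_norm_cancel, rule rapid_summable[OF rs assms(2,3)])
  define Z where "Z m = (if m = 0 then 0 else c (m - 1)) * X m" for m
  have ZS: "Z (Suc m) = c m * X (Suc m)" for m by (simp add: Z_def)
  have sZ: "summable Z" using s1 by (subst summable_Suc_iff[symmetric]) (simp add: ZS)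
  have Zs: "suminf Z = (\<Sum>m. c m * X (Suc m))"
    using suminf_split_head[OF sZ] by (simp add: ZS) (simp add: Z_def)
  have split: "shift_coeff q c m * X m = Z m + of_nat q * (c (Suc m) * X m)" for m
    by (simp add: shift_coeff_def Z_def algebra_simps)
  have s2: "summable (\<lambda>m. of_nat q * (c (Suc m) * X m))"
    using summable_diff[OF sc sZ] by (simp add: split)
  define W where "W m = (if m = 0 then 0 else of_nat q * (c m * X (m - 1)))" for m
  have WS: "W (Suc m) = of_nat q * (c (Suc m) * X m)" for m by (simp add: W_def)
  have sW: "summable W" using s2 by (subst summable_Suc_iff[symmetric]) (simp add: WS)
  have Ws: "suminf W = (\<Sum>m. of_nat q * (c (Suc m) * X m))"
    using suminf_split_head[OF sW] by (simp add: WS) (simp add: W_def)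
  have Y: "c m * Y m = c m * X (Suc m) + W m" for m
    using assms(4,5) by (cases m) (auto simp: W_def algebra_simps)
  show "summable (\<lambda>m. c m * Y m)" unfolding Y by (intro summable_add s1 sW)
  show "(\<Sum>m. shift_coeff q c m * X m) = (\<Sum>m. c m * Y m)"
    unfolding Y split suminf_add[OF sZ s2, symmetric] suminf_add[OF s1 sW, symmetric] Zs Ws ..
qed

lemma pow_coeff_0: "pow_coeff q 0 m = (if m = 0 then 1 else 0)" by (simp add: pow_coeff_def)
lemma pow_coeff_Suc: "pow_coeff q (Suc j) = shift_coeff q (pow_coeff q j)" by (simp add: pow_coeff_def)

lemma pow_coeff_bound: "R \<ge> 1 \<Longrightarrow> norm (pow_coeff q j m) * R ^ m \<le> ((real q + 1) * R) ^ j"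
proof (induction j arbitrary: m)
  case 0
  then show ?case by (simp add: pow_coeff_0)
next
  case (Suc j)
  then show ?case using shift_coeff_bound[of R "pow_coeff q j" "((real q + 1) * R) ^ j" q m] by (simp add: pow_coeff_Suc mult_ac)
qed

lemma rapid_pow_coeff: "rapid (pow_coeff q j)"
  unfolding rapid_def
proof (intro allI impI)
  fix R :: real assume "1 \<le> R"
  then show "\<exists>C\<ge>0. \<forall>m. cmod (pow_coeff q j m) * R ^ m \<le> C"
    using pow_coeff_bound[of R q j] by (intro exI[of _ "((real q + 1) * R) ^ j"]) auto
qed

lemma infsum_eq_suminf:
  fixes f :: "nat \<Rightarrow> complex"
  assumes "summable (\<lambda>i. norm (f i))"
  shows "infsum f UNIV = suminf f"
  by (rule infsumI, rule norm_summable_imp_has_sum[OF assms summable_sums[OF summable_norm_cancel[OF assms]]])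

text \<open>
  Fubini for series dominated by a product, in the form in which it is used throughout.
\<close>

lemma suminf_swap_dominated:
  fixes a :: "nat \<Rightarrow> nat \<Rightarrow> complex"
  assumes "\<And>i j. norm (a i j) \<le> u i * v j" "summable u" "summable v" "\<And>i. u i \<ge> 0" "\<And>j. v j \<ge> 0"
  shows "(\<Sum>i. \<Sum>j. a i j) = (\<Sum>j. \<Sum>i. a i j)"
proof -
  have us: "(\<lambda>i. norm (u i)) summable_on UNIV" "(\<lambda>i. norm (v i)) summable_on UNIV"
    using assms by (auto intro!: norm_summable_imp_summable_on simp: )
  have vs: "(v has_sum suminf v) UNIV"
    using norm_summable_imp_has_sum[of v "suminf v"] assms by (simp add: summable_sums)
  have "(\<lambda>(i, j). u i * v j) summable_on UNIV \<times> UNIV"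
  proof (rule summable_on_SigmaI)
    show "((\<lambda>j. case (i, j) of (i, j) \<Rightarrow> u i * v j) has_sum u i * suminf v) UNIV" for i
      using has_sum_cmult_right[OF vs] by simp
    show "(\<lambda>i. u i * suminf v) summable_on UNIV"
      using us(1) assms(4) by (intro summable_on_cmult_left) simp
  qed (use assms in auto)
  then have "(\<lambda>x. norm (case x of (i, j) \<Rightarrow> u i * v j)) summable_on UNIV \<times> UNIV"
    using assms(4,5) by (simp add: abs_mult case_prod_unfold)
  then have "(\<lambda>x. norm (case x of (i, j) \<Rightarrow> a i j)) summable_on UNIV \<times> UNIV"
    by (rule Infinite_Sum.abs_summable_on_comparison_test) (use assms in \<open>auto simp: abs_mult\<close>)
  then have sm: "(\<lambda>(i,j). a i j) summable_on UNIV \<times> UNIV"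
    by (rule Infinite_Sum.abs_summable_summable)
  have row: "summable (\<lambda>j. norm (a i j))" for i
    by (rule summable_comparison_test'[OF summable_mult[OF assms(3), of "u i"]]) (use assms(1) in auto)
  have col: "summable (\<lambda>i. norm (a i j))" for j
    by (rule summable_comparison_test'[OF summable_mult2[OF assms(2), of "v j"]]) (use assms(1) in auto)
  have nr: "norm (\<Sum>j. a i j) \<le> u i * suminf v" for i
  proof -
    have "norm (\<Sum>j. a i j) \<le> (\<Sum>j. norm (a i j))" by (rule summable_norm[OF row])
    also have "\<dots> \<le> (\<Sum>j. u i * v j)" by (intro suminf_le assms(1) row summable_mult assms(3))
    finally show ?thesis by (simp add: suminf_mult[OF assms(3)])
  qed
  have nc: "norm (\<Sum>i. a i j) \<le> suminf u * v j" for j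
  proof -
    have "norm (\<Sum>i. a i j) \<le> (\<Sum>i. norm (a i j))" by (rule summable_norm[OF col])
    also have "\<dots> \<le> (\<Sum>i. u i * v j)" by (intro suminf_le assms(1) col summable_mult2 assms(2))
    finally show ?thesis by (simp add: suminf_mult2[OF assms(2)])
  qed
  have R: "summable (\<lambda>i. norm (\<Sum>j. a i j))"
    by (rule summable_comparison_test'[OF summable_mult2[OF assms(2), of "suminf v"]]) (use nr in auto)
  have Cc: "summable (\<lambda>j. norm (\<Sum>i. a i j))"
    by (rule summable_comparison_test'[OF summable_mult[OF assms(3), of "suminf u"]]) (use nc in auto)
  have "(\<Sum>i. \<Sum>j. a i j) = (\<Sum>\<^sub>\<infinity>i. \<Sum>\<^sub>\<infinity>j. a i j)"
    by (simp only: infsum_eq_suminf[OF row] infsum_eq_suminf[OF R])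
  also have "\<dots> = (\<Sum>\<^sub>\<infinity>j. \<Sum>\<^sub>\<infinity>i. a i j)" by (rule infsum_swap_banach[OF sm])
  also have "\<dots> = (\<Sum>j. \<Sum>i. a i j)"
    by (simp only: infsum_eq_suminf[OF col] infsum_eq_suminf[OF Cc])
  finally show ?thesis .
qed

lemma summable_exp_real: "summable (\<lambda>j. (x::real) ^ j / fact j)"
  using summable_exp_generic[of x] by (simp add: divide_inverse mult.commute)

lemma exp_sums_complex: "(\<lambda>j. (x::complex) ^ j / fact j) sums exp x"
  using exp_converges[of x] by (simp add: scaleR_conv_of_real divide_inverse mult.commute)

lemma exp_coeff_summable: "summable (\<lambda>j. norm (\<kappa> ^ j / fact j * pow_coeff q j m))"
proof (rule summable_comparison_test'[OF summable_exp_real[of "norm \<kappa> * (real q + 1)"]])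
  fix j
  have "norm (pow_coeff q j m) \<le> (real q + 1) ^ j" using pow_coeff_bound[of 1 q j m] by simp
  from mult_left_mono[OF this, of "norm \<kappa> ^ j / fact j"]
  show "norm (norm (\<kappa> ^ j / fact j * pow_coeff q j m)) \<le> (norm \<kappa> * (real q + 1)) ^ j / fact j"
    by (simp add: norm_mult norm_divide norm_power power_mult_distrib)
qed

lemma rapid_exp_coeff: "rapid (exp_coeff q \<kappa>)"
  unfolding rapid_def
proof (intro allI impI)
  fix R :: real assume R: "1 \<le> R"
  let ?E = "\<Sum>j. (norm \<kappa> * ((real q + 1) * R)) ^ j / fact j"
  have "norm (exp_coeff q \<kappa> m) * R ^ m \<le> ?E" for m
  proof -
    have "norm (exp_coeff q \<kappa> m) * R ^ m \<le> (\<Sum>j. norm (\<kappa> ^ j / fact j * pow_coeff q j m)) * R ^ m"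
      unfolding exp_coeff_def using R by (intro mult_right_mono summable_norm exp_coeff_summable) auto
    also have "\<dots> = (\<Sum>j. norm (\<kappa> ^ j / fact j * pow_coeff q j m) * R ^ m)"
      by (rule suminf_mult2[OF exp_coeff_summable])
    also have "\<dots> \<le> ?E"
    proof (intro suminf_le summable_mult2 exp_coeff_summable summable_exp_real)
      fix j
      show "norm (\<kappa> ^ j / fact j * pow_coeff q j m) * R ^ m \<le> (norm \<kappa> * ((real q + 1) * R)) ^ j / fact j"
        using mult_left_mono[OF pow_coeff_bound[OF R, of q j m], of "norm \<kappa> ^ j / fact j"]
        by (simp add: norm_mult norm_divide norm_power power_mult_distrib mult.assoc)
    qed
    finally show ?thesis .
  qed
  moreover have "?E \<ge> 0" using R by (intro suminf_nonneg summable_exp_real) auto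
  ultimately show "\<exists>C\<ge>0. \<forall>m. norm (exp_coeff q \<kappa> m) * R ^ m \<le> C" by blast
qed

lemma exp_coeff_pairing:
  assumes "R \<ge> 1" "\<And>m. norm (X m) \<le> C * R ^ m"
  shows "(\<Sum>j. \<kappa> ^ j / fact j * (\<Sum>m. pow_coeff q j m * X m)) = (\<Sum>m. exp_coeff q \<kappa> m * X m)"
proof -
  have C: "C \<ge> 0" using order_trans[OF norm_ge_zero[of "X 0"], of C] assms(2)[of 0] by simp
  have sm: "summable (\<lambda>m. pow_coeff q j m * X m)" for j
    by (rule summable_norm_cancel, rule rapid_summable[OF rapid_pow_coeff assms])
  have "(\<Sum>j. \<kappa> ^ j / fact j * (\<Sum>m. pow_coeff q j m * X m)) = (\<Sum>j. \<Sum>m. \<kappa> ^ j / fact j * pow_coeff q j m * X m)"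
    by (simp add: suminf_mult[OF sm, symmetric] mult.assoc)
  also have "\<dots> = (\<Sum>m. \<Sum>j. \<kappa> ^ j / fact j * pow_coeff q j m * X m)"
  proof (rule suminf_swap_dominated)
    show "summable (\<lambda>j. (norm \<kappa> * ((real q + 1) * (2 * R))) ^ j / fact j)" by (rule summable_exp_real)
    show "summable (\<lambda>m. C * (1/2::real) ^ m)" by (intro summable_mult summable_geometric) auto
    fix j m
    have t: "norm (pow_coeff q j m) * (2 * R) ^ m \<le> ((real q + 1) * (2 * R)) ^ j" using assms(1) by (intro pow_coeff_bound) auto
    have "norm (\<kappa> ^ j / fact j * pow_coeff q j m * X m) \<le> norm \<kappa> ^ j / fact j * norm (pow_coeff q j m) * (C * R ^ m)"
      unfolding norm_mult norm_divide norm_power norm_fact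
      by (intro mult_mono assms(2) mult_nonneg_nonneg) auto
    also have "\<dots> = norm \<kappa> ^ j / fact j * (norm (pow_coeff q j m) * (2 * R) ^ m) * (C * (1/2) ^ m)"
      by (simp add: power_mult_distrib power_one_over field_simps)
    also have "\<dots> \<le> norm \<kappa> ^ j / fact j * ((real q + 1) * (2 * R)) ^ j * (C * (1/2) ^ m)"
      using C by (intro mult_right_mono mult_left_mono t) auto
    also have "\<dots> = (norm \<kappa> * ((real q + 1) * (2 * R))) ^ j / fact j * (C * (1/2) ^ m)" by (simp add: power_mult_distrib)
    finally show "norm (\<kappa> ^ j / fact j * pow_coeff q j m * X m) \<le> (norm \<kappa> * ((real q + 1) * (2 * R))) ^ j / fact j * (C * (1/2) ^ m)" .
  qed (use C assms(1) in auto)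
  also have "\<dots> = (\<Sum>m. exp_coeff q \<kappa> m * X m)"
    unfolding exp_coeff_def by (subst suminf_mult2[OF summable_norm_cancel[OF exp_coeff_summable]]) auto
  finally show ?thesis .
qed

section \<open>Chebyshev functions and Cauchy estimates on circles\<close>

text \<open>
  With \<open>w = exp (\<i> \<theta>)\<close> this is \<open>sqrt q ^ m * 2 \<i> sin ((m + 1) \<theta>)\<close>: a Chebyshev polynomial multiplied
  by \<open>w - 1 / w\<close>. The multiplication turns expansions in Chebyshev polynomials into Laurent series
  that are odd under \<open>w \<mapsto> 1 / w\<close>, so that coefficients can be read off.
\<close>

definition cheb :: "nat \<Rightarrow> complex \<Rightarrow> nat \<Rightarrow> complex" where
  "cheb q w m = of_real (sqrt q ^ m) * (w ^ Suc m - inverse w ^ Suc m)"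

definition eigval :: "nat \<Rightarrow> complex \<Rightarrow> complex" where
  "eigval q w = of_real (sqrt q) * (w + inverse w)"

lemma cheb_rec:
  assumes "w \<noteq> 0"
  shows "eigval q w * cheb q w 0 = cheb q w (Suc 0)"
    "eigval q w * cheb q w (Suc m) = cheb q w (Suc (Suc m)) + of_nat q * cheb q w m"
proof -
  have s: "complex_of_real (sqrt q) * of_real (sqrt q) = of_nat q"
    by (simp flip: of_real_mult)
  show "eigval q w * cheb q w 0 = cheb q w (Suc 0)"
    by (simp add: eigval_def cheb_def algebra_simps)
  have w: "w * (inverse w * x) = x" "inverse w * (w * x) = x" for x using assms by simp_all
  have "cheb q w (Suc (Suc m)) + of_nat q * cheb q w m = cheb q w (Suc (Suc m)) + complex_of_real (sqrt q) * of_real (sqrt q) * cheb q w m"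
    by (simp only: s)
  also have "\<dots> = eigval q w * cheb q w (Suc m)"
    unfolding cheb_def eigval_def power_Suc of_real_mult
    using assms by (simp add: algebra_simps w)
  finally show "eigval q w * cheb q w (Suc m) = cheb q w (Suc (Suc m)) + of_nat q * cheb q w m" by simp
qed

lemma cheb_bound:
  assumes "norm w \<ge> 1"
  shows "norm (cheb q w m) \<le> 2 * norm w * (sqrt q * norm w) ^ m"
proof -
  have "inverse (norm w) \<le> norm w" using assms by (meson inverse_le_1_iff order_trans)
  then have "inverse (norm w) ^ Suc m \<le> norm w ^ Suc m" using assms by (intro power_mono) auto
  moreover have "norm (w ^ Suc m - inverse w ^ Suc m) \<le> norm w ^ Suc m + inverse (norm w) ^ Suc m"
    by (metis norm_triangle_ineq4 norm_power norm_inverse)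
  ultimately have "norm (w ^ Suc m - inverse w ^ Suc m) \<le> 2 * norm w ^ Suc m" by linarith
  then have "sqrt q ^ m * norm (w ^ Suc m - inverse w ^ Suc m) \<le> sqrt q ^ m * (2 * norm w ^ Suc m)"
    by (intro mult_left_mono) auto
  moreover have "norm (cheb q w m) = sqrt q ^ m * norm (w ^ Suc m - inverse w ^ Suc m)"
    unfolding cheb_def norm_mult norm_of_real by simp
  ultimately show ?thesis by (simp add: power_mult_distrib mult_ac)
qed

lemma sum_roots_of_unity:
  assumes "K > 0" "\<zeta> = exp (2 * of_real pi * \<i> / of_nat K)"
  shows "(\<Sum>j<K. (\<zeta> ^ n) ^ j) = (if K dvd n then of_nat K else 0)"
proof -
  have z: "\<zeta> ^ n = exp (2 * of_real pi * \<i> * of_nat n / of_nat K)"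
    unfolding assms(2) exp_of_nat_mult[symmetric] by (simp add: mult_ac)
  have e: "\<zeta> ^ n = 1 \<longleftrightarrow> K dvd n" unfolding z using assms(1) by (intro complex_root_unity_eq_1) auto
  have K: "(\<zeta> ^ n) ^ K = 1"
  proof -
    have "\<zeta> ^ K = 1" unfolding assms(2) exp_of_nat_mult[symmetric] using assms(1) by simp
    then show ?thesis by (metis power_commutes power_mult mult.commute power_one)
  qed
  show ?thesis
  proof (cases "K dvd n")
    case True
    then show ?thesis using e by simp
  next
    case False
    then have "\<zeta> ^ n \<noteq> 1" using e by simp
    from geometric_sum[OF this, of K] K False show ?thesis by simp
  qed
qed

text \<open>
  Cauchy's estimate for a Laurent polynomial, by averaging over roots of unity instead of
  integrating over the circle. The order of the roots exceeds all differences of exponents,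
  so the average isolates one coefficient exactly.
\<close>

lemma laurent_coeff_bound_finite:
  fixes a :: "nat \<Rightarrow> complex"
  assumes "\<rho> > 0" "m < N"
    and "\<And>w. norm w = \<rho> \<Longrightarrow> norm (\<Sum>n<N. a n * (w ^ Suc n - inverse w ^ Suc n)) \<le> B"
  shows "norm (a m) * \<rho> ^ Suc m \<le> B"
proof -
  \<comment> \<open>Sums of two exponents are at most \<open>2 * N\<close>, so none but the wanted one is divisible by \<open>K\<close>.\<close>
  define K where "K = 2 * N + 1"
  define \<zeta> :: complex where "\<zeta> = exp (2 * of_real pi * \<i> / of_nat K)"
  have K: "K > 0" by (simp add: K_def)
  have n1: "norm \<zeta> = 1" unfolding \<zeta>_def by (simp add: norm_exp_eq_Re)
  then have z0: "\<zeta> \<noteq> 0" by auto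
  have zK: "\<zeta> ^ K = 1" unfolding \<zeta>_def exp_of_nat_mult[symmetric] using K by simp
  define A where "A w = (\<Sum>n<N. a n * (w ^ Suc n - inverse w ^ Suc n))" for w :: complex
  let ?e = "K - Suc m"
  have inv: "inverse \<zeta> ^ Suc n = \<zeta> ^ (K - Suc n)" if "n < N" for n
  proof -
    have "\<zeta> ^ Suc n * \<zeta> ^ (K - Suc n) = 1"
      unfolding power_add[symmetric] using that zK by (simp add: K_def)
    then show ?thesis unfolding power_inverse by (rule inverse_unique)
  qed
  have tm: "(\<Sum>j<K. ((of_real \<rho> * \<zeta> ^ j) ^ Suc n - inverse (of_real \<rho> * \<zeta> ^ j) ^ Suc n) * (\<zeta> ^ j) ^ ?e)
     = (if n = m then of_nat K * of_real \<rho> ^ Suc m else 0)" if "n < N" for n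
  proof -
    have "((of_real \<rho> * \<zeta> ^ j) ^ Suc n - inverse (of_real \<rho> * \<zeta> ^ j) ^ Suc n) * (\<zeta> ^ j) ^ ?e =
       of_real \<rho> ^ Suc n * (\<zeta> ^ (Suc n + ?e)) ^ j - inverse (of_real \<rho>) ^ Suc n * (\<zeta> ^ (K - Suc n + ?e)) ^ j" for j
    proof -
      have i: "inverse (of_real \<rho> * \<zeta> ^ j) ^ Suc n = inverse (of_real \<rho>) ^ Suc n * (\<zeta> ^ (K - Suc n)) ^ j"
        unfolding inv[OF that, symmetric]
        by (simp only: inverse_mult_distrib power_mult_distrib power_inverse[symmetric] power_mult[symmetric] mult.commute)
      have p: "(\<zeta> ^ j) ^ r = (\<zeta> ^ r) ^ j" for r by (metis power_mult mult.commute)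
      show ?thesis unfolding i power_mult_distrib p power_add by (simp only: power_mult_distrib left_diff_distrib mult.assoc)
    qed
    then have "(\<Sum>j<K. ((of_real \<rho> * \<zeta> ^ j) ^ Suc n - inverse (of_real \<rho> * \<zeta> ^ j) ^ Suc n) * (\<zeta> ^ j) ^ ?e)
      = of_real \<rho> ^ Suc n * (\<Sum>j<K. (\<zeta> ^ (Suc n + ?e)) ^ j)
        - inverse (of_real \<rho>) ^ Suc n * (\<Sum>j<K. (\<zeta> ^ (K - Suc n + ?e)) ^ j)"
      by (simp only: sum_subtractf sum_distrib_left)
    moreover have "K dvd Suc n + ?e \<longleftrightarrow> n = m"
    proof
      assume "K dvd Suc n + ?e"
      then obtain c where c: "Suc n + ?e = K * c" by (auto simp: dvd_def)
      have "0 < K * c" "K * c < K * 2" using that assms(2) unfolding c[symmetric] by (auto simp: K_def)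
      then have "c = 1" by (simp)
      then show "n = m" using c assms(2) that by (simp add: K_def)
    qed (use assms(2) in \<open>simp add: K_def\<close>)
    moreover have "\<not> K dvd K - Suc n + ?e"
    proof
      assume "K dvd K - Suc n + ?e"
      then obtain c where c: "K - Suc n + ?e = K * c" by (auto simp: dvd_def)
      have "K * 1 < K * c" "K * c < K * 2" using that assms(2) unfolding c[symmetric] by (auto simp: K_def)
      then show False by (simp)
    qed
    ultimately show ?thesis unfolding sum_roots_of_unity[OF K \<zeta>_def] by simp
  qed
  have "(\<Sum>j<K. A (of_real \<rho> * \<zeta> ^ j) * (\<zeta> ^ j) ^ ?e) =
    (\<Sum>n<N. a n * (\<Sum>j<K. ((of_real \<rho> * \<zeta> ^ j) ^ Suc n - inverse (of_real \<rho> * \<zeta> ^ j) ^ Suc n) * (\<zeta> ^ j) ^ ?e))"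
    unfolding A_def sum_distrib_right sum_distrib_left by (subst sum.swap) (simp only: mult.assoc)
  also have "\<dots> = (\<Sum>n<N. if n = m then a m * (of_nat K * of_real \<rho> ^ Suc m) else 0)"
  proof (intro sum.cong refl)
    fix n assume "n \<in> {..<N}"
    then have "n < N" by simp
    show "a n * (\<Sum>j<K. ((of_real \<rho> * \<zeta> ^ j) ^ Suc n - inverse (of_real \<rho> * \<zeta> ^ j) ^ Suc n) * (\<zeta> ^ j) ^ ?e)
       = (if n = m then a m * (of_nat K * of_real \<rho> ^ Suc m) else 0)"
      unfolding tm[OF \<open>n < N\<close>] by simp
  qed
  also have "\<dots> = a m * (of_nat K * of_real \<rho> ^ Suc m)" using assms(2) by (simp add: sum.delta del: power_Suc)
  finally have eq: "a m * (of_nat K * of_real \<rho> ^ Suc m) = (\<Sum>j<K. A (of_real \<rho> * \<zeta> ^ j) * (\<zeta> ^ j) ^ ?e)" by simp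
  have "norm (a m * (of_nat K * of_real \<rho> ^ Suc m)) \<le> (\<Sum>j<K. B)"
    unfolding eq
  proof (rule sum_norm_le)
    fix j
    have "norm (complex_of_real \<rho> * \<zeta> ^ j) = \<rho>" using assms(1) by (simp add: norm_mult norm_power n1)
    then have "norm (A (of_real \<rho> * \<zeta> ^ j)) \<le> B" unfolding A_def by (rule assms(3))
    then show "norm (A (of_real \<rho> * \<zeta> ^ j) * (\<zeta> ^ j) ^ ?e) \<le> B" by (simp add: norm_mult norm_power n1)
  qed
  then have "real K * (norm (a m) * \<rho> ^ Suc m) \<le> real K * B"
    using assms(1) by (simp add: norm_mult norm_power mult_ac del: power_Suc)
  then show ?thesis using K by (simp del: power_Suc)
qed

text \<open>
  Cauchy's estimate for Chebyshev series. The tail is uniformly small on the circle, which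
  reduces it to the finite case.
\<close>

lemma coeff_bound_from_circle:
  assumes "\<rho> \<ge> 1" "summable (\<lambda>m. norm (c m) * (sqrt q * \<rho>) ^ m)"
    and "\<And>w. norm w = \<rho> \<Longrightarrow> norm (\<Sum>m. c m * cheb q w m) \<le> B"
  shows "norm (c m) * sqrt q ^ m * \<rho> ^ Suc m \<le> B"
proof (rule field_le_epsilon)
  fix e :: real assume e: "e > 0"
  define u where "u m = 2 * \<rho> * (norm (c m) * (sqrt q * \<rho>) ^ m)" for m
  have su: "summable u" unfolding u_def by (intro summable_mult assms(2))
  obtain N0 where N0: "\<And>n. n \<ge> N0 \<Longrightarrow> norm (\<Sum>i. u (i + n)) < e"
    using suminf_exist_split[OF e su] by blast
  define N where "N = max N0 (Suc m)"
  have N: "norm (\<Sum>i. u (i + N)) < e" "m < N" using N0[of N] by (auto simp: N_def)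
  have "norm (c m * of_real (sqrt q ^ m)) * \<rho> ^ Suc m \<le> B + e"
  proof (rule laurent_coeff_bound_finite[of _ _ N])
    show "\<rho> > 0" "m < N" using assms(1) N by auto
    fix w :: complex assume w: "norm w = \<rho>"
    have le: "norm (c n * cheb q w n) \<le> u n" for n
      using mult_left_mono[OF cheb_bound[of w q n], of "norm (c n)"] w assms(1)
      unfolding norm_mult u_def by (simp add: mult_ac)
    have sn: "summable (\<lambda>n. norm (c n * cheb q w n))"
      by (rule summable_comparison_test'[OF su]) (use le in auto)
    have sn': "summable (\<lambda>i. norm (c (i + N) * cheb q w (i + N)))" using sn by (rule summable_ignore_initial_segment)
    have "norm (\<Sum>i. c (i + N) * cheb q w (i + N)) \<le> (\<Sum>i. norm (c (i + N) * cheb q w (i + N)))"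
      by (rule summable_norm[OF sn'])
    also have "\<dots> \<le> (\<Sum>i. u (i + N))"
      by (intro suminf_le le sn' summable_ignore_initial_segment su)
    also have "\<dots> \<le> e" using N by simp
    finally have tail: "norm (\<Sum>i. c (i + N) * cheb q w (i + N)) \<le> e" .
    have "(\<Sum>n<N. c n * of_real (sqrt q ^ n) * (w ^ Suc n - inverse w ^ Suc n)) =
       (\<Sum>n. c n * cheb q w n) - (\<Sum>i. c (i + N) * cheb q w (i + N))"
      unfolding suminf_split_initial_segment[OF summable_norm_cancel[OF sn], of N]
      by (simp add: cheb_def mult.assoc del: power_Suc)
    also have "norm \<dots> \<le> B + e"
      using norm_triangle_ineq4[of "\<Sum>n. c n * cheb q w n" "\<Sum>i. c (i + N) * cheb q w (i + N)"]
        assms(3)[OF w] tail by linarith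
    finally show "norm (\<Sum>n<N. c n * of_real (sqrt q ^ n) * (w ^ Suc n - inverse w ^ Suc n)) \<le> B + e" .
  qed
  then show "norm (c m) * sqrt q ^ m * \<rho> ^ Suc m \<le> B + e"
    by (simp add: norm_mult norm_power del: power_Suc of_real_power)
qed

section \<open>Series in the Chebyshev functions\<close>

text \<open>
  The semigroup law of the exponential, evaluated at one point: \<open>\<tau> n\<close> plays the value of the
  \<open>n\<close>-th power of the operator.
\<close>

lemma suminf_exp_convolution:
  fixes \<tau> :: "nat \<Rightarrow> complex"
  assumes "R \<ge> 1" "\<And>n. norm (\<tau> n) \<le> C * R ^ n"
  shows "(\<Sum>i. a ^ i / fact i * (\<Sum>j. b ^ j / fact j * \<tau> (i + j))) = (\<Sum>n. (a + b) ^ n / fact n * \<tau> n)"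
proof -
  have C: "C \<ge> 0" using order_trans[OF norm_ge_zero[of "\<tau> 0"], of C] assms(2)[of 0] by simp
  define F where "F i n = (if i \<le> n then a ^ i / fact i * (b ^ (n - i) / fact (n - i)) * \<tau> n else 0)" for i n
  let ?A = "norm a * (2 * R)" and ?B = "norm b * (2 * R)"
  let ?E = "\<Sum>k. ?B ^ k / fact k"
  have E: "?B ^ k / fact k \<le> ?E" for k
    using sum_le_suminf[OF summable_exp_real[of ?B], of "{k}"] assms(1) by simp
  have E0: "?E \<ge> 0" using assms(1) by (intro suminf_nonneg summable_exp_real) auto
  \<comment> \<open>A factor \<open>(1/2) ^ n\<close> is split off so that the bound is a product and the double series converges absolutely.\<close>
  have dom: "norm (F i n) \<le> (?A ^ i / fact i) * (?E * C * (1/2) ^ n)" for i n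
  proof (cases "i \<le> n")
    case True
    then obtain k where n: "n = i + k" using le_Suc_ex by blast
    have "norm (F i n) \<le> norm a ^ i / fact i * (norm b ^ k / fact k) * (C * R ^ n)"
      unfolding F_def n by (simp add: norm_mult norm_divide norm_power)
        (intro mult_left_mono divide_right_mono assms(2)[unfolded n]; simp)
    also have "R ^ n = (2 * R) ^ i * (2 * R) ^ k * (1/2) ^ n"
      by (simp add: n power_add power_mult_distrib power_one_over field_simps)
    also have "norm a ^ i / fact i * (norm b ^ k / fact k) * (C * ((2 * R) ^ i * (2 * R) ^ k * (1/2) ^ n))
       = ?A ^ i / fact i * (?B ^ k / fact k * (C * (1/2) ^ n))"
      by (simp add: power_mult_distrib)
    also have "\<dots> \<le> ?A ^ i / fact i * (?E * (C * (1/2) ^ n))"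
      using C assms(1) by (intro mult_left_mono mult_right_mono E) auto
    finally show ?thesis by (simp add: mult.assoc)
  next
    case False
    then show ?thesis using C assms(1) E0 by (simp add: F_def)
  qed
  have swap: "(\<Sum>i. \<Sum>n. F i n) = (\<Sum>n. \<Sum>i. F i n)"
    by (rule suminf_swap_dominated[OF dom])
      (use C assms(1) E0 in \<open>auto intro!: summable_exp_real summable_mult summable_geometric\<close>)
  have "summable (\<lambda>n. F i n)" for i
    by (rule summable_norm_cancel, rule summable_comparison_test'[where g = "\<lambda>n. (?A ^ i / fact i) * (?E * C * (1/2) ^ n)"])
      (use dom in \<open>auto intro!: summable_mult summable_geometric\<close>)
  then have F1: "(\<Sum>n. F i n) = (\<Sum>j. F i (j + i)) + (\<Sum>j<i. F i j)" for i by (rule suminf_split_initial_segment)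
  have F2: "(\<Sum>j<i. F i j) = 0" for i by (simp add: F_def)
  have F3: "F i (j + i) = a ^ i / fact i * (b ^ j / fact j * \<tau> (i + j))" for i j
    by (simp add: F_def add.commute mult.assoc)
  have F4: "summable (\<lambda>j. b ^ j / fact j * \<tau> (i + j))" for i
  proof (rule summable_norm_cancel, rule summable_comparison_test'[where g = "\<lambda>j. (C * R ^ i) * ((norm b * R) ^ j / fact j)"])
    show "norm (norm (b ^ j / fact j * \<tau> (i + j))) \<le> (C * R ^ i) * ((norm b * R) ^ j / fact j)" for j
      using mult_left_mono[OF assms(2)[of "i + j"], of "norm b ^ j / fact j"]
      by (simp add: norm_mult norm_divide norm_power power_add power_mult_distrib mult_ac)
  qed (intro summable_mult summable_exp_real)
  have L: "(\<Sum>n. F i n) = a ^ i / fact i * (\<Sum>j. b ^ j / fact j * \<tau> (i + j))" for i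
    unfolding F1 F2 F3 suminf_mult[OF F4] by simp
  have R: "(\<Sum>i. F i n) = (a + b) ^ n / fact n * \<tau> n" for n
  proof -
    have "(\<Sum>i. F i n) = (\<Sum>i\<le>n. F i n)" by (rule suminf_finite) (auto simp: F_def)
    also have "\<dots> = (\<Sum>i\<le>n. (of_nat (n choose i) * a ^ i * b ^ (n - i)) / fact n * \<tau> n)"
      by (intro sum.cong refl) (auto simp: F_def binomial_fact field_simps)
    also have "\<dots> = (a + b) ^ n / fact n * \<tau> n"
      unfolding binomial_ring sum_distrib_right sum_divide_distrib ..
    finally show ?thesis .
  qed
  show ?thesis using swap unfolding L R .
qed

lemma cheb_series_shift:
  assumes "rapid c" "norm w \<ge> 1" "q \<ge> 1"
  shows "(\<Sum>m. shift_coeff q c m * cheb q w m) = eigval q w * (\<Sum>m. c m * cheb q w m)"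
proof -
  have R: "sqrt q * norm w \<ge> 1" using assms mult_mono[of 1 "sqrt q" 1 "norm w"] by simp
  have w0: "w \<noteq> 0" using assms(2) by auto
  note b = cheb_bound[OF assms(2)]
  have s: "summable (\<lambda>m. c m * cheb q w m)"
    by (rule summable_norm_cancel, rule rapid_summable[OF assms(1) R b])
  have "(\<Sum>m. shift_coeff q c m * cheb q w m) = (\<Sum>m. c m * (eigval q w * cheb q w m))"
    by (rule shift_coeff_pairing(2)[OF assms(1) R b]) (simp_all only: cheb_rec[OF w0])
  also have "\<dots> = eigval q w * (\<Sum>m. c m * cheb q w m)"
    unfolding suminf_mult[OF s, symmetric] by (simp only: mult.left_commute)
  finally show ?thesis .
qed

lemma cheb_series_exp_coeff:
  assumes "norm w \<ge> 1" "q \<ge> 1"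
  shows "(\<Sum>m. exp_coeff q \<kappa> m * cheb q w m) = exp (\<kappa> * eigval q w) * (w - inverse w)"
proof -
  have R: "sqrt q * norm w \<ge> 1" using assms mult_mono[of 1 "sqrt q" 1 "norm w"] by simp
  have t: "(\<Sum>m. pow_coeff q j m * cheb q w m) = eigval q w ^ j * (w - inverse w)" for j
  proof (induction j)
    case 0
    have "(\<Sum>m. pow_coeff q 0 m * cheb q w m) = (\<Sum>m\<in>{0}. pow_coeff q 0 m * cheb q w m)"
      by (rule suminf_finite) (auto simp: pow_coeff_0)
    then show ?case by (simp add: pow_coeff_0 cheb_def)
  next
    case (Suc j)
    then show ?case unfolding pow_coeff_Suc by (simp add: cheb_series_shift[OF rapid_pow_coeff assms] mult.assoc)
  qed
  have "(\<Sum>m. exp_coeff q \<kappa> m * cheb q w m) = (\<Sum>j. \<kappa> ^ j / fact j * (eigval q w ^ j * (w - inverse w)))"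
    unfolding exp_coeff_pairing[OF R cheb_bound[OF assms(1)], symmetric] t ..
  also have "\<dots> = (\<Sum>j. (\<kappa> * eigval q w) ^ j / fact j * (w - inverse w))"
    by (simp add: power_mult_distrib mult_ac)
  also have "\<dots> = exp (\<kappa> * eigval q w) * (w - inverse w)"
    using sums_mult2[OF exp_sums_complex[of "\<kappa> * eigval q w"], of "w - inverse w"] by (rule sums_unique[symmetric])
  finally show ?thesis .
qed

section \<open>Weak norms\<close>

text \<open>
  The distribution function bounds the smallest of \<open>n\<close> values by \<open>M n powr (- 1 / r)\<close>, where
  \<open>1 / r = 1 - 1 / p\<close>; this form treats \<open>r = \<infinity>\<close> and \<open>r < \<infinity>\<close> alike.
\<close>

lemma weak_norm_min:
  assumes "1 \<le> p" "p < 2" "M > 0" "weak_norm (conj_exponent p) f \<le> ennreal M" "finite E" "E \<noteq> {}"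
  shows "\<exists>x\<in>E. cmod (f x) \<le> M * real (card E) powr - (1 - 1 / p)"
proof (cases "p = 1")
  case True
  obtain x where x: "x \<in> E" using assms(6) by blast
  have "ennreal (cmod (f x)) \<le> ennreal M"
    using assms(4) True by (auto simp: weak_norm_def conj_exponent_def SUP_le_iff)
  then have "cmod (f x) \<le> M" using assms(3) by simp
  moreover have "card E > 0" using assms(5,6) by (simp add: card_gt_0_iff)
  ultimately show ?thesis using x True by auto
next
  case False
  define r where "r = p / (p - 1)"
  have r: "r > 0" using assms(1) False by (simp add: r_def)
  have cr: "conj_exponent p = ennreal r" using False by (simp add: conj_exponent_def r_def)
  have ir: "enn2real (1 / ennreal r) = 1 - 1 / p"
  proof -
    have "1 / ennreal r = ennreal (1 / r)" using r by (metis divide_ennreal ennreal_1 zero_le_one)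
    then show ?thesis using r assms(1) False by (simp add: r_def field_simps)
  qed
  define n where "n = card E"
  have n: "n > 0" unfolding n_def using assms(5,6) by (simp add: card_gt_0_iff)
  show ?thesis
  proof (rule ccontr)
    assume "\<not> (\<exists>x\<in>E. cmod (f x) \<le> M * real (card E) powr - (1 - 1 / p))"
    then have all: "\<forall>x\<in>E. M * real n powr - (1 - 1 / p) < cmod (f x)" by (auto simp: n_def not_le)
    define \<mu> where "\<mu> = Min ((\<lambda>x. cmod (f x)) ` E)"
    have "M * real n powr - (1 - 1 / p) < \<mu>" unfolding \<mu>_def using assms(5,6) all by (subst Min_gr_iff) auto
    then obtain t where t: "M * real n powr - (1 - 1 / p) < t" "t < \<mu>" using dense by blast
    have t0: "t > 0" using t(1) assms(3) n by (smt (verit) mult_nonneg_nonneg powr_ge_zero)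
    have sub: "E \<subseteq> {x. t < cmod (f x)}"
      using t(2) assms(5) unfolding \<mu>_def by (auto intro: less_le_trans Min_le)
    have "(if finite {x. t < cmod (f x)}
              then ennreal (t * real (card {x. t < cmod (f x)}) powr enn2real (1 / ennreal r))
              else \<infinity>) \<le> weak_norm (ennreal r) f"
      by (subst weak_norm_def, subst if_not_P, simp, rule SUP_upper2[of t])
        (use t0 in simp, rule order_refl)
    then have le: "(if finite {x. t < cmod (f x)}
              then ennreal (t * real (card {x. t < cmod (f x)}) powr (1 - 1/p))
              else \<infinity>) \<le> ennreal M" using assms(4) unfolding cr ir by (rule order_trans)
    then have fin: "finite {x. t < cmod (f x)}" by (auto split: if_splits simp: top_unique)
    with le have le': "t * real (card {x. t < cmod (f x)}) powr (1 - 1/p) \<le> M" using assms(3) by simp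
    have "t * real n powr (1 - 1/p) \<le> t * real (card {x. t < cmod (f x)}) powr (1 - 1/p)"
      unfolding n_def using t0 assms(1) card_mono[OF fin sub] by (intro mult_left_mono powr_mono2) auto
    with le' have "t * real n powr (1 - 1/p) \<le> M" by simp
    then have "t \<le> M * real n powr - (1 - 1 / p)" unfolding powr_minus_divide using n by (simp add: pos_le_divide_eq)
    then show False using t(1) by simp
  qed
qed

text \<open>
  Comparison with the decreasing rearrangement, by removing a smallest value repeatedly.
\<close>

lemma weak_norm_rearrangement:
  fixes \<psi> :: "real \<Rightarrow> real"
  assumes "1 \<le> p" "p < 2" "M > 0" "weak_norm (conj_exponent p) f \<le> ennreal M" "finite E"
    and mono: "\<And>s t. 0 \<le> s \<Longrightarrow> s \<le> t \<Longrightarrow> \<psi> s \<le> \<psi> t"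
  shows "(\<Sum>x\<in>E. \<psi> (cmod (f x))) \<le> (\<Sum>k=1..card E. \<psi> (M * real k powr - (1 - 1 / p)))"
  using assms(5)
proof (induction "card E" arbitrary: E)
  case 0
  then show ?case by simp
next
  case (Suc n)
  then have "E \<noteq> {}" by auto
  from weak_norm_min[OF assms(1-4) Suc.prems this] obtain x where
    x: "x \<in> E" "cmod (f x) \<le> M * real (card E) powr - (1 - 1 / p)" by blast
  have c: "card (E - {x}) = n" using Suc x(1) by simp
  have "(\<Sum>x\<in>E. \<psi> (cmod (f x))) = \<psi> (cmod (f x)) + (\<Sum>x\<in>E - {x}. \<psi> (cmod (f x)))"
    by (rule sum.remove[OF Suc.prems x(1)])
  also have "\<dots> \<le> \<psi> (M * real (card E) powr - (1 - 1 / p)) + (\<Sum>k=1..card (E - {x}). \<psi> (M * real k powr - (1 - 1 / p)))"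
    using Suc.hyps(1)[of "E - {x}"] c Suc.prems x(2) by (intro add_mono mono) auto
  also have "\<dots> = (\<Sum>k=1..card E. \<psi> (M * real k powr - (1 - 1 / p)))"
    unfolding c Suc.hyps(2)[symmetric] by simp
  finally show ?case .
qed

lemma sum_inverse_sqrt: "(\<Sum>k=1..n. 1 / sqrt (real k)) \<le> 2 * sqrt (real n)"
proof (induction n)
  case (Suc n)
  have "1 / sqrt (real (Suc n)) \<le> 2 * (sqrt (real (Suc n)) - sqrt (real n))"
  proof -
    let ?a = "sqrt (real (Suc n))" and ?b = "sqrt (real n)"
    have a: "?a > 0" "?a * ?a = ?b * ?b + 1" "?b \<le> ?a" by auto
    have "2 * ?a * ?b \<le> ?a * ?a + ?b * ?b" using sum_squares_bound[of ?a ?b] by (simp add: power2_eq_square)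
    then have "1 \<le> 2 * (?a - ?b) * ?a" using a(2) by (simp add: algebra_simps)
    then show ?thesis using a(1) by (simp add: field_simps)
  qed
  with Suc show ?case by simp
qed simp

text \<open>
  The Hoelder inequality between weak \<open>L\<^sup>r\<close> and indicator functions. The constant does not depend on
  \<open>p\<close> since \<open>1 - 1 / p \<le> 1 / 2\<close>.
\<close>

lemma weak_norm_sum_bound:
  assumes "1 \<le> p" "p < 2" "M > 0" "weak_norm (conj_exponent p) f \<le> ennreal M" "finite E"
  shows "(\<Sum>x\<in>E. cmod (f x)) \<le> 2 * M * real (card E) powr (1 / p)"
proof (cases "card E = 0")
  case True
  then show ?thesis using assms(5) by simp
next
  case False
  define n where "n = card E"
  have n: "n > 0" using False by (simp add: n_def)
  have "(\<Sum>x\<in>E. cmod (f x)) \<le> (\<Sum>k=1..n. M * real k powr - (1 - 1 / p))"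
    unfolding n_def by (rule weak_norm_rearrangement[OF assms]) simp
  also have "\<dots> \<le> (\<Sum>k=1..n. M * real n powr (1/p - 1/2) * (1 / sqrt (real k)))"
  proof (rule sum_mono)
    fix k assume k: "k \<in> {1..n}"
    have "real k powr - (1 - 1 / p) = real k powr (1/p - 1/2) * real k powr (- (1/2))"
      by (simp add: powr_add[symmetric])
    also have "real k powr (- (1/2)) = 1 / sqrt (real k)" using k by (simp add: powr_minus_divide powr_half_sqrt)
    also have "real k powr (1/p - 1/2) * (1 / sqrt (real k)) \<le> real n powr (1/p - 1/2) * (1 / sqrt (real k))"
      using k assms(1,2) by (intro mult_right_mono powr_mono2) (auto simp: field_simps)
    finally show "M * real k powr - (1 - 1 / p) \<le> M * real n powr (1/p - 1/2) * (1 / sqrt (real k))"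
      unfolding mult.assoc[of M] using assms(3) by (intro mult_left_mono) auto
  qed
  also have "\<dots> = M * real n powr (1/p - 1/2) * (\<Sum>k=1..n. 1 / sqrt (real k))" by (simp add: sum_distrib_left)
  also have "\<dots> \<le> M * real n powr (1/p - 1/2) * (2 * sqrt (real n))"
    using assms(3) by (intro mult_left_mono sum_inverse_sqrt) auto
  also have "sqrt (real n) = real n powr (1/2)" by (simp add: powr_half_sqrt)
  also have "M * real n powr (1/p - 1/2) * (2 * real n powr (1/2)) = 2 * M * real n powr (1/p)"
    by (simp add: powr_add[symmetric])
  finally show ?thesis by (simp add: n_def)
qed

lemma weak_norm_bounded:
  assumes "1 \<le> p" "p < 2" "M > 0" "weak_norm (conj_exponent p) f \<le> ennreal M"
  shows "cmod (f x) \<le> M"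
  using weak_norm_min[OF assms, of "{x}"] by simp

context hom_tree
begin

lemma ball_sum_bound:
  assumes "\<And>y. norm (f y) \<le> C"
  shows "norm (ball_sum m f x) \<le> 2 * C * real q ^ m"
proof -
  have C: "C \<ge> 0" using assms norm_ge_zero order_trans by blast
  have "norm (ball_sum m f x) \<le> real (card (parity_ball x m)) * C"
    unfolding ball_sum_def by (rule sum_norm_bound) (rule assms)
  also have "\<dots> \<le> (2 * real q ^ m) * C" using C by (intro mult_right_mono card_parity_ball_le)
  finally show ?thesis by (simp add: mult_ac)
qed

text \<open>
  A ball of radius \<open>m\<close> has about \<open>q ^ m\<close> points. The exponent \<open>m / p\<close> is exactly the one that Cauchy's
  estimate on the circle of radius \<open>q powr (1 / p - 1 / 2)\<close> compensates.
\<close>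

lemma ball_sum_weak_bound:
  assumes "1 \<le> p" "p < 2" "M > 0" "weak_norm (conj_exponent p) f \<le> ennreal M"
  shows "norm (ball_sum m f x) \<le> 4 * M * real q powr (real m / p)"
proof -
  have q0: "real q > 0" using q_ge_2 by simp
  have "norm (ball_sum m f x) \<le> (\<Sum>y\<in>parity_ball x m. cmod (f y))" unfolding ball_sum_def by (rule norm_sum)
  also have "\<dots> \<le> 2 * M * real (card (parity_ball x m)) powr (1 / p)" by (rule weak_norm_sum_bound[OF assms]) simp
  also have "\<dots> \<le> 2 * M * (2 * real q ^ m) powr (1 / p)"
    using assms(1,3) card_parity_ball_le by (intro mult_left_mono powr_mono2) auto
  also have "(2 * real q ^ m) powr (1 / p) = 2 powr (1/p) * real q powr (real m / p)"
    using q0 by (simp add: powr_mult powr_powr flip: powr_realpow)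
  finally have 1: "norm (ball_sum m f x) \<le> 2 * M * real q powr (real m / p) * 2 powr (1/p)" by (simp add: mult_ac)
  have "2 powr (1/p) \<le> 2 powr (1::real)" using assms(1) by (intro powr_mono) auto
  then have "2 * M * real q powr (real m / p) * 2 powr (1/p) \<le> 2 * M * real q powr (real m / p) * 2"
    using assms(3) by (intro mult_left_mono) auto
  with 1 show ?thesis by (simp add: mult_ac)
qed

definition ball_series :: "(nat \<Rightarrow> complex) \<Rightarrow> ('a \<Rightarrow> complex) \<Rightarrow> 'a \<Rightarrow> complex" where
  "ball_series c f x = (\<Sum>m. c m * ball_sum m f x)"

lemma q_ge_1: "real q \<ge> 1" using q_ge_2 by simp

lemma ball_series_summable:
  assumes "rapid c" "\<And>y. norm (f y) \<le> C"
  shows "summable (\<lambda>m. norm (c m * ball_sum m f x))"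
  by (rule rapid_summable[OF assms(1) q_ge_1 ball_sum_bound]) (rule assms(2))

lemma nbr_sum_ball_series:
  assumes "rapid c" "\<And>y. norm (f y) \<le> C"
  shows "nbr_sum (ball_series c f) x = ball_series (shift_coeff q c) f x"
proof -
  have "nbr_sum (ball_series c f) x = (\<Sum>m. \<Sum>z\<in>nbrs x. c m * ball_sum m f z)"
    unfolding nbr_sum_def ball_series_def
    by (rule suminf_sum[symmetric]) (rule summable_norm_cancel[OF ball_series_summable[OF assms]])
  also have "\<dots> = (\<Sum>m. c m * nbr_sum (ball_sum m f) x)" by (simp add: nbr_sum_def sum_distrib_left)
  also have "\<dots> = ball_series (shift_coeff q c) f x"
    unfolding ball_series_def
  proof (rule shift_coeff_pairing(2)[OF assms(1) q_ge_1, symmetric])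
    show "norm (ball_sum m f x) \<le> 2 * C * real q ^ m" for m by (rule ball_sum_bound[OF assms(2)])
    show "nbr_sum (ball_sum 0 f) x = ball_sum (Suc 0) f x" by (simp add: ball_sum_1 ball_sum_0[abs_def] nbr_sum_def)
  qed (rule nbr_sum_ball_sum_Suc)
  finally show ?thesis .
qed

lemma ball_series_delta: "ball_series (\<lambda>m. if m = 0 then 1 else 0) f x = f x"
proof -
  have "ball_series (\<lambda>m. if m = 0 then 1 else 0) f x = (\<Sum>m\<in>{0}. (if m = 0 then 1 else 0) * ball_sum m f x)"
    unfolding ball_series_def by (rule suminf_finite) auto
  then show ?thesis by (simp add: ball_sum_0)
qed

lemma nbr_sum_power_ball_series:
  assumes "\<And>y. norm (f y) \<le> C"
  shows "(nbr_sum ^^ j) f x = ball_series (pow_coeff q j) f x"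
proof (induction j arbitrary: x)
  case 0
  show ?case by (simp add: ball_series_delta pow_coeff_def)
next
  case (Suc j)
  have "(nbr_sum ^^ Suc j) f x = nbr_sum (ball_series (pow_coeff q j) f) x"
    using arg_cong[OF ext[of "(nbr_sum ^^ j) f" "ball_series (pow_coeff q j) f", OF Suc.IH], of "\<lambda>g. nbr_sum g x"] by simp
  then show ?case by (simp add: nbr_sum_ball_series[OF rapid_pow_coeff assms] pow_coeff_Suc)
qed

lemma nbr_sum_bound:
  assumes "\<And>y. norm (f y) \<le> C"
  shows "norm (nbr_sum f x) \<le> (real q + 1) * C"
  using sum_norm_bound[of "nbrs x" f C] assms by (simp add: nbr_sum_def card_nbrs add.commute)

lemma nbr_sum_power_bound:
  assumes "\<And>y. norm (f y) \<le> C"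
  shows "norm ((nbr_sum ^^ j) f x) \<le> C * (real q + 1) ^ j"
proof (induction j arbitrary: x)
  case (Suc j)
  from nbr_sum_bound[OF Suc.IH] show ?case by (simp add: mult_ac)
qed (simp add: assms)

definition exp_nbr :: "complex \<Rightarrow> ('a \<Rightarrow> complex) \<Rightarrow> 'a \<Rightarrow> complex" where
  "exp_nbr \<kappa> f x = (\<Sum>j. \<kappa> ^ j / fact j * (nbr_sum ^^ j) f x)"

lemma exp_nbr_summable:
  assumes "\<And>y. norm (f y) \<le> C"
  shows "summable (\<lambda>j. norm (\<kappa> ^ j / fact j * (nbr_sum ^^ (j + i)) f x))"
proof (rule summable_comparison_test'[where g = "\<lambda>j. (C * (real q + 1) ^ i) * ((norm \<kappa> * (real q + 1)) ^ j / fact j)"])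
  show "norm (norm (\<kappa> ^ j / fact j * (nbr_sum ^^ (j + i)) f x)) \<le> (C * (real q + 1) ^ i) * ((norm \<kappa> * (real q + 1)) ^ j / fact j)" for j
    using mult_left_mono[OF nbr_sum_power_bound[of f C "j + i" x, OF assms], of "norm \<kappa> ^ j / fact j"]
    by (simp add: norm_mult norm_divide norm_power power_add power_mult_distrib mult_ac)
qed (intro summable_mult summable_exp_real)

lemma exp_nbr_ball_series:
  assumes "\<And>y. norm (f y) \<le> C"
  shows "exp_nbr \<kappa> f x = ball_series (exp_coeff q \<kappa>) f x"
  unfolding exp_nbr_def nbr_sum_power_ball_series[OF assms] ball_series_def
  by (rule exp_coeff_pairing[OF q_ge_1 ball_sum_bound[OF assms]])

lemma exp_nbr_bound:
  assumes "\<And>y. norm (f y) \<le> C"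
  shows "\<exists>C'. \<forall>x. norm (exp_nbr \<kappa> f x) \<le> C'"
proof -
  have "norm (exp_nbr \<kappa> f x) \<le> (\<Sum>j. C * ((norm \<kappa> * (real q + 1)) ^ j / fact j))" for x
  proof -
    have s: "summable (\<lambda>j. norm (\<kappa> ^ j / fact j * (nbr_sum ^^ j) f x))"
      using exp_nbr_summable[where i = 0, OF assms] by simp
    have "norm (exp_nbr \<kappa> f x) \<le> (\<Sum>j. norm (\<kappa> ^ j / fact j * (nbr_sum ^^ j) f x))"
      unfolding exp_nbr_def by (rule summable_norm[OF s])
    also have "\<dots> \<le> (\<Sum>j. C * ((norm \<kappa> * (real q + 1)) ^ j / fact j))"
    proof (intro suminf_le s summable_mult summable_exp_real)
      show "norm (\<kappa> ^ j / fact j * (nbr_sum ^^ j) f x) \<le> C * ((norm \<kappa> * (real q + 1)) ^ j / fact j)" for j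
        using mult_left_mono[OF nbr_sum_power_bound[of f C j x, OF assms], of "norm \<kappa> ^ j / fact j"]
        by (simp add: norm_mult norm_divide norm_power power_mult_distrib mult_ac)
    qed
    finally show ?thesis .
  qed
  then show ?thesis by blast
qed

lemma nbr_sum_power_exp_nbr:
  assumes "\<And>y. norm (f y) \<le> C"
  shows "(nbr_sum ^^ i) (exp_nbr \<kappa> f) x = (\<Sum>j. \<kappa> ^ j / fact j * (nbr_sum ^^ (i + j)) f x)"
proof (induction i arbitrary: x)
  case 0
  show ?case by (simp add: exp_nbr_def)
next
  case (Suc i)
  have s: "summable (\<lambda>j. \<kappa> ^ j / fact j * (nbr_sum ^^ (i + j)) f z)" for z
    using summable_norm_cancel[OF exp_nbr_summable[where i = i, OF assms]] by (simp add: add.commute)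
  have "(nbr_sum ^^ Suc i) (exp_nbr \<kappa> f) x = nbr_sum ((nbr_sum ^^ i) (exp_nbr \<kappa> f)) x" by simp
  also have "\<dots> = (\<Sum>z\<in>nbrs x. \<Sum>j. \<kappa> ^ j / fact j * (nbr_sum ^^ (i + j)) f z)"
    unfolding nbr_sum_def[of "(nbr_sum ^^ i) (exp_nbr \<kappa> f)"] by (intro sum.cong refl Suc.IH)
  also have "\<dots> = (\<Sum>j. \<Sum>z\<in>nbrs x. \<kappa> ^ j / fact j * (nbr_sum ^^ (i + j)) f z)"
    by (rule suminf_sum[symmetric]) (rule s)
  also have "\<dots> = (\<Sum>j. \<kappa> ^ j / fact j * (nbr_sum ^^ (Suc i + j)) f x)"
    by (simp add: nbr_sum_def sum_distrib_left)
  finally show ?case .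
qed

lemma exp_nbr_compose:
  assumes "\<And>y. norm (f y) \<le> C"
  shows "exp_nbr a (exp_nbr b f) = exp_nbr (a + b) f"
proof
  fix x
  show "exp_nbr a (exp_nbr b f) x = exp_nbr (a + b) f x"
    unfolding exp_nbr_def[of a] nbr_sum_power_exp_nbr[OF assms] exp_nbr_def[of "a + b"]
    by (rule suminf_exp_convolution[of "real q + 1" _ C]) (auto intro: nbr_sum_power_bound[OF assms])
qed

lemma exp_nbr_nbr_sum:
  assumes "\<And>y. norm (f y) \<le> C"
  shows "nbr_sum (exp_nbr \<kappa> f) = exp_nbr \<kappa> (nbr_sum f)"
proof
  fix x
  have "nbr_sum (exp_nbr \<kappa> f) x = (nbr_sum ^^ 1) (exp_nbr \<kappa> f) x" by simp
  also have "\<dots> = exp_nbr \<kappa> (nbr_sum f) x"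
    unfolding nbr_sum_power_exp_nbr[OF assms] exp_nbr_def by (simp add: funpow_swap1)
  finally show "nbr_sum (exp_nbr \<kappa> f) x = exp_nbr \<kappa> (nbr_sum f) x" .
qed

lemma exp_nbr_0: "exp_nbr 0 f = f"
proof
  fix x
  have "exp_nbr 0 f x = (\<Sum>j\<in>{0}. 0 ^ j / fact j * (nbr_sum ^^ j) f x)"
    unfolding exp_nbr_def by (rule suminf_finite) auto
  then show "exp_nbr 0 f x = f x" by simp
qed

lemma nbr_sum_scale: "nbr_sum (\<lambda>x. a * f x) x = a * nbr_sum f x"
  by (simp add: nbr_sum_def sum_distrib_left)

lemma nbr_sum_diff: "nbr_sum (\<lambda>x. f x - g x) x = nbr_sum f x - nbr_sum g x"
  by (simp add: nbr_sum_def sum_subtractf)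

lemma nbr_sum_add: "nbr_sum (\<lambda>x. f x + g x) x = nbr_sum f x + nbr_sum g x"
  by (simp add: nbr_sum_def sum.distrib)

lemma nbr_sum_power_scale: "(nbr_sum ^^ j) (\<lambda>x. a * f x) = (\<lambda>x. a * (nbr_sum ^^ j) f x)"
  by (induction j) (auto simp: nbr_sum_scale)

lemma exp_nbr_scale:
  assumes "\<And>y. norm (f y) \<le> C"
  shows "exp_nbr \<kappa> (\<lambda>x. a * f x) x = a * exp_nbr \<kappa> f x"
proof -
  have s: "summable (\<lambda>j. \<kappa> ^ j / fact j * (nbr_sum ^^ j) f x)"
    using summable_norm_cancel[OF exp_nbr_summable[where i = 0, OF assms]] by simp
  show ?thesis unfolding exp_nbr_def nbr_sum_power_scale using suminf_mult[OF s, of a] by (simp add: mult_ac)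
qed

definition defect :: "complex \<Rightarrow> ('a \<Rightarrow> complex) \<Rightarrow> 'a \<Rightarrow> complex" where
  "defect l f x = nbr_sum f x - l * f x"

lemma defect_bound:
  assumes "\<And>y. norm (f y) \<le> C"
  shows "norm (defect l f x) \<le> (real q + 1 + norm l) * C"
  using norm_triangle_ineq4[of "nbr_sum f x" "l * f x"] nbr_sum_bound[of f C x, OF assms]
    mult_left_mono[OF assms[of x], of "norm l"]
  by (simp add: defect_def norm_mult algebra_simps)

lemma defect_ball_series:
  assumes "rapid c" "\<And>y. norm (f y) \<le> C"
  shows "defect l (ball_series c f) x = ball_series (\<lambda>m. shift_coeff q c m - l * c m) f x"
proof -
  have s: "summable (\<lambda>m. c m * ball_sum m f x)" "summable (\<lambda>m. shift_coeff q c m * ball_sum m f x)"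
    by (rule summable_norm_cancel, rule ball_series_summable, rule assms rapid_shift_coeff[OF assms(1)], rule assms)+
  show ?thesis
    unfolding defect_def nbr_sum_ball_series[OF assms]
    unfolding ball_series_def left_diff_distrib mult.assoc
    by (simp only: suminf_diff[OF s(2) summable_mult[OF s(1)], symmetric] suminf_mult[OF s(1)])
qed

lemma exp_nbr_defect:
  assumes "\<And>y. norm (f y) \<le> C"
  shows "defect l (exp_nbr \<kappa> f) x = exp_nbr \<kappa> (defect l f) x"
proof -
  have s: "summable (\<lambda>j. \<kappa> ^ j / fact j * (nbr_sum ^^ j) f x)"
    using summable_norm_cancel[OF exp_nbr_summable[where i = 0, OF assms]] by simp
  have s2: "summable (\<lambda>j. \<kappa> ^ j / fact j * (nbr_sum ^^ j) (nbr_sum f) x)"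
    using summable_norm_cancel[OF exp_nbr_summable[where i = 0, OF nbr_sum_bound[OF assms]]] by simp
  have p: "(nbr_sum ^^ j) (defect l f) = (\<lambda>x. (nbr_sum ^^ j) (nbr_sum f) x - l * (nbr_sum ^^ j) f x)" for j
    by (induction j) (auto simp: defect_def nbr_sum_diff nbr_sum_scale)
  have "exp_nbr \<kappa> (defect l f) x = (\<Sum>j. \<kappa> ^ j / fact j * (nbr_sum ^^ j) (nbr_sum f) x - l * (\<kappa> ^ j / fact j * (nbr_sum ^^ j) f x))"
    unfolding exp_nbr_def p by (simp add: algebra_simps)
  also have "\<dots> = exp_nbr \<kappa> (nbr_sum f) x - l * exp_nbr \<kappa> f x"
    unfolding exp_nbr_def suminf_diff[OF s2 summable_mult[OF s], symmetric] suminf_mult[OF s] ..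
  finally show ?thesis unfolding defect_def exp_nbr_nbr_sum[OF assms] by simp
qed

text \<open>
  Where the square of \<open>D = T - l\<close> vanishes, \<open>exp (\<kappa> T) = exp (\<kappa> l) (1 + \<kappa> D)\<close>. For an eigenfunction
  the second term is zero.
\<close>

lemma exp_nbr_nilpotent:
  assumes "\<And>y. norm (g y) \<le> C" "\<And>x. defect l (defect l g) x = 0"
  shows "exp_nbr \<kappa> g x = exp (\<kappa> * l) * (g x + \<kappa> * defect l g x)"
proof -
  let ?h = "defect l g"
  have Th: "nbr_sum ?h x = l * ?h x" for x using assms(2)[of x] by (simp add: defect_def[of l ?h])
  have Tg: "nbr_sum g x = l * g x + ?h x" for x by (simp add: defect_def)
  have p: "(nbr_sum ^^ j) g = (\<lambda>x. l ^ j * g x + of_nat j * l ^ (j - 1) * ?h x)" for j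
  proof (induction j)
    case (Suc j)
    show ?case
    proof
      fix x
      have "(nbr_sum ^^ Suc j) g x = nbr_sum (\<lambda>x. l ^ j * g x + (of_nat j * l ^ (j - 1)) * ?h x) x"
        by (simp add: Suc.IH)
      also have "\<dots> = l ^ j * (l * g x + ?h x) + (of_nat j * l ^ (j - 1)) * (l * ?h x)"
        unfolding nbr_sum_add nbr_sum_scale Tg Th ..
      also have "\<dots> = l ^ Suc j * g x + of_nat (Suc j) * l ^ (Suc j - 1) * ?h x"
        by (cases j) (simp_all add: algebra_simps)
      finally show "(nbr_sum ^^ Suc j) g x = l ^ Suc j * g x + of_nat (Suc j) * l ^ (Suc j - 1) * ?h x" .
    qed
  qed simp
  have e: "(\<lambda>j. (\<kappa> * l) ^ j / fact j * g x) sums (exp (\<kappa> * l) * g x)"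
    by (intro sums_mult2 exp_sums_complex)
  have "(\<lambda>j. \<kappa> ^ Suc j / fact (Suc j) * (of_nat (Suc j) * l ^ j * ?h x)) sums (exp (\<kappa> * l) * (\<kappa> * ?h x))"
  proof -
    have "\<kappa> ^ Suc j / fact (Suc j) * (of_nat (Suc j) * l ^ j * ?h x) = (\<kappa> * l) ^ j / fact j * (\<kappa> * ?h x)" for j
      by (simp add: power_mult_distrib field_simps del: of_nat_Suc)
    then show ?thesis by (simp only:) (intro sums_mult2 exp_sums_complex)
  qed
  then have "(\<lambda>j. \<kappa> ^ j / fact j * (of_nat j * l ^ (j - 1) * ?h x)) sums (exp (\<kappa> * l) * (\<kappa> * ?h x))"
    by (subst (asm) sums_Suc_iff[where f = "\<lambda>j. \<kappa> ^ j / fact j * (of_nat j * l ^ (j - 1) * ?h x)", simplified diff_Suc_1]) simp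
  from sums_add[OF e this] have "(\<lambda>j. \<kappa> ^ j / fact j * (nbr_sum ^^ j) g x) sums (exp (\<kappa> * l) * (g x + \<kappa> * ?h x))"
    unfolding p by (simp add: algebra_simps power_mult_distrib)
  then show ?thesis unfolding exp_nbr_def by (rule sums_unique[symmetric])
qed

end

section \<open>Bounded orbits of extremal growth\<close>

definition defect_coeff :: "nat \<Rightarrow> complex \<Rightarrow> (nat \<Rightarrow> complex) \<Rightarrow> nat \<Rightarrow> complex" where
  "defect_coeff q l c m = shift_coeff q c m - l * c m"

lemma rapid_defect_coeff: "rapid c \<Longrightarrow> rapid (defect_coeff q l c)"
  unfolding defect_coeff_def[abs_def] by (intro rapid_diff_scale rapid_shift_coeff)

lemma rapid_defect_coeff_power: "rapid c \<Longrightarrow> rapid ((defect_coeff q l ^^ n) c)"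
  by (induction n) (auto intro: rapid_defect_coeff)

lemma cheb_series_summable:
  assumes "rapid c" "norm w \<ge> 1" "q \<ge> 1"
  shows "summable (\<lambda>m. c m * cheb q w m)"
proof -
  have R: "sqrt q * norm w \<ge> 1" using assms mult_mono[of 1 "sqrt q" 1 "norm w"] by simp
  show ?thesis
    by (rule summable_norm_cancel, rule rapid_summable[OF assms(1) R cheb_bound[OF assms(2)]])
qed

lemma cheb_series_defect_coeff_power:
  assumes "rapid c" "norm w \<ge> 1" "q \<ge> 1"
  shows "(\<Sum>m. (defect_coeff q l ^^ n) c m * cheb q w m) = (eigval q w - l) ^ n * (\<Sum>m. c m * cheb q w m)"
proof (induction n)
  case (Suc n)
  let ?c = "(defect_coeff q l ^^ n) c"
  have r: "rapid ?c" by (rule rapid_defect_coeff_power[OF assms(1)])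
  have "(\<Sum>m. defect_coeff q l ?c m * cheb q w m) = (\<Sum>m. shift_coeff q ?c m * cheb q w m - l * (?c m * cheb q w m))"
    by (simp add: defect_coeff_def algebra_simps)
  also have "\<dots> = (\<Sum>m. shift_coeff q ?c m * cheb q w m) - l * (\<Sum>m. ?c m * cheb q w m)"
    unfolding suminf_mult[OF cheb_series_summable[OF r assms(2,3)], symmetric]
    by (intro suminf_diff[symmetric] summable_mult cheb_series_summable r rapid_shift_coeff assms(2,3))
  also have "\<dots> = (eigval q w - l) * (\<Sum>m. ?c m * cheb q w m)"
    unfolding cheb_series_shift[OF r assms(2,3)] by (simp add: algebra_simps)
  finally show ?case unfolding Suc.IH by simp
qed simp

text \<open>
  This is why the fourth power of the defect gives decay \<open>1 / k\<^sup>2\<close> at a nondegenerate maximum.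
\<close>

lemma square_exp_bound: "t > 0 \<Longrightarrow> y \<ge> 0 \<Longrightarrow> y\<^sup>2 * exp (- (t * y)) \<le> 2 / t\<^sup>2" for t y :: real
proof -
  assume t: "t > 0" and y: "y \<ge> 0"
  have "1 + t * y + (t * y)\<^sup>2 / 2 \<le> exp (t * y)" using t y by (intro exp_lower_Taylor_quadratic) auto
  then have "(t * y)\<^sup>2 / 2 \<le> exp (t * y)" using t y by (smt (verit) mult_nonneg_nonneg)
  then have "(t * y)\<^sup>2 * exp (- (t * y)) \<le> 2" by (simp add: exp_minus field_simps)
  then show ?thesis using t by (simp add: power_mult_distrib field_simps)
qed

context hom_tree
begin

lemma defect_power_ball_series:
  assumes "rapid c" "\<And>y. norm (f y) \<le> C"
  shows "(defect l ^^ n) (ball_series c f) = ball_series ((defect_coeff q l ^^ n) c) f"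
proof (induction n)
  case (Suc n)
  show ?case
  proof
    fix x
    have "(defect l ^^ Suc n) (ball_series c f) x = defect l (ball_series ((defect_coeff q l ^^ n) c) f) x" using Suc.IH by simp
    also have "\<dots> = ball_series (defect_coeff q l ((defect_coeff q l ^^ n) c)) f x"
      unfolding defect_ball_series[OF rapid_defect_coeff_power[OF assms(1)] assms(2)] defect_coeff_def[of q l "(defect_coeff q l ^^ n) c", abs_def] ..
    finally show "(defect l ^^ Suc n) (ball_series c f) x = ball_series ((defect_coeff q l ^^ Suc n) c) f x" by simp
  qed
qed simp

lemma defect_scale: "defect l (\<lambda>x. a * f x) = (\<lambda>x. a * defect l f x)"
  by (rule ext) (simp add: defect_def nbr_sum_scale algebra_simps)

lemma defect_power_scale: "(defect l ^^ n) (\<lambda>x. a * f x) = (\<lambda>x. a * (defect l ^^ n) f x)"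
  by (induction n) (auto simp: defect_scale)

lemma defect_add: "defect l (\<lambda>x. f x + g x) = (\<lambda>x. defect l f x + defect l g x)"
  by (rule ext) (simp add: defect_def nbr_sum_add algebra_simps)

lemma exp_nbr_orbit:
  assumes "\<And>k y. norm (g k y) \<le> C" "\<And>k. exp_nbr \<kappa> (g (Suc k)) = (\<lambda>x. a * g k x)"
  shows "exp_nbr (of_nat n * \<kappa>) (g (n + k)) = (\<lambda>x. a ^ n * g k x)"
proof (induction n arbitrary: k)
  case 0
  show ?case by (simp add: exp_nbr_0)
next
  case (Suc n)
  have "exp_nbr (of_nat (Suc n) * \<kappa>) (g (Suc n + k)) = exp_nbr \<kappa> (exp_nbr (of_nat n * \<kappa>) (g (n + Suc k)))"
    unfolding exp_nbr_compose[OF assms(1)] by (simp add: algebra_simps)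
  also have "\<dots> = (\<lambda>x. a ^ n * (a * g k x))"
    unfolding Suc.IH using exp_nbr_scale[of "g (Suc k)" C, OF assms(1)] assms(2)[of k] by (simp add: fun_eq_iff)
  finally show ?case by (simp add: mult_ac)
qed

text \<open>
  Along a backward orbit, a nilpotent part makes the values grow linearly in \<open>k\<close>, because
  \<open>h k = b ^ k (h 0 - k \<kappa> D (h 0))\<close> with \<open>|b| = 1\<close>. Boundedness therefore forces \<open>D (h 0) = 0\<close>.
\<close>

lemma bounded_orbit_nilpotent:
  assumes bd: "\<And>k y. norm (h k y) \<le> C"
    and orb: "\<And>k. exp_nbr \<kappa> (h (Suc k)) = (\<lambda>x. a * h k x)"
    and nil: "\<And>k x. defect l (defect l (h k)) x = 0"
    and "\<kappa> \<noteq> 0" "norm a = norm (exp (\<kappa> * l))"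
  shows "defect l (h k) x = 0"
proof -
  define b where "b = a / exp (\<kappa> * l)"
  have nb: "norm b = 1" using assms(5) by (simp add: b_def norm_divide)
  have ab: "a = exp (\<kappa> * l) * b" by (simp add: b_def)
  have step: "b * h k x = h (Suc k) x + \<kappa> * defect l (h (Suc k)) x" for k x
  proof -
    have "a * h k x = exp (\<kappa> * l) * (h (Suc k) x + \<kappa> * defect l (h (Suc k)) x)"
      using exp_nbr_nilpotent[of "h (Suc k)" C l \<kappa> x, OF bd nil] orb[of k] by (simp add: fun_eq_iff)
    then show ?thesis unfolding ab by simp
  qed
  have D: "b * defect l (h k) x = defect l (h (Suc k)) x" for k x
  proof -
    have "defect l (\<lambda>x. b * h k x) = defect l (\<lambda>x. h (Suc k) x + \<kappa> * defect l (h (Suc k)) x)" using step by presburger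
    then show ?thesis unfolding defect_scale defect_add by (simp add: nil fun_eq_iff)
  qed
  have Dk: "defect l (h k) x = b ^ k * defect l (h 0) x" for k x
  proof (induction k)
    case (Suc k)
    show ?case unfolding D[symmetric] Suc.IH by simp
  qed simp
  have hk: "h k x = b ^ k * (h 0 x - of_nat k * \<kappa> * defect l (h 0) x)" for k x
  proof (induction k)
    case (Suc k)
    have "h (Suc k) x = b * h k x - \<kappa> * (b ^ Suc k * defect l (h 0) x)" using step[of k x] Dk[of "Suc k" x] by simp
    then show ?case unfolding Suc.IH by (simp add: algebra_simps)
  qed simp
  have "defect l (h 0) x = 0"
  proof (rule ccontr)
    assume ne: "defect l (h 0) x \<noteq> 0"
    then obtain k :: nat where k: "real k * norm (\<kappa> * defect l (h 0) x) > 2 * C"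
      using reals_Archimedean3[of "norm (\<kappa> * defect l (h 0) x)"] assms(4) by auto
    have "norm (h k x) = norm (h 0 x - of_nat k * \<kappa> * defect l (h 0) x)"
      unfolding hk[of k] by (simp add: norm_mult norm_power nb)
    also have "\<dots> \<ge> real k * norm (\<kappa> * defect l (h 0) x) - norm (h 0 x)"
      using norm_triangle_ineq2[of "of_nat k * \<kappa> * defect l (h 0) x" "h 0 x"]
      by (simp add: norm_minus_commute norm_mult mult.assoc)
    finally show False using k bd[of 0 x] bd[of k x] by linarith
  qed
  then show ?thesis using Dk[of k x] by simp
qed

lemma orbit_defect:
  assumes bd: "\<And>k y. norm (h k y) \<le> C"
    and orb: "\<And>k. exp_nbr \<kappa> (h (Suc k)) = (\<lambda>x. a * h k x)"
  shows "\<exists>C'. \<forall>k y. norm ((defect l ^^ n) (h k) y) \<le> C'"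
    and "exp_nbr \<kappa> ((defect l ^^ n) (h (Suc k))) = (\<lambda>x. a * (defect l ^^ n) (h k) x)"
proof -
  have 1: "\<exists>C'. \<forall>k y. norm ((defect l ^^ n) (h k) y) \<le> C'" for n
  proof (induction n)
    case 0
    show ?case using bd by auto
  next
    case (Suc n)
    then obtain C' where "\<And>k y. norm ((defect l ^^ n) (h k) y) \<le> C'" by blast
    then show ?case using defect_bound[of "(defect l ^^ n) (h k)" C' l for k] by auto
  qed
  show "\<exists>C'. \<forall>k y. norm ((defect l ^^ n) (h k) y) \<le> C'" by (rule 1)
  show "exp_nbr \<kappa> ((defect l ^^ n) (h (Suc k))) = (\<lambda>x. a * (defect l ^^ n) (h k) x)"
  proof (induction n)
    case 0
    show ?case using orb by simp
  next
    case (Suc n)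
    obtain C' where C': "\<And>k y. norm ((defect l ^^ n) (h k) y) \<le> C'" using 1[of n] by blast
    have "exp_nbr \<kappa> ((defect l ^^ Suc n) (h (Suc k))) = defect l (exp_nbr \<kappa> ((defect l ^^ n) (h (Suc k))))"
      using exp_nbr_defect[of "(defect l ^^ n) (h (Suc k))" C' l \<kappa>, OF C'] by (simp add: fun_eq_iff)
    also have "\<dots> = (\<lambda>x. a * (defect l ^^ Suc n) (h k) x)" unfolding Suc.IH defect_scale by simp
    finally show ?case .
  qed
qed

text \<open>
  The analytic core. Everything is bounded by \<open>O(1/k)\<close> while the left side does not depend on \<open>k\<close>.
  The hypothesis \<open>peak\<close> says that the exponent has a nondegenerate maximum at \<open>w1\<close>, expressed by the
  squared chord, which is \<open>2 \<rho>\<^sup>2\<close> times one minus the cosine of the angle.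
\<close>

lemma orbit_extremal_power:
  fixes p M \<Phi>0 \<rho> :: real
  assumes p: "1 \<le> p" "p < 2" "M > 0"
    and weak: "\<And>k. weak_norm (conj_exponent p) (g k) \<le> ennreal M"
    and orb: "\<And>k. exp_nbr \<kappa> (g (Suc k)) = (\<lambda>x. a * g k x)"
    and rho: "\<rho> = real q powr (1 / p - 1 / 2)" and w1: "norm w1 = \<rho>"
    and Phi: "\<Phi>0 > 0"
    and peak: "\<And>w. norm w = \<rho> \<Longrightarrow>
        Re (\<kappa> * eigval q w) = Re (\<kappa> * eigval q w1) - \<Phi>0 * ((norm (w - w1))\<^sup>2 / (2 * \<rho>\<^sup>2))"
    and a: "norm a = exp (Re (\<kappa> * eigval q w1))"
  shows "(defect (eigval q w1) ^^ 4) (g 0) x = 0"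
proof -
  define l where "l = eigval q w1"
  have q0: "real q > 0" "q \<ge> 1" using q_ge_2 by auto
  have r1: "\<rho> \<ge> 1" unfolding rho using p q_ge_1 by (intro ge_one_powr_ge_zero) (auto simp: field_simps)
  have bd: "norm (g k y) \<le> M" for k y by (rule weak_norm_bounded[OF p weak])
  have na: "norm a > 0" unfolding a by simp
  have a0: "a \<noteq> 0" using na by auto
  define r where "r = norm a"
  define c where "c k = (defect_coeff q l ^^ 4) (exp_coeff q (of_nat k * \<kappa>))" for k
  have rc: "rapid (c k)" for k unfolding c_def by (intro rapid_defect_coeff_power rapid_exp_coeff)
  have ser: "(\<Sum>m. c k m * cheb q w m) = (eigval q w - l) ^ 4 * (exp (of_nat k * \<kappa> * eigval q w) * (w - inverse w))"
    if "norm w \<ge> 1" for k w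
    unfolding c_def cheb_series_defect_coeff_power[OF rapid_exp_coeff that q0(2)] cheb_series_exp_coeff[OF that q0(2)] ..
  have bs: "a ^ k * (defect l ^^ 4) (g 0) x = (\<Sum>m. c k m * ball_sum m (g k) x)" for k
  proof -
    have "exp_nbr (of_nat k * \<kappa>) (g (k + 0)) = (\<lambda>x. a ^ k * g 0 x)" by (rule exp_nbr_orbit[of g M, OF bd orb])
    then have "(defect l ^^ 4) (exp_nbr (of_nat k * \<kappa>) (g k)) x = a ^ k * (defect l ^^ 4) (g 0) x"
      by (simp add: defect_power_scale)
    moreover have "exp_nbr (of_nat k * \<kappa>) (g k) = ball_series (exp_coeff q (of_nat k * \<kappa>)) (g k)"
      using exp_nbr_ball_series[of "g k" M, OF bd] by blast
    ultimately show ?thesis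
      using defect_power_ball_series[OF rapid_exp_coeff, of "g k" M] bd by (simp add: c_def ball_series_def)
  qed
  have qp: "sqrt q ^ m * \<rho> ^ m = real q powr (real m / p)" for m
  proof -
    have "sqrt q * \<rho> = real q powr (1 / p)"
      unfolding rho using q0 by (simp add: powr_add[symmetric] flip: powr_half_sqrt)
    then have "sqrt q ^ m * \<rho> ^ m = (real q powr (1 / p)) ^ m" by (simp flip: power_mult_distrib)
    also have "\<dots> = real q powr (real m / p)" using q0 by (simp add: powr_powr flip: powr_realpow)
    finally show ?thesis .
  qed
  have sumc: "summable (\<lambda>m. norm (c k m) * (sqrt q * R) ^ m)" if "R \<ge> 1" for k R
  proof -
    have "1 * 1 \<le> sqrt q * R" using that q0 by (intro mult_mono) auto
    then show ?thesis
      using rapid_summable[OF rc, of "sqrt q * R" "\<lambda>m. of_real ((sqrt q * R) ^ m)" 1] that q0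
      by (simp add: norm_mult norm_power)
  qed
  have nwi: "norm (w - inverse w) \<le> 2 * R" if "norm w = R" "R \<ge> 1" for w :: complex and R
  proof -
    have "norm (w - inverse w) \<le> R + inverse R" using norm_triangle_ineq4[of w "inverse w"] that by (simp add: norm_inverse)
    also have "inverse R \<le> R" using that by (meson inverse_le_1_iff order_trans)
    finally show ?thesis by simp
  qed
  \<comment> \<open>First Cauchy estimate, on the circle through \<open>w1\<close>: no exponential loss, and decay \<open>1 / k\<^sup>2\<close>.\<close>
  define K1 where "K1 = 256 * (real q)\<^sup>2 * \<rho> ^ 5 / \<Phi>0\<^sup>2"
  have K1: "K1 \<ge> 0" using r1 by (simp add: K1_def)
  have b1: "norm (c k m) * real q powr (real m / p) \<le> r ^ k * (K1 / (real k)\<^sup>2)" if k: "k > 0" for k m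
  proof -
    have "norm (c k m) * sqrt q ^ m * \<rho> ^ Suc m \<le> r ^ k * (K1 / (real k)\<^sup>2)"
    proof (rule coeff_bound_from_circle[OF r1 sumc[OF r1]])
      have w_ge: "1 \<le> norm w" if "norm w = \<rho>" for w :: complex using that r1 by simp
      fix w :: complex assume w: "norm w = \<rho>"
      have w0: "w \<noteq> 0" "w1 \<noteq> 0" using w w1 r1 by auto
      define y where "y = (norm (w - w1))\<^sup>2 / (2 * \<rho>\<^sup>2)"
      have y0: "y \<ge> 0" by (simp add: y_def)
      have "eigval q w - l = of_real (sqrt q) * ((w - w1) * (1 - inverse (w * w1)))"
        unfolding eigval_def l_def using w0 by (simp add: field_simps)
      then have "norm (eigval q w - l) = sqrt q * (norm (w - w1) * norm (1 - inverse (w * w1)))"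
        by (simp add: norm_mult)
      also have "norm (1 - inverse (w * w1)) \<le> 1 + inverse (\<rho> * \<rho>)"
        using norm_triangle_ineq4[of 1 "inverse (w * w1)"] w w1 by (simp add: norm_inverse norm_mult)
      also have "inverse (\<rho> * \<rho>) \<le> 1" using r1 mult_le_one[of "inverse \<rho>" "inverse \<rho>"] by (simp add: inverse_le_1_iff)
      finally have "norm (eigval q w - l) \<le> sqrt q * (norm (w - w1) * (1 + 1))" by (simp add: mult_left_mono)
      then have "norm (eigval q w - l) ^ 4 \<le> (sqrt q * (norm (w - w1) * 2)) ^ 4" by (intro power_mono) auto
      also have "\<dots> = 64 * (real q)\<^sup>2 * \<rho> ^ 4 * y\<^sup>2"
      proof -
        have "sqrt q ^ 4 = (real q)\<^sup>2" by (simp add: power4_eq_xxxx power2_eq_square)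
        then show ?thesis using r1 by (simp add: y_def power_mult_distrib field_simps power_divide)
      qed
      finally have A: "norm (eigval q w - l) ^ 4 \<le> 64 * (real q)\<^sup>2 * \<rho> ^ 4 * y\<^sup>2" .
      have "norm (exp (of_nat k * \<kappa> * eigval q w)) = exp (real k * Re (\<kappa> * eigval q w))"
        by (simp add: norm_exp_eq_Re mult.assoc)
      also have "\<dots> = exp (real k * Re (\<kappa> * eigval q w1)) * exp (- (real k * \<Phi>0 * y))"
        unfolding peak[OF w] y_def by (simp add: exp_add[symmetric] algebra_simps)
      also have "exp (real k * Re (\<kappa> * eigval q w1)) = r ^ k" unfolding r_def a by (simp add: exp_of_nat_mult)
      finally have Bq: "norm (exp (of_nat k * \<kappa> * eigval q w)) = r ^ k * exp (- (real k * \<Phi>0 * y))" .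
      have "norm (\<Sum>m. c k m * cheb q w m) =
         norm (eigval q w - l) ^ 4 * (r ^ k * exp (- (real k * \<Phi>0 * y)) * norm (w - inverse w))"
        unfolding ser[OF w_ge[OF w]] norm_mult norm_power Bq by (simp only: mult.assoc)
      also have "\<dots> \<le> (64 * (real q)\<^sup>2 * \<rho> ^ 4 * y\<^sup>2) * (r ^ k * exp (- (real k * \<Phi>0 * y)) * (2 * \<rho>))"
        using A nwi[OF w r1] r1 na by (intro mult_mono) (auto simp: r_def)
      also have "\<dots> = 128 * (real q)\<^sup>2 * \<rho> ^ 5 * r ^ k * (y\<^sup>2 * exp (- (real k * \<Phi>0 * y)))"
        by (simp add: eval_nat_numeral)
      also have "\<dots> \<le> 128 * (real q)\<^sup>2 * \<rho> ^ 5 * r ^ k * (2 / (real k * \<Phi>0)\<^sup>2)"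
        using k Phi y0 r1 na by (intro mult_left_mono square_exp_bound) (auto simp: r_def)
      also have "\<dots> = r ^ k * (K1 / (real k)\<^sup>2)" by (simp add: K1_def power_mult_distrib mult_ac)
      finally show "norm (\<Sum>m. c k m * cheb q w m) \<le> r ^ k * (K1 / (real k)\<^sup>2)" .
    qed
    moreover have "norm (c k m) * real q powr (real m / p) \<le> norm (c k m) * sqrt q ^ m * \<rho> ^ Suc m"
    proof -
      have "norm (c k m) * (sqrt q ^ m * \<rho> ^ m) * 1 \<le> norm (c k m) * (sqrt q ^ m * \<rho> ^ m) * \<rho>"
        using r1 by (intro mult_left_mono) auto
      then show ?thesis unfolding qp[symmetric] by (simp add: mult_ac)
    qed
    ultimately show ?thesis by linarith
  qed
  \<comment> \<open>Second Cauchy estimate, on the doubled circle: exponential loss in \<open>k\<close>, but a gain \<open>(1/2) ^ m\<close>.\<close>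
  define \<Lambda> where "\<Lambda> = sqrt q * (2 * \<rho> + 1)"
  define L where "L = (2 * \<Lambda>) ^ 4 * (4 * \<rho>)"
  define C' where "C' = norm \<kappa> * \<Lambda>"
  have L0: "\<Lambda> \<ge> 0" "L \<ge> 0" "C' \<ge> 0" using r1 by (auto simp: \<Lambda>_def L_def C'_def)
  have eb: "norm (eigval q w) \<le> \<Lambda>" if "1 \<le> norm w" "norm w \<le> 2 * \<rho>" for w
  proof -
    have "inverse (norm w) \<le> 1" using that by (simp add: inverse_le_1_iff)
    then have "norm (w + inverse w) \<le> 2 * \<rho> + 1"
      using norm_triangle_ineq[of w "inverse w"] that by (simp add: norm_inverse)
    then show ?thesis unfolding eigval_def \<Lambda>_def by (simp add: norm_mult mult_left_mono)
  qed
  have b2: "norm (c k m) * real q powr (real m / p) \<le> L * exp (real k * C') * (1 / 2) ^ m" for k m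
  proof -
    have r2: "2 * \<rho> \<ge> 1" using r1 by simp
    have "norm (c k m) * sqrt q ^ m * (2 * \<rho>) ^ Suc m \<le> L * exp (real k * C')"
    proof (rule coeff_bound_from_circle[OF r2 sumc[OF r2]])
      fix w :: complex assume w: "norm w = 2 * \<rho>"
      have e: "norm (eigval q w) \<le> \<Lambda>" "norm l \<le> \<Lambda>" using eb[of w] eb[of w1] w w1 r1 by (auto simp: l_def)
      have "norm (eigval q w - l) ^ 4 \<le> (2 * \<Lambda>) ^ 4"
        using norm_triangle_ineq4[of "eigval q w" l] e by (intro power_mono) auto
      moreover have "norm (exp (of_nat k * \<kappa> * eigval q w)) \<le> exp (real k * C')"
      proof -
        have "norm (exp (of_nat k * \<kappa> * eigval q w)) \<le> exp (norm (of_nat k * \<kappa> * eigval q w))" by (rule norm_exp)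
        also have "\<dots> \<le> exp (real k * C')"
          using e(1) by (simp add: norm_mult C'_def mult.assoc mult_left_mono)
        finally show ?thesis .
      qed
      moreover have "norm (w - inverse w) \<le> 4 * \<rho>" using nwi[OF w r2] by simp
      ultimately have "norm (eigval q w - l) ^ 4 * (norm (exp (of_nat k * \<kappa> * eigval q w)) * norm (w - inverse w))
        \<le> (2 * \<Lambda>) ^ 4 * (exp (real k * C') * (4 * \<rho>))"
        by (intro mult_mono) auto
      then show "norm (\<Sum>m. c k m * cheb q w m) \<le> L * exp (real k * C')"
        using w r2 by (subst ser) (simp_all add: norm_mult norm_power L_def mult_ac)
    qed
    moreover have "(norm (c k m) * real q powr (real m / p)) * 2 ^ m \<le> norm (c k m) * sqrt q ^ m * (2 * \<rho>) ^ Suc m"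
    proof -
      have "(norm (c k m) * (sqrt q ^ m * \<rho> ^ m) * 2 ^ m) * 1 \<le> (norm (c k m) * (sqrt q ^ m * \<rho> ^ m) * 2 ^ m) * (2 * \<rho>)"
        using r1 by (intro mult_left_mono) auto
      then show ?thesis unfolding qp[symmetric] by (simp add: mult_ac power_mult_distrib)
    qed
    ultimately have "(norm (c k m) * real q powr (real m / p)) * 2 ^ m \<le> L * exp (real k * C')" by linarith
    then show ?thesis by (simp add: power_one_over field_simps)
  qed
  \<comment> \<open>From \<open>m = J * k\<close> on, the gain of the second estimate outweighs its loss.\<close>
  obtain J :: nat where J: "exp (C' + 1) / r \<le> 2 ^ J"
    using real_arch_pow[of 2 "exp (C' + 1) / r"] by (auto intro: less_imp_le)
  define B where "B = 4 * M * (real J * K1 + 2 * L)"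
  have main: "norm ((defect l ^^ 4) (g 0) x) \<le> B / real k" if k: "k > 0" for k
  proof -
    define t where "t m = norm (c k m) * real q powr (real m / p)" for m
    define N where "N = J * k"
    have t2: "t (i + N) \<le> (L * exp (real k * C') * (1/2) ^ N) * (1/2) ^ i" for i
      using b2[of k "i + N"] by (simp add: t_def power_add mult_ac)
    have sg: "summable (\<lambda>i. (L * exp (real k * C') * (1/2) ^ N) * (1/2::real) ^ i)"
      by (intro summable_mult summable_geometric) auto
    have st: "summable t"
      by (rule summable_comparison_test'[where g = "\<lambda>m. (L * exp (real k * C')) * (1/2) ^ m"])
        (use b2 in \<open>auto simp: t_def intro!: summable_mult summable_geometric\<close>)
    \<comment> \<open>The terms from \<open>N\<close> on are estimated on the doubled circle, the first \<open>N\<close> terms on the circle through \<open>w1\<close>.\<close>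
    have "(\<Sum>i. t (i + N)) \<le> (\<Sum>i. (L * exp (real k * C') * (1/2) ^ N) * (1/2::real) ^ i)"
      by (intro suminf_le t2 sg summable_ignore_initial_segment st)
    also have "\<dots> = 2 * L * (exp (real k * C') * (1/2) ^ N)"
      by (subst suminf_mult) (auto intro: summable_geometric simp: suminf_geometric)
    also have "exp (real k * C') * (1/2) ^ N \<le> r ^ k / real k"
    proof -
      have "exp (real k * C') * exp (real k) = exp (C' + 1) ^ k"
        by (simp add: exp_of_nat_mult[symmetric] exp_add[symmetric] algebra_simps)
      also have "\<dots> \<le> (2 ^ J * r) ^ k" using J na by (intro power_mono) (auto simp: r_def field_simps)
      also have "\<dots> = 2 ^ N * r ^ k" by (simp add: power_mult_distrib N_def power_mult)
      finally have e1: "exp (real k * C') * exp (real k) \<le> 2 ^ N * r ^ k" .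
      have "real k \<le> exp (real k)" using exp_ge_add_one_self[of "real k"] by linarith
      then have "exp (real k * C') * real k \<le> exp (real k * C') * exp (real k)" by (intro mult_left_mono) auto
      with e1 have "exp (real k * C') * real k \<le> 2 ^ N * r ^ k" by linarith
      then show ?thesis using k by (simp add: power_one_over field_simps)
    qed
    finally have tail: "(\<Sum>i. t (i + N)) \<le> 2 * L * (r ^ k / real k)" using L0 by (simp add: mult_left_mono)
    have "(\<Sum>m<N. t m) \<le> real N * (r ^ k * (K1 / (real k)\<^sup>2))"
      using sum_bounded_above[of "{..<N}" t "r ^ k * (K1 / (real k)\<^sup>2)"] b1[OF k] by (simp add: t_def)
    also have "\<dots> = real J * K1 * (r ^ k / real k)" using k by (simp add: N_def power2_eq_square)
    finally have head: "(\<Sum>m<N. t m) \<le> real J * K1 * (r ^ k / real k)" .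
    have tot: "suminf t \<le> (real J * K1 + 2 * L) * (r ^ k / real k)"
      unfolding suminf_split_initial_segment[OF st, of N] distrib_right using head tail by linarith
    have ct: "norm (c k m * ball_sum m (g k) x) \<le> 4 * M * t m" for m
      using mult_left_mono[OF ball_sum_weak_bound[OF p weak[of k], of m x], of "norm (c k m)"]
      by (simp add: norm_mult t_def mult_ac)
    have sc: "summable (\<lambda>m. norm (c k m * ball_sum m (g k) x))"
      by (rule summable_comparison_test'[OF summable_mult[OF st, of "4 * M"]]) (use ct in auto)
    have "r ^ k * norm ((defect l ^^ 4) (g 0) x) = norm (\<Sum>m. c k m * ball_sum m (g k) x)"
      unfolding bs[symmetric] by (simp add: norm_mult norm_power r_def)
    also have "\<dots> \<le> (\<Sum>m. norm (c k m * ball_sum m (g k) x))" by (rule summable_norm[OF sc])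
    also have "\<dots> \<le> (\<Sum>m. 4 * M * t m)" by (intro suminf_le ct sc summable_mult st)
    also have "\<dots> = 4 * M * suminf t" by (rule suminf_mult[OF st])
    also have "\<dots> \<le> 4 * M * ((real J * K1 + 2 * L) * (r ^ k / real k))" using p tot by (intro mult_left_mono) auto
    also have "\<dots> = r ^ k * (B / real k)" by (simp add: B_def)
    finally show ?thesis by (rule mult_left_le_imp_le) (use na in \<open>simp add: r_def\<close>)
  qed
  have "norm ((defect l ^^ 4) (g 0) x) \<le> 0"
  proof (rule LIMSEQ_le_const)
    show "(\<lambda>k. B / real k) \<longlonglongrightarrow> 0" by (rule lim_const_over_n)
    show "\<exists>N. \<forall>n\<ge>N. norm ((defect l ^^ 4) (g 0) x) \<le> B / real n"
      using main by (intro exI[of _ 1]) auto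
  qed
  then show ?thesis by (simp add: l_def)
qed

text \<open>
  The fourth power of the defect vanishes along the whole orbit, as the hypotheses are invariant
  under shifts; it is then lowered step by step, each time applying
  \<open>bounded_orbit_nilpotent\<close> to the orbit of a power of the defect.
\<close>

lemma orbit_extremal_eigenfunction:
  fixes p M \<Phi>0 \<rho> :: real
  assumes p: "1 \<le> p" "p < 2" "M > 0"
    and weak: "\<And>k. weak_norm (conj_exponent p) (g k) \<le> ennreal M"
    and orb: "\<And>k. exp_nbr \<kappa> (g (Suc k)) = (\<lambda>x. a * g k x)"
    and rho: "\<rho> = real q powr (1 / p - 1 / 2)" and w1: "norm w1 = \<rho>"
    and Phi: "\<Phi>0 > 0" and "\<kappa> \<noteq> 0"
    and peak: "\<And>w. norm w = \<rho> \<Longrightarrow>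
        Re (\<kappa> * eigval q w) = Re (\<kappa> * eigval q w1) - \<Phi>0 * ((norm (w - w1))\<^sup>2 / (2 * \<rho>\<^sup>2))"
    and a: "norm a = exp (Re (\<kappa> * eigval q w1))"
  shows "nbr_sum (g k) x = eigval q w1 * g k x"
proof -
  define l where "l = eigval q w1"
  have bd: "norm (g k y) \<le> M" for k y by (rule weak_norm_bounded[OF p weak])
  have a': "norm a = norm (exp (\<kappa> * l))" using a by (simp add: l_def norm_exp_eq_Re)
  have 4: "(defect l ^^ 4) (g k) x = 0" for k x
  proof -
    have "exp_nbr \<kappa> (g (Suc n + k)) = (\<lambda>x. a * g (n + k) x)" for n using orb[of "n + k"] by simp
    from orbit_extremal_power[where g = "\<lambda>n. g (n + k)", OF p weak this rho w1 Phi peak a]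
    show ?thesis by (simp add: l_def)
  qed
  have down: "(defect l ^^ Suc n) (g k) x = 0" if "\<And>k x. (defect l ^^ Suc (Suc n)) (g k) x = 0" for n k x
  proof -
    obtain C' where C': "\<And>k y. norm ((defect l ^^ n) (g k) y) \<le> C'" using orbit_defect(1)[of g M, OF bd orb] by blast
    have "defect l ((defect l ^^ n) (g k)) x = 0"
      by (rule bounded_orbit_nilpotent[where h = "\<lambda>k. (defect l ^^ n) (g k)", OF C' orbit_defect(2)[of g M, OF bd orb] _ assms(9) a'])
        (use that in simp)
    then show ?thesis by simp
  qed
  have "(defect l ^^ Suc 0) (g k) x = 0"
  proof -
    have s: "(4::nat) = Suc (Suc (Suc (Suc 0)))" by simp
    have 3: "(defect l ^^ Suc (Suc (Suc 0))) (g k) x = 0" for k x by (rule down) (rule 4[unfolded s])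
    have 2: "(defect l ^^ Suc (Suc 0)) (g k) x = 0" for k x by (rule down) (rule 3)
    show ?thesis by (rule down) (rule 2)
  qed
  then show ?thesis by (simp add: defect_def l_def)
qed

end

section \<open>Children, rays and sectors\<close>

locale rooted_tree = hom_tree adj q for adj :: "'a \<Rightarrow> 'a \<Rightarrow> bool" and q +
  fixes x0 :: 'a
begin

abbreviation level :: "'a \<Rightarrow> nat" where "level x \<equiv> d x0 x"

definition children :: "'a \<Rightarrow> 'a set" where
  "children x = {y \<in> nbrs x. level y = level x + 1}"

definition parent :: "'a \<Rightarrow> 'a" where
  "parent y = the_elem {z \<in> nbrs y. level z + 1 = level y}"

lemma parent_eq: "y \<noteq> x0 \<Longrightarrow> {z \<in> nbrs y. level z + 1 = level y} = {parent y}"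
  unfolding parent_def using closer_nbr[of y x0] by (metis the_elem_eq)

lemma level_parent: "y \<noteq> x0 \<Longrightarrow> level (parent y) + 1 = level y"
  using parent_eq[of y] by blast

lemma adj_parent: "y \<noteq> x0 \<Longrightarrow> adj y (parent y)"
  using parent_eq[of y] by (auto simp: nbrs_def)

lemma parent_unique: "adj y z \<Longrightarrow> level z + 1 = level y \<Longrightarrow> z = parent y"
proof -
  assume a: "adj y z" "level z + 1 = level y"
  then have "y \<noteq> x0" by auto
  from parent_eq[OF this] a show "z = parent y" by (auto simp: nbrs_def)
qed

lemma children_iff: "y \<in> children x \<longleftrightarrow> y \<noteq> x0 \<and> parent y = x"
proof
  assume "y \<in> children x"
  then have a: "adj x y" "level y = level x + 1" by (auto simp: children_def nbrs_def)
  then have "y \<noteq> x0" by (metis add_is_0 gdist_refl one_neq_zero)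
  then show "y \<noteq> x0 \<and> parent y = x" using parent_unique[OF adj_sym[OF a(1)]] a(2) by simp
next
  assume a: "y \<noteq> x0 \<and> parent y = x"
  have "adj x y" using adj_sym[OF adj_parent] a by blast
  moreover have "level y = level x + 1" using level_parent a by force
  ultimately show "y \<in> children x" by (auto simp: children_def nbrs_def)
qed

lemma level_child: "y \<in> children x \<Longrightarrow> level y = Suc (level x)"
  by (simp add: children_def)

lemma finite_children [simp]: "finite (children x)"
  by (simp add: children_def)

lemma children_root: "children x0 = nbrs x0"
  using gdist_eq_1[of x0] by (auto simp: children_def nbrs_def)

lemma card_children: "card (children x) = (if x = x0 then q + 1 else q)"
  using card_farther_nbrs[of x x0] by (auto simp: children_root card_nbrs) (simp add: children_def)

lemma card_children_pos: "card (children x) > 0" using q_ge_2 by (simp add: card_children)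

lemma nbrs_split: "x \<noteq> x0 \<Longrightarrow> nbrs x = insert (parent x) (children x)"
  using parent_eq[of x] nbr_dist_cases[of x _ x0] by (auto simp: children_def nbrs_def)

lemma parent_notin_children: "x \<noteq> x0 \<Longrightarrow> parent x \<notin> children x"
  using level_parent[of x] by (auto simp: children_def)

lemma nbr_sum_split: "nbr_sum u x = (if x = x0 then 0 else u (parent x)) + (\<Sum>y\<in>children x. u y)"
  by (cases "x = x0") (auto simp: nbr_sum_def nbrs_split parent_notin_children children_root)

lemma level_induct [case_names root child]:
  assumes "P x0" "\<And>y. y \<noteq> x0 \<Longrightarrow> P (parent y) \<Longrightarrow> P y"
  shows "P x"
proof (induction "level x" arbitrary: x rule: less_induct)
  case less
  show ?case
  proof (cases "x = x0")
    case False
    have "level (parent x) < level x" using level_parent[OF False] by simp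
    from assms(2)[OF False less[OF this]] show ?thesis .
  qed (simp add: assms(1))
qed

abbreviation \<Omega> where "\<Omega> \<equiv> rays adj x0"
abbreviation sector where "sector \<equiv> boundary_sector adj x0"

lemma rays_iff: "\<omega> \<in> \<Omega> \<longleftrightarrow> \<omega> 0 = x0 \<and> (\<forall>n. \<omega> (Suc n) \<in> children (\<omega> n))"
proof
  assume a: "\<omega> \<in> \<Omega>"
  then have w0: "\<omega> 0 = x0" and dist: "\<And>m n. m \<le> n \<Longrightarrow> d (\<omega> m) (\<omega> n) = n - m" by (auto simp: rays_def)
  have l: "level (\<omega> n) = n" for n using dist[of 0 n] w0 by simp
  have "adj (\<omega> n) (\<omega> (Suc n))" for n using dist[of n "Suc n"] gdist_eq_1 by simp
  then show "\<omega> 0 = x0 \<and> (\<forall>n. \<omega> (Suc n) \<in> children (\<omega> n))" using w0 by (simp add: children_def nbrs_def l)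
next
  assume a: "\<omega> 0 = x0 \<and> (\<forall>n. \<omega> (Suc n) \<in> children (\<omega> n))"
  have l: "level (\<omega> n) = n" for n
  proof (induction n)
    case (Suc n)
    show ?case using level_child[of "\<omega> (Suc n)" "\<omega> n"] a Suc by simp
  qed (use a in simp)
  have le: "d (\<omega> m) (\<omega> (m + k)) \<le> k" for m k
  proof (induction k)
    case (Suc k)
    have "adj (\<omega> (m + k)) (\<omega> (Suc (m + k)))" using a by (auto simp: children_def nbrs_def)
    from gdist_adj[OF this, of "\<omega> m"] Suc show ?case by simp
  qed simp
  have "d (\<omega> m) (\<omega> n) = n - m" if "m \<le> n" for m n
    using le[of m "n - m"] gdist_triangle[of x0 "\<omega> n" "\<omega> m"] that by (simp add: l)
  then show "\<omega> \<in> \<Omega>" using a by (simp add: rays_def)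
qed

lemma ray_level: "\<omega> \<in> \<Omega> \<Longrightarrow> level (\<omega> n) = n"
proof (induction n)
  case (Suc n)
  then show ?case using level_child[of "\<omega> (Suc n)" "\<omega> n"] by (simp add: rays_iff)
qed (simp add: rays_iff)

lemma ray_parent: "\<omega> \<in> \<Omega> \<Longrightarrow> parent (\<omega> (Suc n)) = \<omega> n"
  by (auto simp: rays_iff children_iff)

text \<open>
  The level of the confluence point of \<open>x\<close> and \<open>\<omega>\<close>, which is all that the Poisson kernel depends on.
\<close>

definition conf_level :: "'a \<Rightarrow> (nat \<Rightarrow> 'a) \<Rightarrow> nat" where
  "conf_level x \<omega> = level (confluent adj x0 x \<omega>)"

lemma conf_level_char:
  assumes w: "\<omega> \<in> \<Omega>"
  shows "conf_level x \<omega> + d (\<omega> (conf_level x \<omega>)) x = level x"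
    and "j + d (\<omega> j) x = level x \<Longrightarrow> j \<le> conf_level x \<omega>"
proof -
  let ?P = "\<lambda>v. v \<in> range \<omega> \<and> level v + d v x = level x"
  have "?P x0" using w by (auto simp: rays_iff intro: range_eqI[of _ _ 0])
  moreover have "\<forall>v. ?P v \<longrightarrow> level v < level x + 1" by auto
  ultimately have m: "?P (arg_max level ?P) \<and> (\<forall>v. ?P v \<longrightarrow> level v \<le> level (arg_max level ?P))"
    by (rule arg_max_nat_lemma)
  then obtain i where i: "arg_max level ?P = \<omega> i" by blast
  have c: "conf_level x \<omega> = i" unfolding conf_level_def confluent_def using i ray_level[OF w] by simp
  show "conf_level x \<omega> + d (\<omega> (conf_level x \<omega>)) x = level x" using m unfolding c i by (simp add: ray_level[OF w])
  assume "j + d (\<omega> j) x = level x"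
  then have "?P (\<omega> j)" by (simp add: ray_level[OF w])
  with m have "level (\<omega> j) \<le> level (arg_max level ?P)" by blast
  then show "j \<le> conf_level x \<omega>" unfolding c i by (simp add: ray_level[OF w])
qed

lemma conf_level_le: "\<omega> \<in> \<Omega> \<Longrightarrow> conf_level x \<omega> \<le> level x"
  using conf_level_char(1)[of \<omega> x] by linarith

lemma conf_level_eq_level: "\<omega> \<in> \<Omega> \<Longrightarrow> conf_level x \<omega> = level x \<longleftrightarrow> \<omega> (level x) = x"
  using conf_level_char(1)[of \<omega> x] conf_level_char(2)[of \<omega> "level x" x] conf_level_le[of \<omega> x] by (metis add_cancel_right_right gdist_eq_0 gdist_refl le_antisym)

lemma sector_iff: "\<omega> \<in> sector x \<longleftrightarrow> \<omega> \<in> \<Omega> \<and> \<omega> (level x) = x"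
  using conf_level_eq_level by (auto simp: boundary_sector_def conf_level_def)

text \<open>
  Passing to the parent changes the confluence point only if \<open>x\<close> itself lies on the ray. This
  makes the Poisson kernel computable by recursion on the level.
\<close>

lemma conf_level_parent:
  assumes w: "\<omega> \<in> \<Omega>" and x: "x \<noteq> x0"
  shows "conf_level (parent x) \<omega> = (if \<omega> \<in> sector x then level x - 1 else conf_level x \<omega>)"
proof (cases "\<omega> \<in> sector x")
  case True
  then have "\<omega> (level x) = x" by (simp add: sector_iff)
  then have "\<omega> (level (parent x)) = parent x"
    using ray_parent[OF w, of "level (parent x)"] level_parent[OF x] by (metis Suc_eq_plus1)
  then have "conf_level (parent x) \<omega> = level (parent x)" using conf_level_eq_level[OF w] by blast
  then show ?thesis using True level_parent[OF x] by simp
next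
  case False
  then have ne: "\<omega> (level x) \<noteq> x" using w by (simp add: sector_iff)
  have eqv: "j + d (\<omega> j) x = level x \<longleftrightarrow> j + d (\<omega> j) (parent x) = level (parent x)" for j
  proof
    assume a: "j + d (\<omega> j) x = level x"
    then have "d (\<omega> j) x \<noteq> 0" using ne by (metis add_cancel_left_right add_0_right gdist_eq_0 )
    then obtain n where n: "d (\<omega> j) x = Suc n" using not0_implies_Suc by blast
    obtain z where z: "adj x z" "d (\<omega> j) z = n" using n by (rule exists_closer)
    have "level z \<le> j + n" using gdist_triangle[of x0 z "\<omega> j"] ray_level[OF w] z by simp
    moreover have "level z + 1 = level x \<or> level z = level x + 1" by (rule nbr_dist_cases[OF z(1)])
    ultimately have "level z + 1 = level x" using a n by linarith
    from parent_unique[OF z(1) this] z(2) show "j + d (\<omega> j) (parent x) = level (parent x)"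
      using a n level_parent[OF x] by simp
  next
    assume a: "j + d (\<omega> j) (parent x) = level (parent x)"
    have "d (\<omega> j) x \<le> d (\<omega> j) (parent x) + 1" by (rule gdist_adj[OF adj_sym[OF adj_parent[OF x]]])
    moreover have "level x \<le> j + d (\<omega> j) x" using gdist_triangle[of x0 x "\<omega> j"] ray_level[OF w] by simp
    ultimately show "j + d (\<omega> j) x = level x" using a level_parent[OF x] by linarith
  qed
  have "conf_level (parent x) \<omega> = conf_level x \<omega>"
    using conf_level_char(1)[OF w, of x] conf_level_char(1)[OF w, of "parent x"]
      conf_level_char(2)[OF w, of "conf_level x \<omega>" "parent x"] conf_level_char(2)[OF w, of "conf_level (parent x) \<omega>" x] eqv
    by (intro le_antisym) blast+
  then show ?thesis using False by simp
qed

lemma conf_level_root: "\<omega> \<in> \<Omega> \<Longrightarrow> conf_level x0 \<omega> = 0"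
  using conf_level_le[of \<omega> x0] by simp

lemma sector_root: "sector x0 = \<Omega>"
  by (auto simp: sector_iff rays_iff)

text \<open>
  Two rays that agree at a level agree below it. In particular the sectors together with the
  empty set are closed under intersection.
\<close>

lemma sector_disjoint_or_sub:
  "sector x \<inter> sector y \<in> {{}, sector x, sector y}"
proof -
  have anc: "sector y \<subseteq> sector x" if "\<omega> \<in> sector x" "\<omega> \<in> sector y" "level x \<le> level y" for x y \<omega>
  proof
    fix \<eta> assume eta: "\<eta> \<in> sector y"
    have "\<eta> (level y - i) = \<omega> (level y - i)" if "i \<le> level y" for i
      using that
    proof (induction i)
      case 0
      then show ?case using eta \<open>\<omega> \<in> sector y\<close> by (simp add: sector_iff)
    next
      case (Suc i)
      have s: "level y - i = Suc (level y - Suc i)" using Suc.prems by simp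
      have "\<eta> (level y - Suc i) = parent (\<eta> (level y - i))" "\<omega> (level y - Suc i) = parent (\<omega> (level y - i))"
        using ray_parent eta \<open>\<omega> \<in> sector y\<close> unfolding s by (auto simp: sector_iff)
      then show ?case using Suc by simp
    qed
    from this[of "level y - level x"] have "\<eta> (level x) = \<omega> (level x)" using that(3) by simp
    then show "\<eta> \<in> sector x" using eta that(1) by (simp add: sector_iff)
  qed
  show ?thesis
  proof (cases "sector x \<inter> sector y = {}")
    case False
    then obtain \<omega> where "\<omega> \<in> sector x" "\<omega> \<in> sector y" by blast
    with anc[of \<omega> x y] anc[of \<omega> y x] show ?thesis by (metis inf.absorb1 inf.absorb2 insertCI nat_le_linear)
  qed simp
qed

section \<open>The boundary measure\<close>

text \<open>
  The index is reduced modulo the number of children, so that every digit sequence defines a ray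
  and no null set has to be removed from the space of digits.
\<close>

definition nth_child :: "'a \<Rightarrow> nat \<Rightarrow> 'a" where
  "nth_child x k = (SOME h. bij_betw h {0..<card (children x)} (children x)) (k mod card (children x))"

lemma nth_child_bij: "bij_betw (nth_child x) {0..<card (children x)} (children x)"
proof -
  let ?h = "SOME h. bij_betw h {0..<card (children x)} (children x)"
  have "bij_betw ?h {0..<card (children x)} (children x)"
    using someI_ex[OF ex_bij_betw_nat_finite[OF finite_children[of x]]] by simp
  moreover have "bij_betw (nth_child x) {0..<card (children x)} (children x) =
      bij_betw ?h {0..<card (children x)} (children x)"
    by (rule bij_betw_cong) (simp add: nth_child_def)
  ultimately show ?thesis by blast
qed

lemma nth_child_in: "nth_child x k \<in> children x"
proof -
  have "nth_child x k = nth_child x (k mod card (children x))" by (simp add: nth_child_def)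
  then show ?thesis using bij_betw_apply[OF nth_child_bij, of "k mod card (children x)"] card_children_pos by simp
qed

primrec walk :: "(nat \<Rightarrow> nat) \<Rightarrow> nat \<Rightarrow> 'a" where
  "walk ds 0 = x0"
| "walk ds (Suc n) = nth_child (walk ds n) (ds n)"

lemma walk_ray: "walk ds \<in> \<Omega>"
  by (auto simp: rays_iff nth_child_in)

definition digit :: "nat \<Rightarrow> nat measure" where
  "digit n = measure_pmf (pmf_of_set {0..<(if n = 0 then q + 1 else q)})"

definition digits :: "(nat \<Rightarrow> nat) measure" where "digits = Pi\<^sub>M UNIV digit"

lemma prob_digit: "prob_space (digit n)" by (simp add: digit_def measure_pmf.prob_space_axioms)

lemma space_digit: "space (digit n) = UNIV" and sets_digit: "sets (digit n) = UNIV" by (auto simp: digit_def)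

lemma space_digits: "space digits = UNIV" by (auto simp: digits_def space_PiM space_digit)

sublocale digits: product_prob_space digit UNIV
  using prob_digit by (intro product_prob_spaceI)

text \<open>
  Passing through \<open>x\<close> prescribes, for each step up to the level of \<open>x\<close>, exactly one of the equally
  likely digits.
\<close>

lemma walk_cylinder:
  assumes "level x = n"
  shows "\<exists>A. (\<forall>ds. walk ds n = x \<longleftrightarrow> (\<forall>i<n. ds i \<in> A i)) \<and>
    (\<forall>i<n. emeasure (digit i) (A i) = ennreal (1 / (if i = 0 then q + 1 else q)))"
  using assms
proof (induction n arbitrary: x)
  case 0
  then have "x = x0" by simp
  then show ?case by simp
next
  case (Suc n)
  then have x: "x \<noteq> x0" by auto
  have lp: "level (parent x) = n" using level_parent[OF x] Suc.prems by simp
  from Suc.IH[OF this] obtain A where A: "\<And>ds. walk ds n = parent x \<longleftrightarrow> (\<forall>i<n. ds i \<in> A i)"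
    "\<And>i. i < n \<Longrightarrow> emeasure (digit i) (A i) = ennreal (1 / (if i = 0 then q + 1 else q))" by blast
  define B where "B = {k. nth_child (parent x) k = x}"
  have xc: "x \<in> children (parent x)" using x by (simp add: children_iff)
  have cc: "card (children (parent x)) = (if n = 0 then q + 1 else q)"
  proof -
    have "parent x = x0 \<longleftrightarrow> n = 0" using lp gdist_eq_0[of x0 "parent x"] by metis
    then show ?thesis by (simp add: card_children)
  qed
  have "\<exists>k. {0..<(if n = 0 then q + 1 else q)} \<inter> B = {k}"
  proof -
    have bij: "bij_betw (nth_child (parent x)) {0..<(if n = 0 then q + 1 else q)} (children (parent x))"
      using nth_child_bij[of "parent x"] unfolding cc .
    then obtain k where k: "k \<in> {0..<(if n = 0 then q + 1 else q)}" "nth_child (parent x) k = x"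
      using xc by (metis bij_betw_imp_surj_on imageE)
    have "j = k" if "j \<in> {0..<(if n = 0 then q + 1 else q)}" "nth_child (parent x) j = x" for j
      using inj_onD[OF bij_betw_imp_inj_on[OF bij], of j k] that k by simp
    then have "{0..<(if n = 0 then q + 1 else q)} \<inter> B = {k}" using k unfolding B_def by blast
    then show ?thesis ..
  qed
  then have eB: "emeasure (digit n) B = ennreal (1 / (if n = 0 then q + 1 else q))"
    unfolding digit_def using q_ge_2
    by (subst emeasure_pmf_of_set) (auto simp: measure_pmf.emeasure_eq_measure)
  have "walk ds (Suc n) = x \<longleftrightarrow> (\<forall>i<Suc n. ds i \<in> (A(n := B)) i)" for ds
  proof -
    have "walk ds (Suc n) = x \<longleftrightarrow> walk ds n = parent x \<and> ds n \<in> B"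
      using nth_child_in[of "walk ds n" "ds n"] by (auto simp: B_def children_iff)
    also have "\<dots> \<longleftrightarrow> (\<forall>i<Suc n. ds i \<in> (A(n := B)) i)" unfolding A(1) by (auto simp: less_Suc_eq)
    finally show ?thesis .
  qed
  then show ?case using A(2) eB by (intro exI[of _ "A(n := B)"]) (auto simp: less_Suc_eq)
qed

definition sector_emeas :: "'a \<Rightarrow> ennreal" where
  "sector_emeas x = (if x = x0 then 1 else ennreal (1 / (real (q + 1) * real q ^ (level x - 1))))"

lemma walk_prob:
  "{ds. walk ds (level x) = x} \<in> sets digits"
  "emeasure digits {ds. walk ds (level x) = x} = sector_emeas x"
proof -
  let ?n = "level x"
  obtain A where A: "\<And>ds. walk ds ?n = x \<longleftrightarrow> (\<forall>i<?n. ds i \<in> A i)"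
    "\<And>i. i < ?n \<Longrightarrow> emeasure (digit i) (A i) = ennreal (1 / (if i = 0 then q + 1 else q))"
    using walk_cylinder[OF refl, of x] by blast
  have eq: "{ds. walk ds ?n = x} = {ds \<in> space digits. \<forall>i\<in>{..<?n}. ds i \<in> A i}"
    using A(1) unfolding space_digits by blast
  have "{ds \<in> space digits. \<forall>i\<in>{..<?n}. ds i \<in> A i} \<in> sets digits"
  proof -
    have "{ds \<in> space digits. \<forall>i\<in>{..<?n}. ds i \<in> A i} = prod_emb UNIV digit {..<?n} (Pi\<^sub>E {..<?n} A)"
      unfolding prod_emb_def space_digits space_PiM space_digit
      by (simp add: set_eq_iff PiE_iff Pi_iff extensional_def restrict_def)
    also have "\<dots> \<in> sets digits"
      unfolding digits_def by (rule sets_PiM_I) (auto simp: sets_digit)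
    finally show ?thesis .
  qed
  then show "{ds. walk ds ?n = x} \<in> sets digits" unfolding eq .
  have "emeasure digits {ds. walk ds ?n = x} = (\<Prod>i<?n. emeasure (digit i) (A i))"
    unfolding eq unfolding digits_def by (rule digits.emeasure_PiM_Collect) (auto simp: sets_digit)
  also have "\<dots> = (\<Prod>i<?n. ennreal (1 / (if i = 0 then q + 1 else q)))" using A(2) by simp
  also have "\<dots> = sector_emeas x"
  proof (cases "x = x0")
    case False
    then obtain m where m: "?n = Suc m" using gdist_eq_0 not0_implies_Suc by metis
    have "(\<Prod>i<Suc m. ennreal (1 / (if i = 0 then q + 1 else q))) = ennreal (\<Prod>i<Suc m. 1 / (if i = 0 then q + 1 else q))"
      by (rule prod_ennreal) simp
    also have "(\<Prod>i<Suc m. 1 / real (if i = 0 then q + 1 else q)) = 1 / (real (q + 1) * real q ^ m)"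
      unfolding prod.lessThan_Suc_shift by (simp add: power_one_over)
    finally show ?thesis using False m by (simp add: sector_emeas_def)
  qed (simp add: sector_emeas_def)
  finally show "emeasure digits {ds. walk ds ?n = x} = sector_emeas x" .
qed

abbreviation \<nu> where "\<nu> \<equiv> boundary_measure adj q x0"

lemma sector_subset: "range sector \<subseteq> Pow \<Omega>" by (auto simp: boundary_sector_def)

lemma space_\<nu>: "space \<nu> = \<Omega>" and sets_\<nu>: "sets \<nu> = sigma_sets \<Omega> (range sector)"
  unfolding boundary_measure_def
  by (rule space_extend_measure[OF sector_subset], rule sets_extend_measure[OF sector_subset])

lemma sector_sets [measurable]: "sector x \<in> sets \<nu>" unfolding sets_\<nu> by auto

text \<open>
  An extension of the prescribed masses exists, namely the law of the random walk; only its
  existence makes the boundary measure nonzero, since \<^const>\<open>extend_measure\<close> is zero otherwise.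
\<close>

lemma emeasure_sector: "emeasure \<nu> (sector x) = sector_emeas x"
proof -
  define N where "N = distr digits (sigma \<Omega> (range sector)) walk"
  have vim: "walk -` sector x \<inter> space digits = {ds. walk ds (level x) = x}" for x
    by (auto simp: sector_iff walk_ray space_digits)
  have meas: "walk \<in> measurable digits (sigma \<Omega> (range sector))"
    by (rule measurable_measure_of[OF sector_subset]) (auto simp: walk_ray vim walk_prob(1))
  have setsN: "sets N = sets \<nu>" unfolding N_def sets_\<nu> using sector_subset by simp
  have N: "emeasure N (sector x) = sector_emeas x" for x
    unfolding N_def by (subst emeasure_distr[OF meas]) (use sector_subset in \<open>auto simp: vim walk_prob(2)\<close>)
  show ?thesis
  proof (rule emeasure_extend_measure[where \<mu>' = "emeasure N" and I = UNIV and \<mu> = sector_emeas and \<Omega> = \<Omega>])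
    show "\<nu> = extend_measure \<Omega> UNIV sector sector_emeas" by (simp add: boundary_measure_def sector_emeas_def[abs_def])
    show "positive (sets \<nu>) (emeasure N)" using emeasure_positive[of N] unfolding setsN .
    show "countably_additive (sets \<nu>) (emeasure N)" using emeasure_countably_additive[of N] unfolding setsN .
  qed (use N sector_subset in auto)
qed

sublocale \<nu>: prob_space \<nu>
  using emeasure_sector[of x0] by (intro prob_spaceI) (simp add: space_\<nu> sector_root sector_emeas_def)

definition sector_prob :: "nat \<Rightarrow> real" where
  "sector_prob n = (if n = 0 then 1 else 1 / (real (q + 1) * real q ^ (n - 1)))"

lemma measure_sector: "measure \<nu> (sector x) = sector_prob (level x)"
  using emeasure_sector[of x] by (auto simp: measure_def sector_emeas_def sector_prob_def)

end

section \<open>The Poisson recursion and the heat kernel\<close>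

context hom_tree
begin

abbreviation qpow :: "complex \<Rightarrow> complex" where "qpow t \<equiv> of_nat q powr t"

lemma q_pos: "real q > 0" "complex_of_nat q \<noteq> 0" "q \<noteq> 0" using q_ge_2 by auto

lemma qpow_exp: "qpow t = exp (t * of_real (ln q))"
proof -
  have "Ln (of_nat q) = of_real (ln (real q))" using Ln_of_real[OF q_pos(1)] by simp
  then show ?thesis using q_pos by (simp add: powr_def)
qed

lemma qpow_add: "qpow (a + b) = qpow a * qpow b" by (simp add: qpow_exp exp_add distrib_right)
lemma qpow_diff: "qpow (a - b) = qpow a / qpow b" by (simp add: qpow_exp exp_diff left_diff_distrib)
lemma qpow_neg: "qpow (- a) = inverse (qpow a)" by (simp add: qpow_exp exp_minus)
lemma qpow_nz [simp]: "qpow a \<noteq> 0" by (simp add: qpow_exp)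
lemma qpow_1: "qpow 1 = of_nat q" using q_pos by (simp add: qpow_exp exp_of_real)
lemma norm_qpow: "norm (qpow a) = real q powr Re a" using q_pos by (simp add: qpow_exp powr_def)

lemma q_qpow: "of_nat q * qpow (- s) = qpow (1 - s)"
  by (simp add: qpow_diff qpow_neg qpow_1 divide_inverse)

lemma qpow_inv: "qpow s * qpow (- s) = 1"
  unfolding qpow_neg by (rule right_inverse[OF qpow_nz])

text \<open>
  Both sides satisfy the same three-term recurrence.
\<close>

lemma ball_sum_eigenfunction:
  assumes "\<And>x. nbr_sum f x = eigval q w * f x" "w \<noteq> 0"
  shows "(w - inverse w) * ball_sum m f x = cheb q w m * f x"
proof (induction m arbitrary: x rule: induct_nat_012)
  case 0
  show ?case by (simp add: ball_sum_0 cheb_def)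
next
  case 1
  show ?case unfolding ball_sum_1 assms(1) cheb_rec(1)[OF assms(2), symmetric] by (simp add: cheb_def)
next
  case (ge2 m)
  have "(w - inverse w) * nbr_sum (ball_sum (Suc m) f) x = nbr_sum (\<lambda>x. cheb q w (Suc m) * f x) x"
    unfolding nbr_sum_scale[symmetric] ge2(2) ..
  also have "\<dots> = eigval q w * cheb q w (Suc m) * f x" unfolding nbr_sum_scale assms(1) by simp
  finally have "(w - inverse w) * (ball_sum (Suc (Suc m)) f x + of_nat q * ball_sum m f x) = eigval q w * cheb q w (Suc m) * f x"
    unfolding nbr_sum_ball_sum_Suc .
  then have "(w - inverse w) * ball_sum (Suc (Suc m)) f x + of_nat q * (cheb q w m * f x)
     = (cheb q w (Suc (Suc m)) + of_nat q * cheb q w m) * f x"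
    unfolding cheb_rec(2)[OF assms(2)] ge2(1)[symmetric] by (simp add: algebra_simps)
  then show ?case by (simp add: algebra_simps)
qed

text \<open>
  Convolution with a radial kernel that is a series of indicator functions of parity balls.
\<close>

lemma radial_series_conv:
  assumes c: "summable (\<lambda>m. norm (c m) * real q ^ m)" and f: "\<And>y. norm (f y) \<le> C"
  shows "(\<Sum>\<^sub>\<infinity>y. f y * (\<Sum>m. c m * (if y \<in> parity_ball x m then 1 else 0))) = ball_series c f x"
proof -
  have C: "C \<ge> 0" using f norm_ge_zero order_trans by blast
  define F where "F m y = c m * (if y \<in> parity_ball x m then f y else 0)" for m y
  have sc1: "summable (\<lambda>m. norm (c m))"
  proof (rule summable_comparison_test'[OF c])
    fix m
    have "norm (c m) * 1 \<le> norm (c m) * real q ^ m" using q_ge_1 by (intro mult_left_mono) auto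
    then show "norm (norm (c m)) \<le> norm (c m) * real q ^ m" by simp
  qed
  have row: "(F m has_sum c m * ball_sum m f x) UNIV" for m
  proof -
    have "(F m has_sum (\<Sum>y\<in>parity_ball x m. F m y)) UNIV"
      by (rule has_sum_finite_neutralI[where B = "parity_ball x m"]) (auto simp: F_def)
    then show ?thesis by (simp add: F_def ball_sum_def sum_distrib_left)
  qed
  have rown: "((\<lambda>y. norm (F m y)) has_sum norm (c m) * (\<Sum>y\<in>parity_ball x m. norm (f y))) UNIV" for m
  proof -
    have "((\<lambda>y. norm (F m y)) has_sum (\<Sum>y\<in>parity_ball x m. norm (F m y))) UNIV"
      by (rule has_sum_finite_neutralI[where B = "parity_ball x m"]) (auto simp: F_def)
    then show ?thesis by (simp add: F_def sum_distrib_left norm_mult)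
  qed
  have b: "norm (c m) * (\<Sum>y\<in>parity_ball x m. norm (f y)) \<le> (2 * C) * (norm (c m) * real q ^ m)" for m
  proof -
    have "(\<Sum>y\<in>parity_ball x m. norm (f y)) \<le> real (card (parity_ball x m)) * C" by (rule sum_bounded_above) (rule f)
    also have "\<dots> \<le> (2 * real q ^ m) * C" by (intro mult_right_mono card_parity_ball_le C)
    finally have "norm (c m) * (\<Sum>y\<in>parity_ball x m. norm (f y)) \<le> norm (c m) * ((2 * real q ^ m) * C)"
      by (intro mult_left_mono) auto
    then show ?thesis by (simp add: mult_ac)
  qed
  have "summable (\<lambda>m. norm (c m) * (\<Sum>y\<in>parity_ball x m. norm (f y)))"
    by (rule summable_comparison_test'[OF summable_mult[OF c, of "2 * C"]]) (use b in \<open>simp add: abs_mult sum_nonneg\<close>)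
  then have "(\<lambda>m. norm (c m) * (\<Sum>y\<in>parity_ball x m. norm (f y))) summable_on UNIV"
    by (intro norm_summable_imp_summable_on) (simp add: abs_mult sum_nonneg)
  then have "(\<lambda>(m, y). norm (F m y)) summable_on UNIV \<times> UNIV"
    by (intro summable_on_SigmaI[where g = "\<lambda>m. norm (c m) * (\<Sum>y\<in>parity_ball x m. norm (f y))"]) (use rown in auto)
  then have "(\<lambda>z. norm (case z of (m, y) \<Rightarrow> F m y)) summable_on UNIV \<times> UNIV"
    by (simp add: case_prod_unfold)
  then have sm: "(\<lambda>(m, y). F m y) summable_on UNIV \<times> UNIV" by (rule Infinite_Sum.abs_summable_summable)
  have sb: "summable (\<lambda>m. norm (c m * ball_sum m f x))"
  proof (rule summable_comparison_test'[OF summable_mult[OF c, of "2 * C"]])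
    fix m
    have "norm (c m * ball_sum m f x) \<le> norm (c m) * (2 * C * real q ^ m)"
      unfolding norm_mult by (intro mult_left_mono ball_sum_bound f) auto
    then show "norm (norm (c m * ball_sum m f x)) \<le> 2 * C * (norm (c m) * real q ^ m)" by (simp add: mult_ac)
  qed
  have col: "(\<Sum>\<^sub>\<infinity>m. F m y) = f y * (\<Sum>m. c m * (if y \<in> parity_ball x m then 1 else 0))" for y
  proof -
    have s: "summable (\<lambda>m. norm (F m y))"
      by (rule summable_comparison_test'[OF summable_mult2[OF sc1, of "norm (f y)"]]) (auto simp: F_def norm_mult)
    have s1: "summable (\<lambda>m. c m * (if y \<in> parity_ball x m then 1 else 0))"
      by (rule summable_norm_cancel, rule summable_comparison_test'[OF sc1]) auto
    have "(\<Sum>\<^sub>\<infinity>m. F m y) = (\<Sum>m. F m y)" by (rule infsum_eq_suminf[OF s])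
    also have "\<dots> = (\<Sum>m. f y * (c m * (if y \<in> parity_ball x m then 1 else 0)))"
      by (intro suminf_cong) (simp add: F_def)
    also have "\<dots> = f y * (\<Sum>m. c m * (if y \<in> parity_ball x m then 1 else 0))" by (rule suminf_mult[OF s1])
    finally show ?thesis .
  qed
  have "ball_series c f x = (\<Sum>\<^sub>\<infinity>m. c m * ball_sum m f x)"
    unfolding ball_series_def by (rule infsum_eq_suminf[OF sb, symmetric])
  also have "\<dots> = (\<Sum>\<^sub>\<infinity>m. \<Sum>\<^sub>\<infinity>y. F m y)" by (simp add: infsumI[OF row])
  also have "\<dots> = (\<Sum>\<^sub>\<infinity>y. \<Sum>\<^sub>\<infinity>m. F m y)" by (rule infsum_swap_banach[OF sm])
  finally show ?thesis unfolding col by simp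
qed

text \<open>
  The kernel of \<open>exp \<xi>\<close> times the exponential of the neighbour sum at distance \<open>n\<close>.
\<close>

definition heat_val :: "complex \<Rightarrow> nat \<Rightarrow> complex" where
  "heat_val \<xi> n = exp \<xi> * (\<Sum>m. exp_coeff q (- \<xi> / of_nat (q + 1)) m * (if n \<le> m \<and> even (m + n) then 1 else 0))"

lemma rapid_heat_val: "rapid (heat_val \<xi>)"
  unfolding rapid_def
proof (intro allI impI)
  fix R :: real assume R: "1 \<le> R"
  define c where "c = exp_coeff q (- \<xi> / of_nat (q + 1))"
  have s: "summable (\<lambda>m. norm (c m) * R ^ m)"
    using rapid_summable[OF rapid_exp_coeff R, of "\<lambda>m. of_real (R ^ m)" 1] R by (simp add: norm_mult norm_power c_def)
  define B where "B = (\<Sum>m. norm (c m) * R ^ m)"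
  have "norm (heat_val \<xi> n) * R ^ n \<le> norm (exp \<xi>) * B" for n
  proof -
    let ?g = "\<lambda>m. c m * (if n \<le> m \<and> even (m + n) then 1 else 0)"
    have le: "norm (?g m) * R ^ n \<le> norm (c m) * R ^ m" for m
      using R by (auto intro!: mult_left_mono power_increasing)
    have le1: "norm (?g m) \<le> norm (c m) * R ^ m" for m
      using mult_left_mono[OF one_le_power[OF R, of n] norm_ge_zero[of "?g m"]] le[of m] by linarith
    have sg: "summable (\<lambda>m. norm (?g m))" by (rule summable_comparison_test'[OF s]) (use le1 in auto)
    have "norm (suminf ?g) * R ^ n \<le> (\<Sum>m. norm (?g m)) * R ^ n"
      using R by (intro mult_right_mono summable_norm sg) auto
    also have "\<dots> = (\<Sum>m. norm (?g m) * R ^ n)" by (rule suminf_mult2[OF sg])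
    also have "\<dots> \<le> B" unfolding B_def by (intro suminf_le le s summable_mult2 sg)
    finally show ?thesis unfolding heat_val_def c_def[symmetric] norm_mult mult.assoc by (intro mult_left_mono) auto
  qed
  moreover have "B \<ge> 0" unfolding B_def using R by (intro suminf_nonneg s) auto
  ultimately show "\<exists>C\<ge>0. \<forall>m. norm (heat_val \<xi> m) * R ^ m \<le> C" by (intro exI[of _ "norm (exp \<xi>) * B"]) auto
qed

lemma heat_conv:
  assumes "\<And>y. norm (f y) \<le> C"
  shows "(\<Sum>\<^sub>\<infinity>y. f y * heat_val \<xi> (d x y)) = exp \<xi> * exp_nbr (- \<xi> / of_nat (q + 1)) f x"
proof -
  let ?c = "exp_coeff q (- \<xi> / of_nat (q + 1))"
  have s: "summable (\<lambda>m. norm (?c m) * real q ^ m)"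
    using rapid_summable[OF rapid_exp_coeff q_ge_1, of "\<lambda>m. of_real (real q ^ m)" 1] by (simp add: norm_mult norm_power)
  have "(\<Sum>\<^sub>\<infinity>y. f y * heat_val \<xi> (d x y)) = (\<Sum>\<^sub>\<infinity>y. exp \<xi> * (f y * (\<Sum>m. ?c m * (if y \<in> parity_ball x m then 1 else 0))))"
    by (simp add: heat_val_def parity_ball_def mult_ac)
  also have "\<dots> = exp \<xi> * (\<Sum>\<^sub>\<infinity>y. f y * (\<Sum>m. ?c m * (if y \<in> parity_ball x m then 1 else 0)))"
    by (rule infsum_cmult_right')
  also have "\<dots> = exp \<xi> * exp_nbr (- \<xi> / of_nat (q + 1)) f x"
    unfolding radial_series_conv[of ?c f C, OF s assms] exp_nbr_ball_series[of f C, OF assms] ..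
  finally show ?thesis .
qed

end

context rooted_tree
begin

definition pois_pow :: "complex \<Rightarrow> 'a \<Rightarrow> (nat \<Rightarrow> 'a) \<Rightarrow> complex" where
  "pois_pow s x \<omega> = of_real (poisson_kernel adj q x0 x \<omega>) powr s"

lemma pois_pow_eq: "pois_pow s x \<omega> = qpow (s * (2 * of_nat (conf_level x \<omega>) - of_nat (level x)))"
proof -
  let ?k = "2 * int (conf_level x \<omega>) - int (level x)"
  have k: "poisson_kernel adj q x0 x \<omega> = real q powi ?k" by (simp add: poisson_kernel_def conf_level_def)
  have pos: "real q powi ?k > 0" using q_pos by simp
  have "real q powi ?k = real q powr of_int ?k" using powr_real_of_int'[of "real q" ?k] q_pos by simp
  then have "ln (real q powi ?k) = of_int ?k * ln (real q)" using q_pos by (simp only: ln_powr)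
  then have "pois_pow s x \<omega> = exp (s * of_real (of_int ?k * ln (real q)))"
    unfolding pois_pow_def k using pos q_pos by (simp add: powr_def Ln_of_real del: of_real_power_int)
  then show ?thesis unfolding qpow_exp by (simp add: mult.assoc)
qed

text \<open>
  The jump of the power of the Poisson kernel on the sector of a vertex at level \<open>n\<close>.
\<close>

abbreviation pois_step :: "complex \<Rightarrow> nat \<Rightarrow> complex" where
  "pois_step s n \<equiv> qpow (s * of_nat n) - qpow (s * (of_nat n - 2))"

lemma pois_step_Suc: "pois_step s (Suc n) = qpow s * pois_step s n"
  by (simp add: right_diff_distrib qpow_add[symmetric]) (simp add: algebra_simps)

lemma pois_pow_root: "\<omega> \<in> \<Omega> \<Longrightarrow> pois_pow s x0 \<omega> = 1"
  using q_pos by (simp add: pois_pow_eq conf_level_root)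

text \<open>
  Outside the sector of \<open>x\<close> the exponent of the kernel drops by one from the parent to \<open>x\<close>; inside it
  rises by one, and the second term is the correction.
\<close>

lemma pois_pow_rec:
  assumes w: "\<omega> \<in> \<Omega>" and x: "x \<noteq> x0"
  shows "pois_pow s x \<omega> = qpow (- s) * pois_pow s (parent x) \<omega> + pois_step s (level x) * indicator (sector x) \<omega>"
proof -
  obtain n where n: "level x = Suc n" "level (parent x) = n" using level_parent[OF x] by (metis Suc_eq_plus1)
  show ?thesis
  proof (cases "\<omega> \<in> sector x")
    case True
    then have c: "conf_level x \<omega> = Suc n" "conf_level (parent x) \<omega> = n"
      using conf_level_eq_level[OF w, of x] conf_level_parent[OF w x] n by (auto simp: sector_iff)
    show ?thesis unfolding pois_pow_eq c n using True
      by (simp add: qpow_add[symmetric]) (simp add: algebra_simps)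
  next
    case False
    then have c: "conf_level (parent x) \<omega> = conf_level x \<omega>" using conf_level_parent[OF w x] by simp
    show ?thesis unfolding pois_pow_eq c n using False
      by (simp add: qpow_add[symmetric]) (simp add: algebra_simps)
  qed
qed

definition pois :: "complex \<Rightarrow> ((nat \<Rightarrow> 'a) \<Rightarrow> complex) \<Rightarrow> 'a \<Rightarrow> complex" where
  "pois s F x = (\<integral>\<omega>. pois_pow s x \<omega> * F \<omega> \<partial>\<nu>)"

definition sector_int :: "((nat \<Rightarrow> 'a) \<Rightarrow> complex) \<Rightarrow> 'a \<Rightarrow> complex" where
  "sector_int F x = (\<integral>\<omega>. indicator (sector x) \<omega> * F \<omega> \<partial>\<nu>)"

lemma poisson_transform_pois: "poisson_transform adj q x0 z F = pois (1/2 + \<i> * z) F"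
  by (simp add: fun_eq_iff poisson_transform_def pois_def pois_pow_def)

lemma sector_integrable:
  assumes "integrable \<nu> F"
  shows "integrable \<nu> (\<lambda>\<omega>. indicator (sector x) \<omega> * (F \<omega> :: complex))"
proof -
  have "(\<lambda>\<omega>. indicator (sector x) \<omega> * F \<omega>) = (\<lambda>\<omega>. indicator (sector x) \<omega> *\<^sub>R F \<omega>)"
    by (auto simp: indicator_def fun_eq_iff)
  then show ?thesis using integrable_mult_indicator[OF sector_sets assms, of x] by simp
qed

lemma pois_pow_integrable:
  assumes "integrable \<nu> F"
  shows "integrable \<nu> (\<lambda>\<omega>. pois_pow s x \<omega> * F \<omega>)"
proof (induction x rule: level_induct)
  case root
  show ?case by (rule Bochner_Integration.integrable_cong[OF refl, THEN iffD1, OF _ assms]) (simp add: pois_pow_root space_\<nu>)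
next
  case (child y)
  have "integrable \<nu> (\<lambda>\<omega>. qpow (- s) * (pois_pow s (parent y) \<omega> * F \<omega>) + pois_step s (level y) * (indicator (sector y) \<omega> * F \<omega>))"
    by (intro Bochner_Integration.integrable_add integrable_mult_right child sector_integrable assms)
  then show ?case
    by (rule Bochner_Integration.integrable_cong[OF refl, THEN iffD1, rotated])
      (simp add: pois_pow_rec[OF _ child(1)] space_\<nu> algebra_simps)
qed

lemma pois_root: "pois s F x0 = (\<integral>\<omega>. F \<omega> \<partial>\<nu>)"
  unfolding pois_def by (rule Bochner_Integration.integral_cong[OF refl]) (simp add: pois_pow_root space_\<nu>)

lemma sector_int_root: "sector_int F x0 = (\<integral>\<omega>. F \<omega> \<partial>\<nu>)"
  unfolding sector_int_def by (rule Bochner_Integration.integral_cong[OF refl]) (simp add: sector_root space_\<nu>)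

lemma pois_rec:
  assumes F: "integrable \<nu> F" and x: "x \<noteq> x0"
  shows "pois s F x = qpow (- s) * pois s F (parent x) + pois_step s (level x) * sector_int F x"
proof -
  have "pois s F x = (\<integral>\<omega>. qpow (- s) * (pois_pow s (parent x) \<omega> * F \<omega>) + pois_step s (level x) * (indicator (sector x) \<omega> * F \<omega>) \<partial>\<nu>)"
    unfolding pois_def
    by (rule Bochner_Integration.integral_cong[OF refl]) (simp add: pois_pow_rec[OF _ x] space_\<nu> algebra_simps)
  also have "\<dots> = qpow (- s) * pois s F (parent x) + pois_step s (level x) * sector_int F x"
    unfolding pois_def sector_int_def
    by (subst Bochner_Integration.integral_add)
      (auto intro!: pois_pow_integrable sector_integrable F)
  finally show ?thesis .
qed

lemma indicator_sector_children:
  assumes "\<omega> \<in> \<Omega>"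
  shows "indicator (sector x) \<omega> = (\<Sum>y\<in>children x. indicator (sector y) \<omega> :: complex)"
proof (cases "\<omega> \<in> sector x")
  case True
  let ?z = "\<omega> (Suc (level x))"
  have "\<omega> (level x) = x" using True by (simp add: sector_iff)
  moreover have "?z \<in> children (\<omega> (level x))" using assms by (simp add: rays_iff)
  ultimately have z: "?z \<in> children x" by simp
  have "(\<Sum>y\<in>children x. indicator (sector y) \<omega> :: complex) = (\<Sum>y\<in>children x. if y = ?z then 1 else 0)"
    by (intro sum.cong refl) (use assms in \<open>auto simp: indicator_def sector_iff level_child\<close>)
  then show ?thesis using True z by simp
next
  case False
  have "\<omega> \<notin> sector y" if "y \<in> children x" for y
  proof
    assume "\<omega> \<in> sector y"
    then have "\<omega> (Suc (level x)) = y" using level_child[OF that] by (simp add: sector_iff)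
    then have "\<omega> (level x) = x" using ray_parent[OF assms, of "level x"] that by (simp add: children_iff)
    then show False using False assms by (simp add: sector_iff)
  qed
  then show ?thesis using False by simp
qed

lemma sector_int_children:
  assumes F: "integrable \<nu> F"
  shows "sector_int F x = (\<Sum>y\<in>children x. sector_int F y)"
proof -
  have "sector_int F x = (\<integral>\<omega>. (\<Sum>y\<in>children x. indicator (sector y) \<omega> * F \<omega>) \<partial>\<nu>)"
    unfolding sector_int_def
    by (rule Bochner_Integration.integral_cong[OF refl]) (simp only: indicator_sector_children[of _ x] space_\<nu> sum_distrib_right)
  also have "\<dots> = (\<Sum>y\<in>children x. sector_int F y)"
    unfolding sector_int_def by (rule Bochner_Integration.integral_sum) (rule sector_integrable[OF F])
  finally show ?thesis .
qed

text \<open>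
  The Poisson transform is an eigenfunction: the recursion expresses the values at the children
  through the value at \<open>x\<close> and the integrals over the sectors of the children, which add up to the
  integral over the sector of \<open>x\<close>.
\<close>

lemma nbr_sum_pois:
  assumes F: "integrable \<nu> F"
  shows "nbr_sum (pois s F) x = (qpow s + qpow (1 - s)) * pois s F x"
proof -
  let ?u = "pois s F"
  have "(\<Sum>y\<in>children x. ?u y) = (\<Sum>y\<in>children x. qpow (- s) * ?u x + pois_step s (Suc (level x)) * sector_int F y)"
    by (intro sum.cong refl) (use pois_rec[OF F] in \<open>auto simp: children_iff level_child[symmetric]\<close>)
  also have "\<dots> = of_nat (card (children x)) * (qpow (- s) * ?u x) + pois_step s (Suc (level x)) * sector_int F x"
    unfolding sum.distrib sector_int_children[OF F, of x] sum_distrib_left by simp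
  finally have ch: "(\<Sum>y\<in>children x. ?u y) = of_nat (card (children x)) * (qpow (- s) * ?u x) + qpow s * (pois_step s (level x) * sector_int F x)"
    unfolding pois_step_Suc by (simp add: mult.assoc)
  show ?thesis
  proof (cases "x = x0")
    case True
    have "pois_step s 0 = 1 - qpow (- s) * qpow (- s)"
      using q_pos by (simp add: qpow_add[symmetric] mult.commute)
    then have "qpow s * (pois_step s (level x) * sector_int F x) = qpow s * ((1 - qpow (- s) * qpow (- s)) * ?u x)"
      unfolding True by (simp only: gdist_refl pois_root sector_int_root)
    also have "\<dots> = qpow s * ?u x - (qpow s * qpow (- s)) * (qpow (- s) * ?u x)"
      by (simp only: left_diff_distrib right_diff_distrib mult_1_left mult.assoc)
    also note qpow_inv
    finally have e: "qpow s * (pois_step s (level x) * sector_int F x) = (qpow s - qpow (- s)) * ?u x"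
      by (simp only: left_diff_distrib mult_1_left mult.assoc)
    show ?thesis unfolding nbr_sum_split ch e using True
      by (simp add: card_children q_qpow[symmetric] algebra_simps)
  next
    case False
    have "pois_step s (level x) * sector_int F x = ?u x - qpow (- s) * ?u (parent x)"
      using pois_rec[OF F False, of s] by simp
    then have "qpow s * (pois_step s (level x) * sector_int F x) = qpow s * ?u x - (qpow s * qpow (- s)) * ?u (parent x)"
      by (simp only: right_diff_distrib mult.assoc)
    also note qpow_inv
    finally have e: "qpow s * (pois_step s (level x) * sector_int F x) = qpow s * ?u x - ?u (parent x)"
      by (simp only: mult_1_left)
    show ?thesis unfolding nbr_sum_split ch e using False
      by (simp add: card_children q_qpow[symmetric] algebra_simps)
  qed
qed

lemma sector_int_one: "sector_int (\<lambda>\<omega>. 1) x = of_real (sector_prob (level x))"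
  unfolding sector_int_def
proof -
  have "(\<integral>\<omega>. indicator (sector x) \<omega> * (1::complex) \<partial>\<nu>) = (\<integral>\<omega>. of_real (indicator (sector x) \<omega>) \<partial>\<nu>)"
    by (intro Bochner_Integration.integral_cong refl) (simp add: indicator_def)
  also have "\<dots> = of_real (measure \<nu> (sector x))"
    by (subst integral_complex_of_real) (simp add: Int_absorb2 sets.sets_into_space)
  finally show "(\<integral>\<omega>. indicator (sector x) \<omega> * (1::complex) \<partial>\<nu>) = of_real (sector_prob (level x))"
    unfolding measure_sector .
qed

lemma pois_one_exponent_one: "pois 1 (\<lambda>\<omega>. 1) x = 1"
proof (induction x rule: level_induct)
  case root
  show ?case by (simp add: pois_root \<nu>.prob_space)
next
  case (child x)
  obtain n where n: "level x = Suc n" using level_parent[OF child(1)] by (metis Suc_eq_plus1)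
  have e1: "qpow (of_nat (Suc n)) = of_nat q ^ Suc n" and e2: "qpow (of_nat (Suc n) - 2) = of_nat q ^ n / of_nat q"
    using q_pos by (simp_all add: powr_diff powr_nat' powr_add field_simps power2_eq_square)
  have "pois 1 (\<lambda>\<omega>. 1) x = inverse (of_nat q) + (of_nat q ^ Suc n - of_nat q ^ n / of_nat q) / (of_nat (q + 1) * of_nat q ^ n)"
    unfolding pois_rec[OF \<nu>.integrable_const child(1)] child(2) sector_int_one n mult_1 e1 e2 qpow_neg qpow_1
    by (simp add: sector_prob_def)
  also have "\<dots> = inverse (of_nat q) + (of_nat q - inverse (of_nat q)) / of_nat (q + 1)"
  proof -
    have "of_nat q ^ Suc n - of_nat q ^ n / of_nat q = (of_nat q - inverse (of_nat q)) * (of_nat q ^ n :: complex)"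
      by (simp add: left_diff_distrib divide_inverse)
    then show ?thesis using q_pos(2) by simp
  qed
  also have "\<dots> = 1"
  proof -
    have "complex_of_nat (q + 1) \<noteq> 0" by (metis of_nat_eq_0_iff Suc_eq_plus1 nat.distinct(1))
    moreover have "complex_of_nat q - inverse (of_nat q) = of_nat (q + 1) * ((of_nat q - 1) / of_nat q)"
      using q_pos(2) by (simp add: field_simps)
    moreover have "inverse (complex_of_nat q) + (of_nat q - 1) / of_nat q = 1"
      using q_pos(2) by (simp add: field_simps)
    ultimately show ?thesis by simp
  qed
  finally show ?case .
qed

text \<open>
  Spherical functions are bounded on the whole strip, because \<open>t powr \<sigma> \<le> 1 + t\<close> for \<open>0 \<le> \<sigma> \<le> 1\<close> and
  the Poisson kernel has total mass one.
\<close>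

lemma pois_one_bound:
  assumes "0 \<le> Re s" "Re s \<le> 1"
  shows "norm (pois s (\<lambda>\<omega>. 1) x) \<le> 2"
proof -
  note int = pois_pow_integrable[OF \<nu>.integrable_const, of _ x "1::complex"]
  have int1: "integrable \<nu> (pois_pow 1 x)" using int[of 1] by simp
  have le: "norm (pois_pow s x \<omega> * 1) \<le> 1 + Re (pois_pow 1 x \<omega>)" for \<omega>
  proof -
    let ?e = "2 * real (conf_level x \<omega>) - real (level x)"
    have "norm (pois_pow s x \<omega>) = real q powr (Re s * ?e)" unfolding pois_pow_eq norm_qpow by simp
    moreover have "pois_pow 1 x \<omega> = of_real (real q powr ?e)"
      using q_pos by (simp add: pois_pow_eq powr_of_real[symmetric])
    moreover have "real q powr (Re s * ?e) \<le> 1 + real q powr ?e"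
    proof (cases "?e \<ge> 0")
      case True
      then have "real q powr (Re s * ?e) \<le> real q powr ?e"
        using assms q_ge_1 by (intro powr_mono) (auto simp: mult_left_le_one_le)
      then show ?thesis by simp
    next
      case False
      then have "Re s * ?e \<le> 0" using assms by (simp add: mult_nonneg_nonpos)
      then have "real q powr (Re s * ?e) \<le> real q powr 0" using q_ge_1 by (intro powr_mono) auto
      moreover have "real q powr ?e \<ge> 0" "real q powr 0 = 1" using q_pos by simp_all
      ultimately show ?thesis by linarith
    qed
    ultimately show ?thesis by simp
  qed
  have "norm (pois s (\<lambda>\<omega>. 1) x) \<le> (\<integral>\<omega>. norm (pois_pow s x \<omega> * 1) \<partial>\<nu>)" unfolding pois_def by (rule integral_norm_bound)
  also have "\<dots> \<le> (\<integral>\<omega>. 1 + Re (pois_pow 1 x \<omega> * 1) \<partial>\<nu>)"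
    using le by (intro integral_mono Bochner_Integration.integrable_add \<nu>.integrable_const integrable_norm integrable_Re int) simp
  also have "\<dots> = 1 + Re (pois 1 (\<lambda>\<omega>. 1) x)"
    unfolding pois_def by (subst Bochner_Integration.integral_add[OF \<nu>.integrable_const integrable_Re[OF int]]) (simp_all add: \<nu>.prob_space integral_Re[OF int1])
  finally show ?thesis by (simp add: pois_one_exponent_one)
qed

lemma exists_level: "\<exists>x. level x = n"
proof (induction n)
  case 0
  show ?case by (rule exI[of _ x0]) simp
next
  case (Suc n)
  then obtain x where "level x = n" by blast
  then show ?case using level_child[OF nth_child_in[of x 0]] by auto
qed

lemma radial_value_eq:
  assumes "radial adj x0 k"
  shows "radial_value adj x0 k (level y) = k y"
proof -
  have "level (SOME x. level x = level y) = level y" by (rule someI[of _ y]) simp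
  then show ?thesis using assms unfolding radial_value_def radial_def by blast
qed

definition heat_fun :: "complex \<Rightarrow> 'a \<Rightarrow> complex" where "heat_fun \<xi> x = heat_val \<xi> (level x)"

lemma radial_heat_fun: "radial adj x0 (heat_fun \<xi>)" by (simp add: radial_def heat_fun_def)

lemma radial_value_heat_fun: "radial_value adj x0 (heat_fun \<xi>) n = heat_val \<xi> n"
  using exists_level[of n] radial_value_eq[OF radial_heat_fun[of \<xi>]] by (auto simp: heat_fun_def)

lemma schwartz_heat_fun:
  assumes "1 \<le> p"
  shows "heat_fun \<xi> \<in> schwartz_space adj q x0 p"
  unfolding schwartz_space_def
proof (intro CollectI allI)
  fix m :: nat
  let ?R = "2 ^ m * real q"
  have R: "1 \<le> ?R" using q_ge_1 mult_mono[of 1 "2 ^ m :: real" 1 "real q"] by simp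
  obtain C where C: "\<And>n. norm (heat_val \<xi> n) * ?R ^ n \<le> C" using rapid_heat_val[of \<xi>] R unfolding rapid_def by blast
  show "bdd_above (range (\<lambda>x. (1 + real (level x)) ^ m * real q powr (real (level x) / p) * cmod (heat_fun \<xi> x)))"
  proof (intro bdd_aboveI2)
    fix x
    let ?n = "level x"
    have "1 + real ?n \<le> 2 ^ ?n" using of_nat_mono[OF Suc_leI[OF less_exp[of ?n]], where 'a=real] by simp
    then have 1: "(1 + real ?n) ^ m \<le> (2 ^ m) ^ ?n"
      using power_mono[of "1 + real ?n" "2 ^ ?n" m] by (simp add: power_mult[symmetric] mult.commute)
    have "real q powr (real ?n / p) \<le> real q powr real ?n"
      using assms q_ge_1 by (intro powr_mono) (auto simp: divide_le_eq mult_le_cancel_left1)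
    then have 2: "real q powr (real ?n / p) \<le> real q ^ ?n" using q_pos by (simp add: powr_realpow)
    have "(1 + real ?n) ^ m * real q powr (real ?n / p) * cmod (heat_fun \<xi> x) \<le> (2 ^ m) ^ ?n * real q ^ ?n * norm (heat_val \<xi> ?n)"
      unfolding heat_fun_def by (intro mult_right_mono mult_mono 1 2) auto
    also have "\<dots> = norm (heat_val \<xi> ?n) * ?R ^ ?n" by (simp add: power_mult_distrib mult_ac)
    also have "\<dots> \<le> C" by (rule C)
    finally show "(1 + real ?n) ^ m * real q powr (real ?n / p) * cmod (heat_fun \<xi> x) \<le> C" .
  qed
qed

lemma delta_p: assumes "1 \<le> p" shows "\<delta> (ennreal p) = 1 / p - 1 / 2"
proof -
  have "1 / ennreal p = ennreal (1 / p)" using assms by (metis divide_ennreal ennreal_1 zero_le_one less_le_trans zero_less_one)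
  then show ?thesis using assms by (simp add: \<delta>_def)
qed

lemma strip_Re:
  assumes "1 \<le> p" "p < 2" "z \<in> strip p"
  shows "0 \<le> Re (1 / 2 + \<i> * z)" "Re (1 / 2 + \<i> * z) \<le> 1"
proof -
  have "1 / p \<le> 1" "1 / p > 1 / 2" using assms by (auto simp: field_simps)
  then have "\<bar>Im z\<bar> \<le> 1 / 2" using assms(3) unfolding strip_def delta_p[OF assms(1)] by auto
  then show "0 \<le> Re (1 / 2 + \<i> * z)" "Re (1 / 2 + \<i> * z) \<le> 1" by (auto simp: abs_le_iff)
qed

lemma spherical_eq: "spherical_function adj q x0 z = pois (1 / 2 + \<i> * z) (\<lambda>\<omega>. 1)"
  by (simp add: spherical_function_def poisson_transform_pois)

lemma eig_eq: "qpow (1 / 2 + \<i> * z) + qpow (1 - (1 / 2 + \<i> * z)) = eigval q (qpow (\<i> * z))"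
proof -
  have "complex_of_real (sqrt q) = qpow (1 / 2)"
    using q_pos by (simp add: qpow_exp flip: powr_half_sqrt) (simp add: powr_def flip: exp_of_real)
  moreover have "1 - (1 / 2 + \<i> * z) = 1 / 2 + - (\<i> * z)" by simp
  ultimately show ?thesis unfolding eigval_def by (simp only: qpow_add qpow_neg distrib_left)
qed

lemma gamma_eq: "\<gamma> q z = 1 - eigval q (qpow (\<i> * z)) / of_nat (q + 1)"
proof -
  have "1 - (1 / 2 + \<i> * z) = 1 / 2 - \<i> * z" by simp
  then show ?thesis unfolding \<gamma>_def eig_eq[symmetric] by (simp only:)
qed

text \<open>
  The spherical function is an eigenfunction with value one at the root, so the exponential of the
  neighbour sum acts on it as a scalar.
\<close>

lemma transform_heat_fun:
  assumes "1 \<le> p" "p < 2" "z \<in> strip p"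
  shows "spherical_transform adj q x0 (heat_fun \<xi>) z = exp (\<xi> * \<gamma> q z)"
proof -
  let ?f = "spherical_function adj q x0 z" and ?l = "eigval q (qpow (\<i> * z))"
  have b: "norm (?f y) \<le> 2" for y unfolding spherical_eq by (rule pois_one_bound[OF strip_Re[OF assms]])
  have "defect ?l ?f = (\<lambda>x. 0)"
    unfolding defect_def spherical_eq nbr_sum_pois[OF \<nu>.integrable_const] eig_eq by (simp add: fun_eq_iff)
  then have e: "exp_nbr \<kappa> ?f x0 = exp (\<kappa> * ?l)" for \<kappa>
    using exp_nbr_nilpotent[of ?f 2 ?l \<kappa> x0, OF b]
    by (simp add: defect_def nbr_sum_def spherical_eq pois_root \<nu>.prob_space)
  have "spherical_transform adj q x0 (heat_fun \<xi>) z = (\<Sum>\<^sub>\<infinity>y. ?f y * heat_val \<xi> (d x0 y))"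
    unfolding spherical_transform_def heat_fun_def by (simp add: mult.commute)
  also have "\<dots> = exp \<xi> * exp (- \<xi> / of_nat (q + 1) * ?l)" unfolding heat_conv[of ?f 2, OF b] e ..
  also have "\<dots> = exp (\<xi> * \<gamma> q z)" unfolding gamma_eq exp_add[symmetric] by (simp add: algebra_simps)
  finally show ?thesis .
qed

text \<open>
  A decaying radial function is the sum of its differences of step two, that is, a series of
  indicator functions of parity balls.
\<close>

lemma schwartz_expansion:
  assumes h: "radial adj x0 h" "h \<in> schwartz_space adj q x0 1"
  shows "\<exists>e. summable (\<lambda>m. norm (e m) * real q ^ m) \<and>
    (\<forall>x. h x = (\<Sum>m. e m * (if x \<in> parity_ball x0 m then 1 else 0)))"
proof -
  define K where "K n = radial_value adj x0 h n" for n
  have KL: "K (level x) = h x" for x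
    unfolding K_def by (simp add: radial_value_eq h)
  have "bdd_above (range (\<lambda>x. (1 + real (level x)) ^ 2 * real q powr (real (level x) / 1) * cmod (h x)))"
    using h(2) unfolding schwartz_space_def mem_Collect_eq by (rule spec)
  then obtain C where C: "\<And>x. (1 + real (level x)) ^ 2 * real q ^ level x * cmod (h x) \<le> C"
    unfolding bdd_above_def using q_pos by (auto simp: powr_realpow)
  have Kq: "norm (K n) * real q ^ n \<le> C * (1 / (1 + real n) ^ 2)" for n
  proof -
    obtain x where x: "level x = n" using exists_level by blast
    show ?thesis using C[of x] KL[of x] unfolding x by (simp add: field_simps)
  qed
  have inv2: "summable (\<lambda>n. 1 / (1 + real n) ^ 2)"
  proof -
    have "summable (\<lambda>n. inverse (real (Suc n) ^ 2))"
      using inverse_power_summable[of 2, where 'a=real] by (subst summable_Suc_iff) simp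
    then show ?thesis by (simp add: inverse_eq_divide)
  qed
  have sK: "summable (\<lambda>n. norm (K n) * real q ^ n)"
    by (rule summable_comparison_test'[OF summable_mult[OF inv2, of C]]) (use Kq in simp)
  \<comment> \<open>The indicator functions of parity balls that contain a point at level \<open>n\<close> are those with \<open>m = n, n + 2, \<dots>\<close>, so the sum of the differences telescopes to \<open>K n\<close>.\<close>
  define e where "e m = K m - K (m + 2)" for m
  have se: "summable (\<lambda>m. norm (e m) * real q ^ m)"
  proof (rule summable_comparison_test'[OF summable_add[OF sK summable_ignore_initial_segment[OF sK, of 2]]])
    fix m
    have "norm (K (m + 2)) * real q ^ m \<le> norm (K (m + 2)) * real q ^ (m + 2)"
      using q_ge_1 by (intro mult_left_mono power_increasing) auto
    moreover have "norm (e m) * real q ^ m \<le> (norm (K m) + norm (K (m + 2))) * real q ^ m"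
      unfolding e_def by (intro mult_right_mono norm_triangle_ineq4) auto
    ultimately have "norm (e m) * real q ^ m \<le> norm (K m) * real q ^ m + norm (K (m + 2)) * real q ^ (m + 2)"
      unfolding distrib_right by linarith
    then show "norm (norm (e m) * real q ^ m) \<le> norm (K m) * real q ^ m + norm (K (m + 2)) * real q ^ (m + 2)"
      by simp
  qed
  have K0: "K \<longlonglongrightarrow> 0"
  proof (rule tendsto_norm_zero_cancel, rule summable_LIMSEQ_zero, rule summable_comparison_test'[OF sK])
    fix n
    have "norm (K n) * 1 \<le> norm (K n) * real q ^ n" using q_ge_1 by (intro mult_left_mono) auto
    then show "norm (norm (K n)) \<le> norm (K n) * real q ^ n" by simp
  qed
  have Ksum: "(\<Sum>m. e m * (if n \<le> m \<and> even (m + n) then 1 else 0)) = K n" for n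
  proof -
    have sm: "strict_mono (\<lambda>j::nat. n + 2 * j)" by (auto simp: strict_mono_def)
    have "(\<lambda>j. K (n + 2 * j)) \<longlonglongrightarrow> 0"
      using LIMSEQ_subseq_LIMSEQ[OF K0 sm] by (simp add: o_def)
    then have "(\<lambda>j. K (n + 2 * j) - K (n + 2 * Suc j)) sums (K (n + 2 * 0) - 0)" by (rule telescope_sums')
    then have 1: "(\<lambda>j. e (n + 2 * j) * (if n \<le> n + 2 * j \<and> even (n + 2 * j + n) then 1 else 0)) sums K n"
      by (simp add: e_def)
    have 2: "e m * (if n \<le> m \<and> even (m + n) then 1 else 0) = 0" if m: "m \<notin> range (\<lambda>j. n + 2 * j)" for m
    proof -
      have "\<not> (n \<le> m \<and> even (m + n))"
      proof
        assume a: "n \<le> m \<and> even (m + n)"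
        then have "even (m - n)" by simp
        then obtain j where "m - n = 2 * j" by blast
        then have "m = n + 2 * j" using conjunct1[OF a] by arith
        then show False using m by blast
      qed
      then show ?thesis by (simp only: if_False mult_zero_right)
    qed
    have "(\<lambda>m. e m * (if n \<le> m \<and> even (m + n) then 1 else 0)) sums K n"
      using sums_mono_reindex[OF sm, of "\<lambda>m. e m * (if n \<le> m \<and> even (m + n) then 1 else 0)" "K n"] 1 2 by blast
    then show ?thesis by (rule sums_unique[symmetric])
  qed
  have "h x = (\<Sum>m. e m * (if x \<in> parity_ball x0 m then 1 else 0))" for x
    unfolding KL[symmetric] Ksum[symmetric] by (simp add: parity_ball_def)
  with se show ?thesis by blast
qed

text \<open>
  The spherical function is an eigenfunction with value one at the root, so that the sums over
  parity balls act on it as Chebyshev polynomials.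
\<close>

lemma transform_cheb:
  assumes se: "summable (\<lambda>m. norm (e m) * real q ^ m)"
    and h: "\<And>x. h x = (\<Sum>m. e m * (if x \<in> parity_ball x0 m then 1 else 0))"
    and z: "z \<in> strip 1" and w: "w = qpow (\<i> * z)"
  shows "(\<Sum>m. e m * cheb q w m) = (w - inverse w) * spherical_transform adj q x0 h z"
proof -
  let ?f = "spherical_function adj q x0 z"
  have w0: "w \<noteq> 0" unfolding w by (rule qpow_nz)
  have b: "norm (?f y) \<le> 2" for y unfolding spherical_eq by (rule pois_one_bound[OF strip_Re[OF _ _ z]]) auto
  have t: "spherical_transform adj q x0 h z = ball_series e ?f x0"
    unfolding radial_series_conv[of e ?f 2 x0, OF se b, symmetric] spherical_transform_def h[symmetric]
    by (simp add: mult.commute)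
  have eig: "nbr_sum ?f x = eigval q w * ?f x" for x
    unfolding spherical_eq nbr_sum_pois[OF \<nu>.integrable_const] eig_eq w ..
  have sb: "summable (\<lambda>m. e m * ball_sum m ?f x0)"
  proof (rule summable_norm_cancel, rule summable_comparison_test'[OF summable_mult[OF se, of 4]])
    fix m
    have "norm (e m * ball_sum m ?f x0) \<le> norm (e m) * (2 * 2 * real q ^ m)"
      unfolding norm_mult by (intro mult_left_mono ball_sum_bound b) auto
    then show "norm (norm (e m * ball_sum m ?f x0)) \<le> 4 * (norm (e m) * real q ^ m)" by (simp add: mult_ac)
  qed
  have "(\<Sum>m. e m * cheb q w m) = (\<Sum>m. (w - inverse w) * (e m * ball_sum m ?f x0))"
    using ball_sum_eigenfunction[OF eig w0, of _ x0]
    by (intro suminf_cong) (simp add: spherical_eq pois_root \<nu>.prob_space mult.left_commute)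
  also have "\<dots> = (w - inverse w) * ball_series e ?f x0" unfolding ball_series_def by (rule suminf_mult[OF sb])
  finally show ?thesis unfolding t .
qed

text \<open>
  For real \<open>z\<close> the points \<open>w\<close> fill the unit circle, where Cauchy's estimate determines the
  coefficients.
\<close>

lemma transform_unique:
  assumes h: "radial adj x0 h" "h \<in> schwartz_space adj q x0 1"
    and g: "radial adj x0 g" "g \<in> schwartz_space adj q x0 1"
    and eq: "\<And>z. z \<in> strip 1 \<Longrightarrow> spherical_transform adj q x0 h z = spherical_transform adj q x0 g z"
  shows "h = g"
proof -
  obtain e where e: "summable (\<lambda>m. norm (e m) * real q ^ m)"
    "\<And>x. h x = (\<Sum>m. e m * (if x \<in> parity_ball x0 m then 1 else 0))" using schwartz_expansion[OF h] by blast
  obtain c where c: "summable (\<lambda>m. norm (c m) * real q ^ m)"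
    "\<And>x. g x = (\<Sum>m. c m * (if x \<in> parity_ball x0 m then 1 else 0))" using schwartz_expansion[OF g] by blast
  have sq: "summable (\<lambda>m. norm (e m) * (sqrt q * 1) ^ m)" if "summable (\<lambda>m. norm (e m) * real q ^ m)" for e :: "nat \<Rightarrow> complex"
  proof (rule summable_comparison_test'[OF that])
    fix m
    have "sqrt q \<le> real q" using q_ge_1 real_sqrt_le_mono[of "real q" "real q * real q"] by simp
    then have "norm (e m) * (sqrt q * 1) ^ m \<le> norm (e m) * real q ^ m"
      by (intro mult_left_mono power_mono) auto
    then show "norm (norm (e m) * (sqrt q * 1) ^ m) \<le> norm (e m) * real q ^ m" by simp
  qed
  have s: "summable (\<lambda>m. norm (e m - c m) * (sqrt q * 1) ^ m)"
  proof (rule summable_comparison_test'[OF summable_add[OF sq[OF e(1)] sq[OF c(1)]]])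
    fix m
    have "norm (e m - c m) * (sqrt q * 1) ^ m \<le> (norm (e m) + norm (c m)) * (sqrt q * 1) ^ m"
      by (intro mult_right_mono norm_triangle_ineq4) auto
    then show "norm (norm (e m - c m) * (sqrt q * 1) ^ m) \<le> norm (e m) * (sqrt q * 1) ^ m + norm (c m) * (sqrt q * 1) ^ m"
      by (simp add: distrib_right)
  qed
  have zero: "norm (\<Sum>m. (e m - c m) * cheb q w m) \<le> 0" if w: "norm w = 1" for w
  proof -
    define z where "z = complex_of_real (Arg w / ln q)"
    have lnq: "ln (real q) > 0" using q_ge_2 by simp
    have w0: "w \<noteq> 0" using w by auto
    have wz: "w = qpow (\<i> * z)"
    proof -
      have "qpow (\<i> * z) = exp (\<i> * of_real (Arg w))" unfolding qpow_exp z_def using lnq by simp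
      then show ?thesis using Arg_eq[OF w0] w by simp
    qed
    have zs: "z \<in> strip 1" unfolding strip_def z_def by simp
    have sV: "summable (\<lambda>m. e m * cheb q w m)" if "summable (\<lambda>m. norm (e m) * real q ^ m)" for e
    proof (rule summable_norm_cancel, rule summable_comparison_test'[OF summable_mult[OF sq[OF that], of 2]])
      fix m
      have "norm (e m * cheb q w m) \<le> norm (e m) * (2 * norm w * (sqrt q * norm w) ^ m)"
        unfolding norm_mult by (intro mult_left_mono cheb_bound) (use w in auto)
      then show "norm (norm (e m * cheb q w m)) \<le> 2 * (norm (e m) * (sqrt q * 1) ^ m)"
        unfolding w by (simp add: mult_ac)
    qed
    have "(\<Sum>m. (e m - c m) * cheb q w m) = (\<Sum>m. e m * cheb q w m) - (\<Sum>m. c m * cheb q w m)"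
      unfolding left_diff_distrib by (rule suminf_diff[OF sV[OF e(1)] sV[OF c(1)], symmetric])
    then show ?thesis
      unfolding transform_cheb[OF e zs wz] transform_cheb[OF c zs wz] eq[OF zs] by simp
  qed
  have "e m = c m" for m
  proof -
    have "norm (e m - c m) * sqrt q ^ m * 1 ^ Suc m \<le> 0"
      using coeff_bound_from_circle[of 1 "\<lambda>m. e m - c m" q 0 m, OF order_refl s zero] .
    moreover have "sqrt q ^ m > 0" using q_pos by simp
    ultimately show ?thesis by (simp add: mult_le_0_iff)
  qed
  then show ?thesis using e(2) c(2) by (simp add: fun_eq_iff)
qed

lemma heat_kernel_eq: "heat_kernel adj q x0 \<xi> = heat_fun \<xi>"
  unfolding heat_kernel_def
proof (rule the_equality)
  show "radial adj x0 (heat_fun \<xi>) \<and> (\<forall>p. 1 \<le> p \<and> p < 2 \<longrightarrow> heat_fun \<xi> \<in> schwartz_space adj q x0 p \<and>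
     (\<forall>z\<in>strip p. spherical_transform adj q x0 (heat_fun \<xi>) z = exp (\<xi> * \<gamma> q z)))"
    using radial_heat_fun schwartz_heat_fun transform_heat_fun by blast
  fix h assume "radial adj x0 h \<and> (\<forall>p. 1 \<le> p \<and> p < 2 \<longrightarrow> h \<in> schwartz_space adj q x0 p \<and>
     (\<forall>z\<in>strip p. spherical_transform adj q x0 h z = exp (\<xi> * \<gamma> q z)))"
  then have h: "radial adj x0 h" "h \<in> schwartz_space adj q x0 1"
    "\<And>z. z \<in> strip 1 \<Longrightarrow> spherical_transform adj q x0 h z = exp (\<xi> * \<gamma> q z)" by auto
  show "h = heat_fun \<xi>"
    by (rule transform_unique[OF h(1,2) radial_heat_fun schwartz_heat_fun]) (use h(3) transform_heat_fun[of 1] in auto)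
qed

theorem heat_operator_eq:
  assumes "\<And>y. norm (f y) \<le> C"
  shows "heat_operator adj q x0 \<xi> f x = exp \<xi> * exp_nbr (- \<xi> / of_nat (q + 1)) f x"
  unfolding heat_operator_def tree_conv_def heat_kernel_eq radial_value_heat_fun
  by (rule heat_conv[of f C, OF assms])

end

section \<open>Densities of additive functions on sectors\<close>

text \<open>
  Completeness of \<open>L\<^sup>1\<close>, together with almost sure convergence of a subsequence. The limit is that of
  the subsequence; Fatou's lemma shows that the full sequence converges to it in \<open>L\<^sup>1\<close>.
\<close>

lemma L1_Cauchy_converges:
  fixes s :: "nat \<Rightarrow> 'b \<Rightarrow> complex"
  assumes int: "\<And>n. integrable M (s n)"
    and cauchy: "\<And>e. e > 0 \<Longrightarrow> \<exists>N. \<forall>i\<ge>N. \<forall>j\<ge>N. (LINT x|M. norm (s i x - s j x)) < e"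
  obtains F r where "integrable M F" "strict_mono r" "AE x in M. (\<lambda>i. s (r i) x) \<longlonglongrightarrow> F x"
    "(\<lambda>n. \<integral>\<^sup>+x. norm (s n x - F x) \<partial>M) \<longlonglongrightarrow> 0"
proof -
  have [measurable]: "\<And>n. s n \<in> borel_measurable M" using int by auto
  obtain r where r: "strict_mono r" "AE x in M. Cauchy (\<lambda>i. s (r i) x)"
    using cauchy_L1_AE_cauchy_subseq[OF int cauchy] by blast
  define F where "F x = lim (\<lambda>i. s (r i) x)" for x
  have F[measurable]: "F \<in> borel_measurable M" unfolding F_def by measurable
  have lim: "AE x in M. (\<lambda>i. s (r i) x) \<longlonglongrightarrow> F x"
    using r(2) by eventually_elim (auto simp: F_def Cauchy_convergent_iff convergent_LIMSEQ_iff)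
  have bound: "\<exists>N. \<forall>n\<ge>N. (\<integral>\<^sup>+x. norm (s n x - F x) \<partial>M) \<le> ennreal e" if "e > 0" for e
  proof -
    obtain N where N: "\<And>i j. i \<ge> N \<Longrightarrow> j \<ge> N \<Longrightarrow> (LINT x|M. norm (s i x - s j x)) < e"
      using cauchy[OF \<open>e > 0\<close>] by blast
    have "(\<integral>\<^sup>+x. norm (s n x - F x) \<partial>M) \<le> ennreal e" if n: "n \<ge> N" for n
    proof -
      have "AE x in M. (\<lambda>j. ennreal (norm (s n x - s (r j) x))) \<longlonglongrightarrow> ennreal (norm (s n x - F x))"
        using lim by eventually_elim (intro tendsto_intros)
      then have "AE x in M. ennreal (norm (s n x - F x)) = liminf (\<lambda>j. ennreal (norm (s n x - s (r j) x)))"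
        by eventually_elim (rule lim_imp_Liminf[OF sequentially_bot, symmetric])
      then have "(\<integral>\<^sup>+x. norm (s n x - F x) \<partial>M) = (\<integral>\<^sup>+x. liminf (\<lambda>j. ennreal (norm (s n x - s (r j) x))) \<partial>M)"
        by (rule nn_integral_cong_AE)
      also have "\<dots> \<le> liminf (\<lambda>j. \<integral>\<^sup>+x. ennreal (norm (s n x - s (r j) x)) \<partial>M)"
        by (rule nn_integral_liminf) measurable
      also have "\<dots> \<le> ennreal e"
      proof (rule Liminf_le[OF sequentially_bot], rule eventually_sequentiallyI[of N])
        fix j assume "N \<le> j"
        then have "r j \<ge> N" using seq_suble[OF r(1), of j] by linarith
        have "(\<integral>\<^sup>+x. ennreal (norm (s n x - s (r j) x)) \<partial>M) = ennreal (LINT x|M. norm (s n x - s (r j) x))"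
          by (rule nn_integral_eq_integral) (use int in auto)
        also have "\<dots> \<le> ennreal e" using N[OF n \<open>r j \<ge> N\<close>] by (intro ennreal_leI) simp
        finally show "(\<integral>\<^sup>+x. ennreal (norm (s n x - s (r j) x)) \<partial>M) \<le> ennreal e" .
      qed
      finally show ?thesis .
    qed
    then show ?thesis by blast
  qed
  have conv: "(\<lambda>n. \<integral>\<^sup>+x. norm (s n x - F x) \<partial>M) \<longlonglongrightarrow> 0"
  proof (rule order_tendstoI)
    fix a :: ennreal assume a: "0 < a"
    obtain c where c: "0 < c" "c < a" using dense[OF a] by blast
    then have "c \<noteq> top" using less_le_trans[OF c(2) top_greatest] by auto
    with c(1) obtain e where e: "e > 0" "ennreal e < a"
      using c(2) by (cases c) auto
    show "\<forall>\<^sub>F n in sequentially. (\<integral>\<^sup>+x. norm (s n x - F x) \<partial>M) < a"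
      using bound[OF e(1)] e(2) unfolding eventually_sequentially by (meson le_less_trans)
  qed simp
  obtain N where "\<forall>n\<ge>N. (\<integral>\<^sup>+x. norm (s n x - F x) \<partial>M) \<le> ennreal 1" using bound[of 1] by auto
  then have "(\<integral>\<^sup>+x. norm (s N x - F x) \<partial>M) < \<infinity>" by (metis ennreal_less_top infinity_ennreal_def le_less_trans order_refl)
  then have "integrable M (\<lambda>x. s N x - F x)" by (intro integrableI_bounded) auto
  then have "integrable M (\<lambda>x. s N x - (s N x - F x))" by (rule Bochner_Integration.integrable_diff[OF int])
  moreover have "(\<lambda>x. s N x - (s N x - F x)) = F" by auto
  ultimately have "integrable M F" by (simp only:)
  from that[OF this r(1) lim conv] show ?thesis .
qed

text \<open>
  Jensen's inequality for powers on the closed half line, by the tangent at the mean.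
\<close>

lemma powr_mean_le:
  fixes t :: "'b \<Rightarrow> real"
  assumes "finite S" "S \<noteq> {}" "\<And>i. i \<in> S \<Longrightarrow> t i \<ge> 0" "R \<ge> 1"
  shows "((\<Sum>i\<in>S. t i) / card S) powr R \<le> (\<Sum>i\<in>S. t i powr R) / card S"
proof (cases "(\<Sum>i\<in>S. t i) = 0")
  case True
  then show ?thesis by (simp add: sum_nonneg divide_nonneg_nonneg)
next
  case False
  define a where "a = (\<Sum>i\<in>S. t i) / card S"
  have c: "real (card S) > 0" using assms(1,2) by (simp add: card_gt_0_iff)
  have "(\<Sum>i\<in>S. t i) > 0" using False sum_nonneg[of S t] assms(3) by fastforce
  then have a: "a > 0" unfolding a_def using c by simp
  have tangent: "a powr R + R * a powr (R - 1) * (x - a) \<le> x powr R" if "x \<ge> 0" for x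
  proof (cases "x = 0")
    case True
    have "R * a powr (R - 1) * a = R * a powr R" using a by (simp add: powr_diff)
    moreover have "a powr R \<le> R * a powr R" using assms(4) a by simp
    ultimately show ?thesis using True assms(4) by (simp add: algebra_simps)
  next
    case False
    then have "x powr R - a powr R \<ge> R * a powr (R - 1) * (x - a)"
      using that a
      by (intro convex_on_imp_above_tangent[where A = "{0<..}"] powr_convex assms(4))
        (auto intro!: derivative_eq_intros simp: interior_open)
    then show ?thesis by simp
  qed
  have "card S * a powr R = (\<Sum>i\<in>S. a powr R + R * a powr (R - 1) * (t i - a))"
  proof -
    have "(\<Sum>i\<in>S. t i - a) = 0" using c by (simp add: sum_subtractf a_def)
    then have "(\<Sum>i\<in>S. R * a powr (R - 1) * (t i - a)) = 0" by (simp flip: sum_distrib_left)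
    then show ?thesis by (simp add: sum.distrib)
  qed
  also have "\<dots> \<le> (\<Sum>i\<in>S. t i powr R)" by (intro sum_mono tangent assms(3))
  finally show ?thesis unfolding a_def[symmetric] using c by (simp add: field_simps)
qed

lemma harmonic_le_ln: "n \<ge> 1 \<Longrightarrow> (\<Sum>k=1..n. 1 / real k) \<le> 1 + ln (real n)"
proof (induction n rule: nat_induct_at_least)
  case base
  show ?case by simp
next
  case (Suc n)
  have "ln (real n / real (Suc n)) \<le> real n / real (Suc n) - 1" using Suc.hyps by (intro ln_le_minus_one) simp
  also have "\<dots> = - (1 / real (Suc n))" by (simp add: field_simps)
  finally have "1 / real (Suc n) \<le> ln (real (Suc n)) - ln (real n)" using Suc.hyps by (simp add: ln_div)
  with Suc.IH show ?case by simp
qed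

lemma AE_nonpos_of_integrals_zero:
  fixes f :: "'b \<Rightarrow> real"
  assumes "integrable M f" "\<And>A. A \<in> sets M \<Longrightarrow> (\<integral>x. indicator A x * f x \<partial>M) = 0"
  shows "AE x in M. f x \<le> 0"
proof -
  define A where "A = {x \<in> space M. f x > 0}"
  have [measurable]: "f \<in> borel_measurable M" using assms(1) by auto
  have A: "A \<in> sets M" unfolding A_def by measurable
  have "integrable M (\<lambda>x. indicator A x * f x)"
    using integrable_mult_indicator[OF A assms(1)] by simp
  then have "AE x in M. indicator A x * f x = 0"
    using assms(2)[OF A] by (subst (asm) integral_nonneg_eq_0_iff_AE) (auto simp: A_def indicator_def)
  then show ?thesis
    using AE_space by eventually_elim (auto simp: A_def indicator_def split: if_splits)
qed

text \<open>
  The real and imaginary parts and their negatives are all almost everywhere nonpositive.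
\<close>

lemma AE_zero_of_integrals_zero:
  fixes f :: "'b \<Rightarrow> complex"
  assumes f: "integrable M f" and 0: "\<And>A. A \<in> sets M \<Longrightarrow> (\<integral>x. indicator A x * f x \<partial>M) = 0"
  shows "AE x in M. f x = 0"
proof -
  have i: "integrable M (\<lambda>x. indicator A x * f x)" if "A \<in> sets M" for A
  proof -
    have "(\<lambda>x. indicator A x * f x) = (\<lambda>x. indicator A x *\<^sub>R f x)" by (auto simp: indicator_def fun_eq_iff)
    then show ?thesis using integrable_mult_indicator[OF that f] by simp
  qed
  have re: "(\<integral>x. indicator A x * Re (f x) \<partial>M) = 0" and im: "(\<integral>x. indicator A x * Im (f x) \<partial>M) = 0" if "A \<in> sets M" for A
  proof -
    have "(\<integral>x. indicator A x * Re (f x) \<partial>M) = (\<integral>x. Re (indicator A x * f x) \<partial>M)"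
      by (intro Bochner_Integration.integral_cong refl) (simp add: indicator_def)
    then show "(\<integral>x. indicator A x * Re (f x) \<partial>M) = 0"
      unfolding integral_Re[OF i[OF that]] 0[OF that] by simp
    have "(\<integral>x. indicator A x * Im (f x) \<partial>M) = (\<integral>x. Im (indicator A x * f x) \<partial>M)"
      by (intro Bochner_Integration.integral_cong refl) (simp add: indicator_def)
    then show "(\<integral>x. indicator A x * Im (f x) \<partial>M) = 0"
      unfolding integral_Im[OF i[OF that]] 0[OF that] by simp
  qed
  have "AE x in M. Re (f x) \<le> 0" by (rule AE_nonpos_of_integrals_zero) (use f re in auto)
  moreover have "AE x in M. - Re (f x) \<le> 0" by (rule AE_nonpos_of_integrals_zero) (use f re in auto)
  moreover have "AE x in M. Im (f x) \<le> 0" by (rule AE_nonpos_of_integrals_zero) (use f im in auto)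
  moreover have "AE x in M. - Im (f x) \<le> 0" by (rule AE_nonpos_of_integrals_zero) (use f im in auto)
  ultimately show ?thesis by eventually_elim (auto simp: complex_eq_iff)
qed

context rooted_tree
begin

definition sphere :: "nat \<Rightarrow> 'a set" where "sphere n = {x. level x = n}"

lemma finite_sphere [simp]: "finite (sphere n)"
  by (rule finite_subset[OF _ finite_ball[of x0 n]]) (auto simp: sphere_def)

lemma sphere_Suc: "sphere (Suc n) = (\<Union>x\<in>sphere n. children x)"
proof (intro set_eqI iffI)
  fix y assume "y \<in> sphere (Suc n)"
  then have y: "level y = Suc n" "y \<noteq> x0" by (auto simp: sphere_def)
  then have "parent y \<in> sphere n" using level_parent[OF y(2)] by (simp add: sphere_def)
  then show "y \<in> (\<Union>x\<in>sphere n. children x)" using y(2) by (auto simp: children_iff)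
qed (auto simp: sphere_def level_child)

lemma sum_sphere_Suc: "(\<Sum>y\<in>sphere (Suc n). g y) = (\<Sum>x\<in>sphere n. \<Sum>y\<in>children x. g y)"
  unfolding sphere_Suc by (rule sum.UNION_disjoint) (auto simp: children_iff)

text \<open>
  A function of the \<open>n\<close>-th vertex of a ray is constant on the sectors of level \<open>n\<close>.
\<close>

lemma integral_level_mult:
  assumes F: "integrable \<nu> F"
  shows "integrable \<nu> (\<lambda>\<omega>. h (\<omega> n) * F \<omega>)"
    and "(\<integral>\<omega>. h (\<omega> n) * F \<omega> \<partial>\<nu>) = (\<Sum>x\<in>sphere n. h x * sector_int F x)"
proof -
  let ?G = "\<lambda>\<omega>. \<Sum>x\<in>sphere n. h x * (indicator (sector x) \<omega> * F \<omega>)"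
  have eq: "?G \<omega> = h (\<omega> n) * F \<omega>" if "\<omega> \<in> \<Omega>" for \<omega>
  proof -
    have "?G \<omega> = (\<Sum>x\<in>sphere n. if x = \<omega> n then h (\<omega> n) * F \<omega> else 0)"
      by (intro sum.cong refl) (use that in \<open>auto simp: indicator_def sector_iff sphere_def\<close>)
    moreover have "\<omega> n \<in> sphere n" using ray_level[OF that, of n] by (simp add: sphere_def)
    ultimately show ?thesis by simp
  qed
  have i: "integrable \<nu> ?G"
    by (intro Bochner_Integration.integrable_sum integrable_mult_right sector_integrable F)
  then show "integrable \<nu> (\<lambda>\<omega>. h (\<omega> n) * F \<omega>)"
    by (rule Bochner_Integration.integrable_cong[OF refl, THEN iffD1, rotated]) (simp add: eq space_\<nu>)
  have "(\<integral>\<omega>. h (\<omega> n) * F \<omega> \<partial>\<nu>) = (\<integral>\<omega>. ?G \<omega> \<partial>\<nu>)"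
    by (rule Bochner_Integration.integral_cong[OF refl]) (simp add: eq space_\<nu>)
  also have "\<dots> = (\<Sum>x\<in>sphere n. h x * sector_int F x)"
    unfolding sector_int_def
    by (subst Bochner_Integration.integral_sum) (auto intro!: integrable_mult_right sector_integrable F)
  finally show "(\<integral>\<omega>. h (\<omega> n) * F \<omega> \<partial>\<nu>) = (\<Sum>x\<in>sphere n. h x * sector_int F x)" .
qed

lemma integral_level:
  fixes g :: "'a \<Rightarrow> real"
  shows "integrable \<nu> (\<lambda>\<omega>. g (\<omega> n))" "(\<integral>\<omega>. g (\<omega> n) \<partial>\<nu>) = (\<Sum>x\<in>sphere n. sector_prob n * g x)"
proof -
  note c = integral_level_mult[OF \<nu>.integrable_const, of "\<lambda>x. complex_of_real (g x)" n 1]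
  show "integrable \<nu> (\<lambda>\<omega>. g (\<omega> n))" using integrable_Re[OF c(1)] by simp
  have "(\<integral>\<omega>. g (\<omega> n) \<partial>\<nu>) = Re (\<integral>\<omega>. complex_of_real (g (\<omega> n)) * 1 \<partial>\<nu>)"
    using integral_Re[OF c(1)] by simp
  also have "\<dots> = (\<Sum>x\<in>sphere n. sector_prob n * g x)"
    unfolding c(2) by (simp add: sector_int_one sphere_def mult.commute)
  finally show "(\<integral>\<omega>. g (\<omega> n) \<partial>\<nu>) = (\<Sum>x\<in>sphere n. sector_prob n * g x)" .
qed

lemma sector_prob_pos: "sector_prob n > 0" using q_pos by (simp add: sector_prob_def)

lemma sector_prob_Suc: "sector_prob (level x) = real (card (children x)) * sector_prob (Suc (level x))"
proof (cases "x = x0")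
  case False
  then have "level x \<noteq> 0" by simp
  then show ?thesis using False q_pos by (cases "level x") (simp_all add: sector_prob_def card_children)
next
  case True
  then show ?thesis unfolding True by (simp add: sector_prob_def card_children)
qed

definition child_additive :: "('a \<Rightarrow> complex) \<Rightarrow> bool" where
  "child_additive \<mu> \<longleftrightarrow> (\<forall>x. \<mu> x = (\<Sum>y\<in>children x. \<mu> y))"

text \<open>
  For child-additive \<open>\<mu>\<close> this is a martingale with respect to the sectors of level \<open>n\<close>.
\<close>

definition level_dens :: "('a \<Rightarrow> complex) \<Rightarrow> nat \<Rightarrow> (nat \<Rightarrow> 'a) \<Rightarrow> complex" where
  "level_dens \<mu> n \<omega> = \<mu> (\<omega> n) / of_real (sector_prob n)"

lemma level_dens_integrable: "integrable \<nu> (level_dens \<mu> n)"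
  using integral_level_mult(1)[OF \<nu>.integrable_const, of "\<lambda>x. \<mu> x / of_real (sector_prob n)" n 1] by (simp add: level_dens_def[abs_def])

lemma sector_int_level_dens:
  assumes "child_additive \<mu>" "level x \<le> n"
  shows "sector_int (level_dens \<mu> n) x = \<mu> x"
  using assms(2)
proof (induction "n - level x" arbitrary: x)
  case 0
  then have n: "level x = n" by simp
  have "sector_int (level_dens \<mu> n) x = (\<integral>\<omega>. (if \<omega> n = x then \<mu> x / of_real (sector_prob n) else 0) * 1 \<partial>\<nu>)"
    unfolding sector_int_def
    by (rule Bochner_Integration.integral_cong[OF refl]) (use n in \<open>auto simp: level_dens_def indicator_def sector_iff space_\<nu>\<close>)
  also have "\<dots> = (\<Sum>y\<in>sphere n. (if y = x then \<mu> x / of_real (sector_prob n) else 0) * sector_int (\<lambda>_. 1) y)"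
    by (rule integral_level_mult(2)[OF \<nu>.integrable_const])
  also have "\<dots> = (\<Sum>y\<in>sphere n. if y = x then \<mu> x else 0)"
    by (intro sum.cong refl) (use n sector_prob_pos[of n] in \<open>auto simp: sector_int_one sphere_def\<close>)
  also have "\<dots> = \<mu> x"
  proof -
    have "x \<in> sphere n" using n by (simp add: sphere_def)
    then show ?thesis by simp
  qed
  finally show ?case .
next
  case (Suc m)
  have "sector_int (level_dens \<mu> n) x = (\<Sum>y\<in>children x. sector_int (level_dens \<mu> n) y)" by (rule sector_int_children[OF level_dens_integrable])
  also have "\<dots> = (\<Sum>y\<in>children x. \<mu> y)"
    by (intro sum.cong refl Suc.hyps(1)) (use Suc.hyps(2) in \<open>auto simp: level_child\<close>)
  also have "\<dots> = \<mu> x" using assms(1) unfolding child_additive_def by metis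
  finally show ?case .
qed

text \<open>
  Orthogonality of martingale increments.
\<close>

lemma level_dens_square_diff:
  assumes ad: "child_additive \<mu>" and "n \<le> N"
  shows "(\<integral>\<omega>. (norm (level_dens \<mu> N \<omega> - level_dens \<mu> n \<omega>))\<^sup>2 \<partial>\<nu>)
       = (\<integral>\<omega>. (norm (level_dens \<mu> N \<omega>))\<^sup>2 \<partial>\<nu>) - (\<integral>\<omega>. (norm (level_dens \<mu> n \<omega>))\<^sup>2 \<partial>\<nu>)"
    and "integrable \<nu> (\<lambda>\<omega>. (norm (level_dens \<mu> N \<omega> - level_dens \<mu> n \<omega>))\<^sup>2)"
proof -
  have sq: "integrable \<nu> (\<lambda>\<omega>. (norm (level_dens \<mu> k \<omega>))\<^sup>2)" for k
    using integral_level(1)[of "\<lambda>x. (norm (\<mu> x / of_real (sector_prob k)))\<^sup>2" k] by (simp add: level_dens_def)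
  have cr: "integrable \<nu> (\<lambda>\<omega>. cnj (level_dens \<mu> n \<omega>) * level_dens \<mu> N \<omega>)"
    "(\<integral>\<omega>. cnj (level_dens \<mu> n \<omega>) * level_dens \<mu> N \<omega> \<partial>\<nu>) = (\<Sum>x\<in>sphere n. cnj (\<mu> x / of_real (sector_prob n)) * sector_int (level_dens \<mu> N) x)"
    using integral_level_mult[OF level_dens_integrable, of "\<lambda>x. cnj (\<mu> x / of_real (sector_prob n))" n \<mu> N] by (simp_all add: level_dens_def)
  have "(\<Sum>x\<in>sphere n. cnj (\<mu> x / of_real (sector_prob n)) * sector_int (level_dens \<mu> N) x) =
     (\<Sum>x\<in>sphere n. of_real (sector_prob n * (norm (\<mu> x / of_real (sector_prob n)))\<^sup>2))"
  proof (rule sum.cong[OF refl])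
    fix x assume x: "x \<in> sphere n"
    then have "sector_int (level_dens \<mu> N) x = \<mu> x" using sector_int_level_dens[OF ad, of x N] assms(2) by (simp add: sphere_def)
    then show "cnj (\<mu> x / of_real (sector_prob n)) * sector_int (level_dens \<mu> N) x = of_real (sector_prob n * (norm (\<mu> x / of_real (sector_prob n)))\<^sup>2)"
    proof -
      assume s: "sector_int (level_dens \<mu> N) x = \<mu> x"
      have "cnj (\<mu> x / of_real (sector_prob n)) * sector_int (level_dens \<mu> N) x = (\<mu> x * cnj (\<mu> x)) / of_real (sector_prob n)"
        by (simp add: s)
      also have "\<dots> = of_real ((norm (\<mu> x))\<^sup>2 / sector_prob n)"
        by (simp only: complex_norm_square[symmetric] of_real_divide)
      also have "(norm (\<mu> x))\<^sup>2 / sector_prob n = sector_prob n * (norm (\<mu> x / of_real (sector_prob n)))\<^sup>2"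
        using sector_prob_pos[of n] by (simp add: norm_divide power_divide power2_eq_square)
      finally show ?thesis .
    qed
  qed
  also have "\<dots> = of_real (\<integral>\<omega>. (norm (level_dens \<mu> n \<omega>))\<^sup>2 \<partial>\<nu>)"
    using integral_level(2)[of "\<lambda>x. (norm (\<mu> x / of_real (sector_prob n)))\<^sup>2" n] by (simp add: level_dens_def)
  finally have c2: "(\<integral>\<omega>. cnj (level_dens \<mu> n \<omega>) * level_dens \<mu> N \<omega> \<partial>\<nu>) = of_real (\<integral>\<omega>. (norm (level_dens \<mu> n \<omega>))\<^sup>2 \<partial>\<nu>)"
    unfolding cr(2) .
  have ex: "(norm (z - w))\<^sup>2 = (norm z)\<^sup>2 + (norm w)\<^sup>2 - 2 * Re (cnj w * z)" for z w :: complex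
    unfolding cmod_power2 by (simp add: power2_eq_square algebra_simps)
  have cR: "integrable \<nu> (\<lambda>\<omega>. 2 * Re (cnj (level_dens \<mu> n \<omega>) * level_dens \<mu> N \<omega>))"
    by (intro integrable_mult_right integrable_Re cr(1))
  show "integrable \<nu> (\<lambda>\<omega>. (norm (level_dens \<mu> N \<omega> - level_dens \<mu> n \<omega>))\<^sup>2)"
    unfolding ex by (intro Bochner_Integration.integrable_diff Bochner_Integration.integrable_add sq cR)
  have "(\<integral>\<omega>. (norm (level_dens \<mu> N \<omega> - level_dens \<mu> n \<omega>))\<^sup>2 \<partial>\<nu>) =
     (\<integral>\<omega>. (norm (level_dens \<mu> N \<omega>))\<^sup>2 \<partial>\<nu>) + (\<integral>\<omega>. (norm (level_dens \<mu> n \<omega>))\<^sup>2 \<partial>\<nu>)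
       - 2 * (\<integral>\<omega>. Re (cnj (level_dens \<mu> n \<omega>) * level_dens \<mu> N \<omega>) \<partial>\<nu>)"
    unfolding ex
    by (subst Bochner_Integration.integral_diff[OF Bochner_Integration.integrable_add[OF sq sq] cR])
      (simp only: Bochner_Integration.integral_add[OF sq sq] integral_mult_right_zero)
  also have "(\<integral>\<omega>. Re (cnj (level_dens \<mu> n \<omega>) * level_dens \<mu> N \<omega>) \<partial>\<nu>) = (\<integral>\<omega>. (norm (level_dens \<mu> n \<omega>))\<^sup>2 \<partial>\<nu>)"
    unfolding integral_Re[OF cr(1)] c2 by simp
  finally show "(\<integral>\<omega>. (norm (level_dens \<mu> N \<omega> - level_dens \<mu> n \<omega>))\<^sup>2 \<partial>\<nu>)
       = (\<integral>\<omega>. (norm (level_dens \<mu> N \<omega>))\<^sup>2 \<partial>\<nu>) - (\<integral>\<omega>. (norm (level_dens \<mu> n \<omega>))\<^sup>2 \<partial>\<nu>)" by simp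
qed

text \<open>
  The second moments increase and are bounded, hence form a Cauchy sequence; by orthogonality the
  densities are Cauchy in \<open>L\<^sup>2\<close> and so in \<open>L\<^sup>1\<close>, which preserves integrals over sectors.
\<close>

lemma child_additive_L2_limit:
  assumes ad: "child_additive \<mu>" and bd: "\<And>n. (\<integral>\<omega>. (norm (level_dens \<mu> n \<omega>))\<^sup>2 \<partial>\<nu>) \<le> B"
  obtains F r where "integrable \<nu> F" "strict_mono r" "AE \<omega> in \<nu>. (\<lambda>i. level_dens \<mu> (r i) \<omega>) \<longlonglongrightarrow> F \<omega>"
    "\<And>x. sector_int F x = \<mu> x"
proof -
  define a where "a n = (\<integral>\<omega>. (norm (level_dens \<mu> n \<omega>))\<^sup>2 \<partial>\<nu>)" for n
  have d: "(\<integral>\<omega>. (norm (level_dens \<mu> N \<omega> - level_dens \<mu> n \<omega>))\<^sup>2 \<partial>\<nu>) = a N - a n" if "n \<le> N" for n N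
    using level_dens_square_diff(1)[OF ad that] by (simp add: a_def)
  have "incseq a"
  proof (rule incseq_SucI)
    fix n
    have "0 \<le> (\<integral>\<omega>. (norm (level_dens \<mu> (Suc n) \<omega> - level_dens \<mu> n \<omega>))\<^sup>2 \<partial>\<nu>)" by (intro Bochner_Integration.integral_nonneg) simp
    then show "a n \<le> a (Suc n)" using d[of n "Suc n"] by simp
  qed
  then obtain L where "a \<longlonglongrightarrow> L" using incseq_convergent[of a B] bd unfolding a_def by blast
  then have "Cauchy a" by (rule LIMSEQ_imp_Cauchy)
  have cauchy: "\<exists>N. \<forall>i\<ge>N. \<forall>j\<ge>N. (\<integral>\<omega>. norm (level_dens \<mu> i \<omega> - level_dens \<mu> j \<omega>) \<partial>\<nu>) < e" if e: "e > 0" for e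
  proof -
    obtain N where N: "\<And>i j. i \<ge> N \<Longrightarrow> j \<ge> N \<Longrightarrow> norm (a i - a j) < e\<^sup>2"
      using CauchyD[OF \<open>Cauchy a\<close>, of "e\<^sup>2"] e by auto
    have le: "(\<integral>\<omega>. norm (level_dens \<mu> i \<omega> - level_dens \<mu> j \<omega>) \<partial>\<nu>) < e" if ij: "i \<ge> N" "j \<ge> N" "j \<le> i" for i j
    proof -
      \<comment> \<open>Arithmetic-geometric mean, tuned to \<open>e\<close>; it replaces the Cauchy-Schwarz inequality.\<close>
      have pt: "norm z \<le> (e + (norm z)\<^sup>2 / e) / 2" for z :: complex
        using sum_squares_bound[of e "norm z"] e by (simp add: field_simps power2_eq_square)
      note sq = level_dens_square_diff(2)[OF ad ij(3)]
      have "(\<integral>\<omega>. norm (level_dens \<mu> i \<omega> - level_dens \<mu> j \<omega>) \<partial>\<nu>) \<le> (\<integral>\<omega>. (e + (norm (level_dens \<mu> i \<omega> - level_dens \<mu> j \<omega>))\<^sup>2 / e) / 2 \<partial>\<nu>)"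
        by (intro integral_mono integrable_norm Bochner_Integration.integrable_diff level_dens_integrable
             integrable_divide Bochner_Integration.integrable_add \<nu>.integrable_const sq pt)
      also have "\<dots> = (e + (a i - a j) / e) / 2"
      proof -
        have "(\<integral>\<omega>. e + (norm (level_dens \<mu> i \<omega> - level_dens \<mu> j \<omega>))\<^sup>2 / e \<partial>\<nu>) = e + (\<integral>\<omega>. (norm (level_dens \<mu> i \<omega> - level_dens \<mu> j \<omega>))\<^sup>2 / e \<partial>\<nu>)"
          by (subst Bochner_Integration.integral_add[OF \<nu>.integrable_const integrable_divide[OF sq]]) (simp_all add: \<nu>.prob_space)
        then show ?thesis using d[OF ij(3)] by simp
      qed
      also have "\<dots> < (e + e\<^sup>2 / e) / 2" using N[OF ij(1,2)] e by (simp add: divide_strict_right_mono)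
      also have "\<dots> = e" using e by (simp add: power2_eq_square)
      finally show ?thesis .
    qed
    show ?thesis
    proof (intro exI allI impI)
      fix i j assume "N \<le> i" "N \<le> j"
      then show "(\<integral>\<omega>. norm (level_dens \<mu> i \<omega> - level_dens \<mu> j \<omega>) \<partial>\<nu>) < e"
        using le[of i j] le[of j i] by (cases "j \<le> i") (auto simp: norm_minus_commute)
    qed
  qed
  from L1_Cauchy_converges[OF level_dens_integrable cauchy] obtain F r where
    F: "integrable \<nu> F" "strict_mono r" "AE \<omega> in \<nu>. (\<lambda>i. level_dens \<mu> (r i) \<omega>) \<longlonglongrightarrow> F \<omega>"
      "(\<lambda>n. \<integral>\<^sup>+\<omega>. norm (level_dens \<mu> n \<omega> - F \<omega>) \<partial>\<nu>) \<longlonglongrightarrow> 0" by blast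
  have "sector_int F x = \<mu> x" for x
  proof -
    have "(\<lambda>n. \<integral>\<omega>. indicator (sector x) \<omega> * level_dens \<mu> n \<omega> \<partial>\<nu>) \<longlonglongrightarrow> (\<integral>\<omega>. indicator (sector x) \<omega> * F \<omega> \<partial>\<nu>)"
    proof (rule tendsto_L1_int[OF sector_integrable[OF level_dens_integrable] sector_integrable[OF F(1)]])
      show "(\<lambda>n. \<integral>\<^sup>+\<omega>. norm (indicator (sector x) \<omega> * level_dens \<mu> n \<omega> - indicator (sector x) \<omega> * F \<omega>) \<partial>\<nu>) \<longlonglongrightarrow> 0"
      proof (rule tendsto_sandwich[OF _ _ tendsto_const F(4)])
        show "\<forall>\<^sub>F n in sequentially. (\<integral>\<^sup>+\<omega>. norm (indicator (sector x) \<omega> * level_dens \<mu> n \<omega> - indicator (sector x) \<omega> * F \<omega>) \<partial>\<nu>)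
           \<le> (\<integral>\<^sup>+\<omega>. norm (level_dens \<mu> n \<omega> - F \<omega>) \<partial>\<nu>)"
          by (intro always_eventually allI nn_integral_mono) (auto simp: indicator_def)
      qed simp
    qed
    then have "(\<lambda>n. sector_int (level_dens \<mu> n) x) \<longlonglongrightarrow> sector_int F x" by (simp add: sector_int_def)
    moreover have "(\<lambda>n. sector_int (level_dens \<mu> n) x) \<longlonglongrightarrow> \<mu> x"
      by (rule tendsto_eventually, rule eventually_sequentiallyI[of "level x"]) (simp add: sector_int_level_dens[OF ad])
    ultimately show ?thesis by (rule LIMSEQ_unique)
  qed
  from that[OF F(1-3) this] show ?thesis .
qed

text \<open>
  Dynkin's argument: sectors generate the \<open>\<sigma>\<close>-algebra and are closed under intersection, up to the
  empty set.
\<close>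

lemma AE_zero_of_sector_int_zero:
  assumes f: "integrable \<nu> f" and 0: "\<And>x. sector_int f x = 0"
  shows "AE \<omega> in \<nu>. f \<omega> = 0"
proof (rule AE_zero_of_integrals_zero[OF f])
  have i: "integrable \<nu> (\<lambda>x. indicator A x * f x)" if "A \<in> sets \<nu>" for A
  proof -
    have "(\<lambda>x. indicator A x * f x) = (\<lambda>x. indicator A x *\<^sub>R f x)" by (auto simp: indicator_def fun_eq_iff)
    then show ?thesis using integrable_mult_indicator[OF that f] by simp
  qed
  have tot: "(\<integral>\<omega>. f \<omega> \<partial>\<nu>) = 0" using 0[of x0] by (simp add: sector_int_root)
  let ?G = "insert {} (range sector)"
  have sg: "sets \<nu> = sigma_sets \<Omega> ?G"
  proof -
    have "sigma_sets \<Omega> ?G = sigma_sets \<Omega> (range sector)"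
      by (rule sigma_sets_eqI) (auto intro: sigma_sets.Empty)
    then show ?thesis by (simp add: sets_\<nu>)
  qed
  fix A assume "A \<in> sets \<nu>"
  then have A: "A \<in> sigma_sets \<Omega> ?G" by (simp add: sg)
  have st: "Int_stable ?G"
    unfolding Int_stable_def using sector_disjoint_or_sub by fastforce
  have sub: "?G \<subseteq> Pow \<Omega>" using sector_subset by auto
  show "(\<integral>x. indicator A x * f x \<partial>\<nu>) = 0"
    using st sub A
  proof (induction rule: sigma_sets_induct_disjoint)
    case (basic A)
    then show ?case using 0 by (auto simp: sector_int_def)
  next
    case empty
    show ?case by simp
  next
    case (compl A)
    have "(\<integral>x. indicator (\<Omega> - A) x * f x \<partial>\<nu>) = (\<integral>x. f x - indicator A x * f x \<partial>\<nu>)"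
      by (rule Bochner_Integration.integral_cong[OF refl]) (auto simp: space_\<nu> indicator_def)
    also have "\<dots> = 0" using i[of A] compl f tot by (simp add: sg)
    finally show ?case .
  next
    case (union A)
    have ms: "\<And>i. A i \<in> sets \<nu>" using union(2) by (auto simp: sg)
    have c: "(\<integral>x. indicator B x * f x \<partial>\<nu>) = (LINT x:B|\<nu>. f x)" for B
      unfolding set_lebesgue_integral_def
      by (intro Bochner_Integration.integral_cong refl) (simp add: indicator_def)
    have "set_integrable \<nu> (\<Union>i. A i) f"
      unfolding set_integrable_def using ms f by (intro integrable_mult_indicator) auto
    then have "(LINT x:(\<Union>i. A i)|\<nu>. f x) = (\<Sum>i. LINT x:A i|\<nu>. f x)"
      using union(1) ms by (intro lebesgue_integral_countable_add) (auto simp: disjoint_family_on_def)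
    then show ?case using union(3) unfolding c by simp
  qed
qed

end

section \<open>Poisson representation of eigenfunctions\<close>

context rooted_tree
begin

lemma pois_step_factor: "pois_step s n = qpow (s * of_nat n) * (1 - qpow (- (2 * s)))"
proof -
  have "s * (of_nat n - 2) = s * of_nat n + - (2 * s)" by (simp add: algebra_simps)
  then show ?thesis by (simp only: qpow_add right_diff_distrib mult_1_right)
qed

lemma pois_step_lower:
  assumes "Re s > 0"
  shows "1 - real q powr (- (2 * Re s)) > 0"
    and "norm (pois_step s n) \<ge> real q powr (Re s * real n) * (1 - real q powr (- (2 * Re s)))"
proof -
  have "real q powr (- (2 * Re s)) < real q powr 0"
    using assms q_ge_2 by (intro powr_less_mono) auto
  then show pos: "1 - real q powr (- (2 * Re s)) > 0" using q_pos by simp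
  have "1 - real q powr (- (2 * Re s)) \<le> norm (1 - qpow (- (2 * s)))"
    using norm_triangle_ineq2[of 1 "qpow (- (2 * s))"] by (simp add: norm_qpow)
  then have "real q powr (Re s * real n) * (1 - real q powr (- (2 * Re s))) \<le> norm (qpow (s * of_nat n)) * norm (1 - qpow (- (2 * s)))"
    using pos by (intro mult_mono) (simp_all add: norm_qpow)
  then show "norm (pois_step s n) \<ge> real q powr (Re s * real n) * (1 - real q powr (- (2 * Re s)))"
    unfolding pois_step_factor norm_mult .
qed

lemma pois_step_nz: "Re s > 0 \<Longrightarrow> pois_step s n \<noteq> 0"
proof -
  assume s: "Re s > 0"
  have "0 < real q powr (Re s * real n) * (1 - real q powr (- (2 * Re s)))"
    using pois_step_lower(1)[OF s] q_pos by simp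
  then have "norm (pois_step s n) > 0" using pois_step_lower(2)[OF s, of n] by linarith
  then show "pois_step s n \<noteq> 0" unfolding zero_less_norm_iff .
qed

text \<open>
  The recursion \<open>pois_rec\<close> solved for the integral over a sector.
\<close>

definition sector_mass :: "complex \<Rightarrow> ('a \<Rightarrow> complex) \<Rightarrow> 'a \<Rightarrow> complex" where
  "sector_mass s u x = (if x = x0 then u x0 else (u x - qpow (- s) * u (parent x)) / pois_step s (level x))"

text \<open>
  The eigenvalue equation expresses the sum of \<open>u\<close> over the children through \<open>u x\<close> and
  \<open>u (parent x)\<close>, and the eigenvalue is the one for which the masses of the children add up.
\<close>

lemma child_additive_sector_mass:
  assumes s: "Re s > 0" and eig: "\<And>x. nbr_sum u x = (qpow s + qpow (1 - s)) * u x"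
  shows "child_additive (sector_mass s u)"
  unfolding child_additive_def
proof
  fix x
  have "(\<Sum>y\<in>children x. sector_mass s u y) = (\<Sum>y\<in>children x. (u y - qpow (- s) * u x) / pois_step s (Suc (level x)))"
    by (intro sum.cong refl) (auto simp: sector_mass_def children_iff level_child[symmetric])
  also have "\<dots> = ((\<Sum>y\<in>children x. u y) - of_nat (card (children x)) * (qpow (- s) * u x)) / pois_step s (Suc (level x))"
    by (simp only: sum_divide_distrib[symmetric] sum_subtractf sum_constant)
  also have "(\<Sum>y\<in>children x. u y) = (qpow s + of_nat q * qpow (- s)) * u x - (if x = x0 then 0 else u (parent x))"
    using nbr_sum_split[of u x] eig[of x] by (simp add: q_qpow)
  also have "((qpow s + of_nat q * qpow (- s)) * u x - (if x = x0 then 0 else u (parent x))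
      - of_nat (card (children x)) * (qpow (- s) * u x)) = pois_step s (Suc (level x)) * sector_mass s u x"
  proof (cases "x = x0")
    case True
    have "pois_step s (Suc 0) = qpow s - qpow (- s)"
    proof -
      have "s * of_nat (Suc 0) = s" "s * (of_nat (Suc 0) - 2) = - s" by (simp_all add: algebra_simps)
      then show ?thesis by (simp only:)
    qed
    then show ?thesis unfolding True gdist_refl by (simp add: card_children sector_mass_def algebra_simps)
  next
    case False
    have "pois_step s (Suc (level x)) * sector_mass s u x = qpow s * (pois_step s (level x) * sector_mass s u x)"
      unfolding pois_step_Suc by (simp only: mult.assoc)
    also have "pois_step s (level x) * sector_mass s u x = u x - qpow (- s) * u (parent x)"
      unfolding sector_mass_def if_not_P[OF False] times_divide_eq_right
      by (rule nonzero_mult_div_cancel_left[OF pois_step_nz[OF s]])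
    also have "qpow s * (u x - qpow (- s) * u (parent x)) = qpow s * u x - (qpow s * qpow (- s)) * u (parent x)"
      by (simp only: right_diff_distrib mult.assoc)
    finally show ?thesis using False by (simp add: card_children qpow_inv algebra_simps)
  qed
  also have "pois_step s (Suc (level x)) * sector_mass s u x / pois_step s (Suc (level x)) = sector_mass s u x"
    by (rule nonzero_mult_div_cancel_left[OF pois_step_nz[OF s]])
  finally show "sector_mass s u x = (\<Sum>y\<in>children x. sector_mass s u y)" by (rule sym)
qed

lemma pois_of_sector_mass:
  assumes s: "Re s > 0" and F: "integrable \<nu> F" and m: "\<And>x. sector_int F x = sector_mass s u x"
  shows "pois s F x = u x"
proof (induction x rule: level_induct)
  case root
  show ?case using m[of x0] by (simp add: pois_root sector_int_root sector_mass_def)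
next
  case (child x)
  have "pois_step s (level x) * sector_mass s u x = u x - qpow (- s) * u (parent x)"
    unfolding sector_mass_def if_not_P[OF child(1)] times_divide_eq_right by (rule nonzero_mult_div_cancel_left[OF pois_step_nz[OF s]])
  then show ?case unfolding pois_rec[OF F child(1)] child(2) m by simp
qed

lemma sector_int_from_pois:
  assumes s: "Re s > 0" and F: "integrable \<nu> F"
  shows "sector_int F x = sector_mass s (pois s F) x"
proof (cases "x = x0")
  case True
  then show ?thesis by (simp add: pois_root sector_int_root sector_mass_def)
next
  case False
  have "pois s F x - qpow (- s) * pois s F (parent x) = pois_step s (level x) * sector_int F x"
    using pois_rec[OF F False, of s] by (simp only: add_diff_cancel_left')
  then show ?thesis unfolding sector_mass_def if_not_P[OF False]
    by (simp only: nonzero_mult_div_cancel_left[OF pois_step_nz[OF s]])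
qed

text \<open>
  Both functions have the same integrals over sectors, by \<open>sector_int_from_pois\<close>.
\<close>

lemma pois_injective:
  assumes s: "Re s > 0" and FG: "integrable \<nu> F" "integrable \<nu> G" and eq: "pois s F = pois s G"
  shows "AE \<omega> in \<nu>. G \<omega> = F \<omega>"
proof -
  have "sector_int (\<lambda>\<omega>. G \<omega> - F \<omega>) x = 0" for x
  proof -
    have "sector_int (\<lambda>\<omega>. G \<omega> - F \<omega>) x = sector_int G x - sector_int F x"
      unfolding sector_int_def right_diff_distrib
      by (rule Bochner_Integration.integral_diff[OF sector_integrable[OF FG(2)] sector_integrable[OF FG(1)]])
    then show ?thesis unfolding sector_int_from_pois[OF s FG(1)] sector_int_from_pois[OF s FG(2)] eq by simp
  qed
  from AE_zero_of_sector_int_zero[OF Bochner_Integration.integrable_diff[OF FG(2,1)] this] show ?thesis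
    by eventually_elim simp
qed

definition abs_dens :: "complex \<Rightarrow> ('a \<Rightarrow> complex) \<Rightarrow> 'a \<Rightarrow> real" where
  "abs_dens s u x = norm (sector_mass s u x) / sector_prob (level x)"

lemma norm_level_dens: "\<omega> \<in> \<Omega> \<Longrightarrow> norm (level_dens (sector_mass s u) n \<omega>) = abs_dens s u (\<omega> n)"
  using sector_prob_pos[of n] by (simp add: level_dens_def abs_dens_def norm_divide ray_level)

lemma integral_level_dens_powr:
  shows "integrable \<nu> (\<lambda>\<omega>. norm (level_dens (sector_mass s u) n \<omega>) powr R)"
    and "(\<integral>\<omega>. norm (level_dens (sector_mass s u) n \<omega>) powr R \<partial>\<nu>) = (\<Sum>x\<in>sphere n. sector_prob n * abs_dens s u x powr R)"
proof -
  note l = integral_level[of "\<lambda>x. abs_dens s u x powr R" n]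
  show "integrable \<nu> (\<lambda>\<omega>. norm (level_dens (sector_mass s u) n \<omega>) powr R)"
    by (rule Bochner_Integration.integrable_cong[OF refl, THEN iffD1, OF _ l(1)]) (simp add: norm_level_dens space_\<nu>)
  show "(\<integral>\<omega>. norm (level_dens (sector_mass s u) n \<omega>) powr R \<partial>\<nu>) = (\<Sum>x\<in>sphere n. sector_prob n * abs_dens s u x powr R)"
    unfolding l(2)[symmetric] by (rule Bochner_Integration.integral_cong[OF refl]) (simp add: norm_level_dens space_\<nu>)
qed

lemma abs_dens_le_mean:
  assumes ad: "child_additive (sector_mass s u)" and R: "R \<ge> 1"
  shows "sector_prob (level x) * abs_dens s u x powr R \<le> (\<Sum>y\<in>children x. sector_prob (Suc (level x)) * abs_dens s u y powr R)"
proof -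
  let ?c = "real (card (children x))" and ?r = "sector_prob (Suc (level x))"
  have c: "?c > 0" using card_children_pos by simp
  have ne: "children x \<noteq> {}" using card_children_pos[of x] by auto
  have "norm (sector_mass s u x) \<le> (\<Sum>y\<in>children x. norm (sector_mass s u y))"
    using ad unfolding child_additive_def by (metis norm_sum)
  then have "abs_dens s u x \<le> (\<Sum>y\<in>children x. norm (sector_mass s u y)) / sector_prob (level x)"
    unfolding abs_dens_def using sector_prob_pos by (intro divide_right_mono) (auto intro: less_imp_le)
  also have "\<dots> = (\<Sum>y\<in>children x. abs_dens s u y) / ?c"
    unfolding sector_prob_Suc by (simp add: abs_dens_def level_child sum_divide_distrib mult.commute)
  finally have "abs_dens s u x powr R \<le> ((\<Sum>y\<in>children x. abs_dens s u y) / ?c) powr R"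
    using R sector_prob_pos by (intro powr_mono2) (auto simp: abs_dens_def intro!: divide_nonneg_nonneg less_imp_le[OF sector_prob_pos])
  also have "\<dots> \<le> (\<Sum>y\<in>children x. abs_dens s u y powr R) / ?c"
    by (rule powr_mean_le[OF finite_children ne _ R]) (auto simp: abs_dens_def intro!: divide_nonneg_nonneg less_imp_le[OF sector_prob_pos])
  finally have "sector_prob (level x) * abs_dens s u x powr R \<le> sector_prob (level x) * ((\<Sum>y\<in>children x. abs_dens s u y powr R) / ?c)"
    using sector_prob_pos by (intro mult_left_mono) (auto intro: less_imp_le)
  also have "\<dots> = (\<Sum>y\<in>children x. ?r * abs_dens s u y powr R)"
  proof -
    have "sector_prob (level x) * ((\<Sum>y\<in>children x. abs_dens s u y powr R) / ?c) = ?r * (\<Sum>y\<in>children x. abs_dens s u y powr R)"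
      unfolding sector_prob_Suc using c by simp
    then show ?thesis by (simp only: sum_distrib_left)
  qed
  finally show ?thesis .
qed

lemma sphere_abs_dens_mono:
  assumes ad: "child_additive (sector_mass s u)" and R: "R \<ge> 1"
  shows "incseq (\<lambda>n. \<Sum>x\<in>sphere n. sector_prob n * abs_dens s u x powr R)"
proof (rule incseq_SucI)
  fix n
  have "(\<Sum>x\<in>sphere n. sector_prob n * abs_dens s u x powr R) \<le> (\<Sum>x\<in>sphere n. \<Sum>y\<in>children x. sector_prob (Suc n) * abs_dens s u y powr R)"
    by (rule sum_mono) (use abs_dens_le_mean[OF ad R] in \<open>auto simp: sphere_def\<close>)
  then show "(\<Sum>x\<in>sphere n. sector_prob n * abs_dens s u x powr R) \<le> (\<Sum>x\<in>sphere (Suc n). sector_prob (Suc n) * abs_dens s u x powr R)"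
    unfolding sum_sphere_Suc .
qed

text \<open>
  A sector of level \<open>n\<close> has measure about \<open>q powr (- n)\<close>, while the kernel has size \<open>q powr (n / p)\<close> on it.
\<close>

lemma abs_dens_bound:
  assumes p: "1 \<le> p" and s: "Re s = 1 / p"
  obtains K where "K > 0"
    "\<And>u x. x \<noteq> x0 \<Longrightarrow> abs_dens s u x \<le> K * real q powr (real (level x) * (1 - 1 / p)) * (norm (u x) + norm (u (parent x)))"
proof -
  have s0: "Re s > 0" using p s by simp
  define c0 where "c0 = 1 - real q powr (- (2 * Re s))"
  have c0: "c0 > 0" unfolding c0_def by (rule pois_step_lower(1)[OF s0])
  have main: "abs_dens s u x \<le> (2 / c0) * real q powr (real (level x) * (1 - 1 / p)) * (norm (u x) + norm (u (parent x)))"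
    if x: "x \<noteq> x0" for u x
  proof -
    let ?n = "level x"
    obtain m where n: "?n = Suc m" using level_parent[OF x] by (metis Suc_eq_plus1)
    let ?U = "norm (u x) + norm (u (parent x))"
    have "norm (u x - qpow (- s) * u (parent x)) \<le> ?U"
    proof -
      have "real q powr (- Re s) \<le> real q powr 0" using s0 q_ge_1 by (intro powr_mono) auto
      then have "norm (qpow (- s)) \<le> 1" using q_pos by (simp add: norm_qpow)
      then have "norm (qpow (- s) * u (parent x)) \<le> norm (u (parent x))"
        unfolding norm_mult by (rule mult_left_le_one_le[OF norm_ge_zero norm_ge_zero])
      then show ?thesis using norm_triangle_ineq4[of "u x" "qpow (- s) * u (parent x)"] by linarith
    qed
    then have "norm (sector_mass s u x) \<le> ?U / norm (pois_step s ?n)"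
      unfolding sector_mass_def if_not_P[OF x] norm_divide by (rule divide_right_mono) simp
    also have "\<dots> \<le> ?U / (real q powr (Re s * real ?n) * c0)"
    proof (rule divide_left_mono)
      show "real q powr (Re s * real ?n) * c0 \<le> norm (pois_step s ?n)"
        using pois_step_lower(2)[OF s0, of ?n] unfolding c0_def .
      have "norm (pois_step s ?n) > 0" using pois_step_nz[OF s0, of ?n] unfolding zero_less_norm_iff .
      moreover have "real q powr (Re s * real ?n) * c0 > 0" using c0 q_pos by (intro mult_pos_pos) simp_all
      ultimately show "norm (pois_step s ?n) * (real q powr (Re s * real ?n) * c0) > 0" by (rule mult_pos_pos)
    qed simp
    finally have a: "norm (sector_mass s u x) \<le> ?U / (real q powr (Re s * real ?n) * c0)" .
    have "1 / sector_prob ?n = (real q + 1) * real q ^ m" unfolding n by (simp add: sector_prob_def)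
    also have "\<dots> \<le> (2 * real q) * real q ^ m" using q_ge_1 by (intro mult_right_mono) auto
    also have "\<dots> = 2 * real q powr (real ?n)" unfolding n using q_pos by (simp add: powr_realpow powr_add mult.commute)
    finally have b: "1 / sector_prob ?n \<le> 2 * real q powr (real ?n)" .
    have "abs_dens s u x = norm (sector_mass s u x) * (1 / sector_prob ?n)" by (simp add: abs_dens_def)
    also have "\<dots> \<le> (?U / (real q powr (Re s * real ?n) * c0)) * (2 * real q powr (real ?n))"
      using sector_prob_pos[of ?n] c0 by (intro mult_mono a b) auto
    also have "\<dots> = (2 / c0) * (real q powr (real ?n) / real q powr (Re s * real ?n)) * ?U" by (simp add: mult_ac)
    also have "real q powr (real ?n) / real q powr (Re s * real ?n) = real q powr (real ?n * (1 - 1 / p))"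
      unfolding powr_diff[symmetric] s by (simp add: algebra_simps)
    finally show ?thesis .
  qed
  show ?thesis by (rule that[OF _ main]) (use c0 in auto)
qed

lemma card_ball_le: "real (card {x. level x \<le> N}) \<le> real q ^ (N + 3)"
proof -
  have "{x. level x \<le> N} \<subseteq> parity_ball x0 N \<union> parity_ball x0 (Suc N)" by (auto simp: parity_ball_def)
  then have "card {x. level x \<le> N} \<le> card (parity_ball x0 N) + card (parity_ball x0 (Suc N))"
    by (meson card_Un_le card_mono finite_Un finite_parity_ball order_trans)
  then have "real (card {x. level x \<le> N}) \<le> real (card (parity_ball x0 N)) + real (card (parity_ball x0 (Suc N)))" by linarith
  also have "\<dots> \<le> 2 * real q ^ N + 2 * real q ^ Suc N" by (intro add_mono card_parity_ball_le)
  also have "\<dots> \<le> 2 * real q ^ Suc N + 2 * real q ^ Suc N"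
    using q_ge_1 power_increasing[of N "Suc N" "real q"] by simp
  also have "\<dots> = (2 * 2) * real q ^ Suc N" by simp
  also have "\<dots> \<le> (real q * real q) * real q ^ Suc N" using q_ge_2 by (intro mult_right_mono mult_mono) auto
  finally show ?thesis by (simp add: power_add eval_nat_numeral mult_ac)
qed

text \<open>
  With \<open>\<sigma> n\<close> the sum of \<open>|u| powr R\<close> over the sphere of radius \<open>n\<close>, the \<open>R\<close>-th moment of the density
  at level \<open>n\<close> is at most a constant times \<open>\<sigma> n + \<sigma> (n - 1)\<close>. The rearrangement estimate gives a
  harmonic sum for the total of \<open>\<sigma>\<close> up to level \<open>N\<close>, hence a bound linear in \<open>N\<close>; monotonicity of the
  moments turns this bound on averages into a uniform one.
\<close>

lemma sphere_abs_dens_bounded: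
  assumes p: "1 < p" "p < 2" "M > 0" and s: "Re s = 1 / p"
    and weak: "weak_norm (conj_exponent p) u \<le> ennreal M"
    and ad: "child_additive (sector_mass s u)" and R: "R = p / (p - 1)"
  shows "\<exists>B. \<forall>n. (\<Sum>x\<in>sphere n. sector_prob n * abs_dens s u x powr R) \<le> B"
proof -
  have R1: "R > 2" unfolding R using p by (simp add: field_simps)
  have pR: "1 - 1 / p = 1 / R" unfolding R using p by (simp add: field_simps)
  obtain K where K: "K > 0"
    "\<And>u x. x \<noteq> x0 \<Longrightarrow> abs_dens s u x \<le> K * real q powr (real (level x) * (1 - 1 / p)) * (norm (u x) + norm (u (parent x)))"
    using abs_dens_bound[of p s] p s by (metis less_imp_le)
  define b where "b n = (\<Sum>x\<in>sphere n. sector_prob n * abs_dens s u x powr R)" for n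
  define \<sigma> where "\<sigma> n = (\<Sum>x\<in>sphere n. norm (u x) powr R)" for n
  define K' where "K' = (2 * K) powr R"
  have sb: "sector_prob (level x) * abs_dens s u x powr R \<le> K' * (norm (u x) powr R + norm (u (parent x)) powr R)" if x: "x \<noteq> x0" for x
  proof -
    let ?n = "level x"
    let ?m = "max (norm (u x)) (norm (u (parent x)))"
    have "abs_dens s u x \<le> K * real q powr (real ?n / R) * (norm (u x) + norm (u (parent x)))"
      using K(2)[OF x, of u] unfolding pR by simp
    also have "\<dots> \<le> K * real q powr (real ?n / R) * (2 * ?m)" using K(1) by (intro mult_left_mono) auto
    finally have "abs_dens s u x powr R \<le> (K * real q powr (real ?n / R) * (2 * ?m)) powr R"
      using R1 by (intro powr_mono2) (auto simp: abs_dens_def intro!: divide_nonneg_nonneg less_imp_le[OF sector_prob_pos])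
    also have "\<dots> = K' * real q ^ ?n * ?m powr R"
    proof -
      have "K * real q powr (real ?n / R) * (2 * ?m) = (2 * K) * real q powr (real ?n / R) * ?m" by simp
      also have "\<dots> powr R = K' * (real q powr (real ?n / R)) powr R * ?m powr R"
        unfolding K'_def by (simp add: powr_mult K(1) less_imp_le)
      also have "(real q powr (real ?n / R)) powr R = real q ^ ?n" using R1 q_pos by (simp add: powr_powr powr_realpow)
      finally show ?thesis .
    qed
    finally have 1: "abs_dens s u x powr R \<le> K' * real q ^ ?n * ?m powr R" .
    obtain m where n: "?n = Suc m" using level_parent[OF x] by (metis Suc_eq_plus1)
    have 2: "sector_prob ?n * real q ^ ?n \<le> 1"
    proof -
      have "sector_prob ?n * real q ^ ?n = (real q * real q ^ m) / ((real q + 1) * real q ^ m)"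
        unfolding n by (simp add: sector_prob_def add.commute)
      also have "\<dots> \<le> 1"
        using q_pos by (subst divide_le_eq_1_pos) (simp_all add: distrib_right add_pos_pos)
      finally show ?thesis .
    qed
    have "sector_prob ?n * abs_dens s u x powr R \<le> sector_prob ?n * (K' * real q ^ ?n * ?m powr R)"
      using 1 sector_prob_pos by (intro mult_left_mono) (auto intro: less_imp_le)
    also have "\<dots> = (sector_prob ?n * real q ^ ?n) * (K' * ?m powr R)" by simp
    also have "\<dots> \<le> 1 * (K' * ?m powr R)" using 2 by (intro mult_right_mono) (auto simp: K'_def)
    also have "?m powr R \<le> norm (u x) powr R + norm (u (parent x)) powr R" by (simp add: max_def)
    finally show ?thesis by (simp add: K'_def mult_left_mono)
  qed
  have bS: "b (Suc n) \<le> K' * (\<sigma> (Suc n) + (real q + 1) * \<sigma> n)" for n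
  proof -
    have "b (Suc n) \<le> (\<Sum>x\<in>sphere (Suc n). K' * (norm (u x) powr R + norm (u (parent x)) powr R))"
      unfolding b_def
    proof (rule sum_mono)
      fix x assume x: "x \<in> sphere (Suc n)"
      then have "level x = Suc n" by (simp add: sphere_def)
      moreover from this have "x \<noteq> x0" by auto
      ultimately show "sector_prob (Suc n) * abs_dens s u x powr R \<le> K' * (norm (u x) powr R + norm (u (parent x)) powr R)"
        using sb[of x] by simp
    qed
    also have "\<dots> = K' * (\<sigma> (Suc n) + (\<Sum>x\<in>sphere (Suc n). norm (u (parent x)) powr R))"
      by (simp add: \<sigma>_def sum.distrib sum_distrib_left[symmetric])
    also have "(\<Sum>x\<in>sphere (Suc n). norm (u (parent x)) powr R) = (\<Sum>x\<in>sphere n. real (card (children x)) * norm (u x) powr R)"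
      unfolding sum_sphere_Suc by (simp add: children_iff)
    also have "\<dots> \<le> (real q + 1) * \<sigma> n"
      unfolding \<sigma>_def sum_distrib_left by (intro sum_mono mult_right_mono) (auto simp: card_children)
    finally show ?thesis by (simp add: K'_def mult_left_mono)
  qed
  define lq where "lq = ln (real q)"
  have lq: "lq > 0" unfolding lq_def using q_ge_2 by simp
  \<comment> \<open>Rearrangement over the ball of radius \<open>N\<close>: the \<open>R\<close>-th powers are at most those of \<open>M k powr (- 1 / R)\<close>.\<close>
  have sig: "(\<Sum>n\<le>N. \<sigma> n) \<le> M powr R * (1 + real (N + 3) * lq)" for N
  proof -
    let ?E = "{x. level x \<le> N}"
    have fE: "finite ?E" by (rule finite_ball)
    have E: "?E = (\<Union>n\<in>{..N}. sphere n)" by (auto simp: sphere_def)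
    have "(\<Sum>n\<le>N. \<sigma> n) = (\<Sum>x\<in>?E. norm (u x) powr R)"
      unfolding E \<sigma>_def by (rule sum.UNION_disjoint[symmetric]) (simp, simp, auto simp: sphere_def)
    also have "\<dots> \<le> (\<Sum>k=1..card ?E. (M * real k powr - (1 - 1 / p)) powr R)"
      by (rule weak_norm_rearrangement[OF _ p(2,3) weak fE, where \<psi> = "\<lambda>t. t powr R"])
        (use p R1 in \<open>auto intro: powr_mono2\<close>)
    also have "\<dots> = (\<Sum>k=1..card ?E. M powr R * (1 / real k))"
    proof (rule sum.cong[OF refl])
      fix k assume k: "k \<in> {1..card ?E}"
      have "(M * real k powr - (1 - 1 / p)) powr R = M powr R * (real k powr - (1 / R)) powr R"
        unfolding pR using p(3) by (simp add: powr_mult)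
      also have "(real k powr - (1 / R)) powr R = 1 / real k"
        unfolding powr_powr using k R1 by (simp add: powr_minus_divide)
      finally show "(M * real k powr - (1 - 1 / p)) powr R = M powr R * (1 / real k)" .
    qed
    also have "\<dots> = M powr R * (\<Sum>k=1..card ?E. 1 / real k)" by (simp add: sum_distrib_left)
    also have "\<dots> \<le> M powr R * (1 + real (N + 3) * lq)"
    proof (rule mult_left_mono)
      have "x0 \<in> ?E" by simp
      then have c1: "card ?E \<ge> 1" using fE by (metis card_gt_0_iff empty_iff One_nat_def Suc_leI)
      have "(\<Sum>k=1..card ?E. 1 / real k) \<le> 1 + ln (real (card ?E))" by (rule harmonic_le_ln[OF c1])
      also have "ln (real (card ?E)) \<le> ln (real q ^ (N + 3))"
        using c1 card_ball_le[of N] q_pos by (subst ln_le_cancel_iff) auto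
      also have "\<dots> = real (N + 3) * lq" unfolding lq_def using q_pos by (simp add: ln_realpow)
      finally show "(\<Sum>k=1..card ?E. 1 / real k) \<le> 1 + real (N + 3) * lq" by simp
    qed simp
    finally show ?thesis .
  qed
  have sig0: "\<sigma> n \<ge> 0" for n unfolding \<sigma>_def by (intro sum_nonneg) simp
  have b0: "b n \<ge> 0" for n unfolding b_def by (intro sum_nonneg mult_nonneg_nonneg less_imp_le[OF sector_prob_pos]) simp
  have inc: "incseq b" unfolding b_def[abs_def] by (rule sphere_abs_dens_mono[OF ad]) (use R1 in simp)
  define Q where "Q = K' * (real q + 2) * M powr R"
  have Q0: "Q \<ge> 0" by (simp add: Q_def K'_def)
  have ball_sum: "(\<Sum>n<N. b (Suc n)) \<le> Q * (1 + real (N + 3) * lq)" for N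
  proof -
    have "(\<Sum>n<N. b (Suc n)) \<le> (\<Sum>n<N. K' * (\<sigma> (Suc n) + (real q + 1) * \<sigma> n))" by (intro sum_mono bS)
    also have "\<dots> = K' * ((\<Sum>n<N. \<sigma> (Suc n)) + (real q + 1) * (\<Sum>n<N. \<sigma> n))"
      by (simp only: sum_distrib_left[symmetric] sum.distrib)
    also have "\<dots> \<le> K' * ((\<Sum>n\<le>N. \<sigma> n) + (real q + 1) * (\<Sum>n\<le>N. \<sigma> n))"
    proof (intro mult_left_mono add_mono)
      show "(\<Sum>n<N. \<sigma> (Suc n)) \<le> (\<Sum>n\<le>N. \<sigma> n)" unfolding lessThan_Suc_atMost[symmetric] sum.lessThan_Suc_shift using sig0[of 0] by simp
      show "(\<Sum>n<N. \<sigma> n) \<le> (\<Sum>n\<le>N. \<sigma> n)" by (intro sum_mono2) (auto simp: sig0)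
    qed (auto simp: K'_def)
    also have "\<dots> = K' * (real q + 2) * (\<Sum>n\<le>N. \<sigma> n)" by (simp add: algebra_simps)
    also have "\<dots> \<le> K' * (real q + 2) * (M powr R * (1 + real (N + 3) * lq))"
      by (intro mult_left_mono sig) (simp add: K'_def)
    finally show ?thesis by (simp add: Q_def mult_ac)
  qed
  have "b n \<le> Q * (1 + 4 * lq)" for n
  proof -
    \<comment> \<open>The moments increase, so the one at level \<open>n\<close> is at most the average of the next \<open>n + 1\<close>.\<close>
    have "real (Suc n) * b n = (\<Sum>i\<in>{n..<Suc (2 * n)}. b n)" by simp
    also have "\<dots> \<le> (\<Sum>i\<in>{n..<Suc (2 * n)}. b (Suc i))"
      by (intro sum_mono incseqD[OF inc]) auto
    also have "\<dots> \<le> (\<Sum>i<Suc (2 * n). b (Suc i))" by (intro sum_mono2) (auto simp: b0)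
    also have "\<dots> \<le> Q * (1 + real (Suc (2 * n) + 3) * lq)" by (rule ball_sum)
    also have "\<dots> \<le> Q * (real (Suc n) * (1 + 4 * lq))"
    proof (intro mult_left_mono Q0)
      have "real (Suc (2 * n) + 3) * lq \<le> (real (Suc n) * 4) * lq" using lq by (intro mult_right_mono) auto
      moreover have "1 \<le> real (Suc n)" by simp
      moreover have "real (Suc n) * (1 + 4 * lq) = real (Suc n) + (real (Suc n) * 4) * lq"
        by (simp only: distrib_left mult_1_right mult.assoc)
      ultimately show "1 + real (Suc (2 * n) + 3) * lq \<le> real (Suc n) * (1 + 4 * lq)" by linarith
    qed
    finally have "real (Suc n) * b n \<le> real (Suc n) * (Q * (1 + 4 * lq))" by (simp only: mult.left_commute)
    then show ?thesis by (rule mult_left_le_imp_le) simp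
  qed
  then show ?thesis unfolding b_def by blast
qed

lemma boundary_Lp_integrable:
  assumes p: "1 \<le> p" "p < 2" and F: "F \<in> boundary_Lp adj q x0 (conj_exponent p)"
  shows "integrable \<nu> F"
proof (cases "p = 1")
  case True
  then obtain C where m: "F \<in> borel_measurable \<nu>" "AE \<omega> in \<nu>. norm (F \<omega>) \<le> C"
    using F by (auto simp: boundary_Lp_def conj_exponent_def)
  then show ?thesis by (intro \<nu>.integrable_const_bound)
next
  case False
  define R where "R = p / (p - 1)"
  have R: "R > 2" using p False by (simp add: R_def field_simps)
  have m: "F \<in> borel_measurable \<nu>" "integrable \<nu> (\<lambda>\<omega>. norm (F \<omega>) powr R)"
    using F False R by (auto simp: boundary_Lp_def conj_exponent_def R_def[symmetric])
  have le: "t \<le> 1 + t powr R" if "t \<ge> 0" for t :: real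
  proof (cases "t \<le> 1")
    case False
    then have "t powr 1 \<le> t powr R" using R by (intro powr_mono) auto
    then show ?thesis using False by simp
  qed (use that in \<open>simp add: add_increasing2\<close>)
  show ?thesis
    by (rule Bochner_Integration.integrable_bound[OF Bochner_Integration.integrable_add[OF \<nu>.integrable_const[of 1] m(2)] m(1)])
      (use le in \<open>auto intro!: AE_I2 simp: abs_of_nonneg\<close>)
qed

text \<open>
  The limit of the densities has the right integrals over sectors and hence the right Poisson
  transform. Its integrability follows from that of the densities, by pointwise convergence if
  \<open>p = 1\<close> and by Fatou's lemma otherwise.
\<close>

theorem poisson_representation:
  assumes p: "1 \<le> p" "p < 2" "M > 0" and s: "Re s = 1 / p"
    and weak: "weak_norm (conj_exponent p) u \<le> ennreal M"
    and eig: "\<And>x. nbr_sum u x = (qpow s + qpow (1 - s)) * u x"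
  obtains F where "F \<in> boundary_Lp adj q x0 (conj_exponent p)" "pois s F = u"
proof -
  have s0: "Re s > 0" using p s by simp
  have ad: "child_additive (sector_mass s u)" by (rule child_additive_sector_mass[OF s0 eig])
  let ?D = "level_dens (sector_mass s u)"
  have [measurable]: "?D n \<in> borel_measurable \<nu>" for n using level_dens_integrable by auto
  have p2: "(norm (?D n \<omega>))\<^sup>2 = norm (?D n \<omega>) powr 2" for n \<omega>
    by (cases "?D n \<omega> = 0") (simp_all add: powr_numeral)
  show ?thesis
  proof (cases "p = 1")
    case True
    obtain K where K: "K > 0"
      "\<And>u x. x \<noteq> x0 \<Longrightarrow> abs_dens s u x \<le> K * real q powr (real (level x) * (1 - 1 / p)) * (norm (u x) + norm (u (parent x)))"
      using abs_dens_bound[OF p(1) s] by metis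
    have uM: "norm (u x) \<le> M" for x by (rule weak_norm_bounded[OF p weak])
    define C where "C = max M (K * (M + M))"
    have aC: "abs_dens s u x \<le> C" for x
    proof (cases "x = x0")
      case True
      then show ?thesis using uM[of x0] by (simp add: abs_dens_def sector_mass_def sector_prob_def C_def)
    next
      case False
      have "abs_dens s u x \<le> K * (norm (u x) + norm (u (parent x)))"
        using K(2)[OF False, of u] \<open>p = 1\<close> q_pos by simp
      also have "\<dots> \<le> K * (M + M)" using K(1) by (intro mult_left_mono add_mono uM) auto
      finally show ?thesis by (simp add: C_def)
    qed
    have DC: "norm (?D n \<omega>) \<le> C" if "\<omega> \<in> \<Omega>" for n \<omega> using norm_level_dens[OF that] aC by simp
    have "(\<integral>\<omega>. (norm (?D n \<omega>))\<^sup>2 \<partial>\<nu>) \<le> C\<^sup>2" for n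
    proof (rule \<nu>.integral_le_const)
      show "integrable \<nu> (\<lambda>\<omega>. (norm (?D n \<omega>))\<^sup>2)" unfolding p2 by (rule integral_level_dens_powr(1))
      show "AE \<omega> in \<nu>. (norm (?D n \<omega>))\<^sup>2 \<le> C\<^sup>2"
        using DC by (intro AE_I2 power_mono) (auto simp: space_\<nu>)
    qed
    from child_additive_L2_limit[OF ad this] obtain F r where F: "integrable \<nu> F" "strict_mono r"
      "AE \<omega> in \<nu>. (\<lambda>i. ?D (r i) \<omega>) \<longlonglongrightarrow> F \<omega>" "\<And>x. sector_int F x = sector_mass s u x" by blast
    have "AE \<omega> in \<nu>. norm (F \<omega>) \<le> C"
      using F(3) AE_space
    proof eventually_elim
      case (elim \<omega>)
      show ?case by (rule LIMSEQ_le_const2[OF tendsto_norm[OF elim(1)]]) (use DC elim(2) in \<open>auto simp: space_\<nu>\<close>)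
    qed
    then have "F \<in> boundary_Lp adj q x0 (conj_exponent p)"
      using F(1) True by (auto simp: boundary_Lp_def conj_exponent_def)
    moreover have "pois s F = u" using pois_of_sector_mass[OF s0 F(1,4)] by (simp add: fun_eq_iff)
    ultimately show ?thesis by (rule that)
  next
    case False
    define R where "R = p / (p - 1)"
    have R: "R > 2" using p False by (simp add: R_def field_simps)
    obtain B where B: "\<And>n. (\<integral>\<omega>. norm (?D n \<omega>) powr R \<partial>\<nu>) \<le> B"
      using sphere_abs_dens_bounded[OF _ p(2,3) s weak ad R_def] p(1) False unfolding integral_level_dens_powr(2) by auto
    have "(\<integral>\<omega>. (norm (?D n \<omega>))\<^sup>2 \<partial>\<nu>) \<le> 1 + B" for n
    proof -
      have le: "t powr 2 \<le> 1 + t powr R" if "t \<ge> 0" for t :: real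
      proof (cases "t \<le> 1")
        case True
        then have "t powr 2 \<le> 1" using that powr_mono2[of 2 t 1] by simp
        then show ?thesis by (simp add: add_increasing2)
      next
        case False
        then have "t powr 2 \<le> t powr R" using R by (intro powr_mono) auto
        then show ?thesis by simp
      qed
      have "(\<integral>\<omega>. (norm (?D n \<omega>))\<^sup>2 \<partial>\<nu>) \<le> (\<integral>\<omega>. 1 + norm (?D n \<omega>) powr R \<partial>\<nu>)"
        unfolding p2 by (intro integral_mono Bochner_Integration.integrable_add \<nu>.integrable_const integral_level_dens_powr(1) le) simp
      also have "\<dots> = 1 + (\<integral>\<omega>. norm (?D n \<omega>) powr R \<partial>\<nu>)"
        by (subst Bochner_Integration.integral_add[OF \<nu>.integrable_const integral_level_dens_powr(1)]) (simp add: \<nu>.prob_space)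
      finally show ?thesis using B[of n] by linarith
    qed
    from child_additive_L2_limit[OF ad this] obtain F r where F: "integrable \<nu> F" "strict_mono r"
      "AE \<omega> in \<nu>. (\<lambda>i. ?D (r i) \<omega>) \<longlonglongrightarrow> F \<omega>" "\<And>x. sector_int F x = sector_mass s u x" by blast
    have [measurable]: "F \<in> borel_measurable \<nu>" using F(1) by auto
    have "(\<integral>\<^sup>+\<omega>. ennreal (norm (F \<omega>) powr R) \<partial>\<nu>) = (\<integral>\<^sup>+\<omega>. liminf (\<lambda>i. ennreal (norm (?D (r i) \<omega>) powr R)) \<partial>\<nu>)"
    proof (rule nn_integral_cong_AE)
      show "AE \<omega> in \<nu>. ennreal (norm (F \<omega>) powr R) = liminf (\<lambda>i. ennreal (norm (?D (r i) \<omega>) powr R))"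
        using F(3)
      proof eventually_elim
        case (elim \<omega>)
        have "(\<lambda>i. norm (?D (r i) \<omega>) powr R) \<longlonglongrightarrow> norm (F \<omega>) powr R"
          by (rule tendsto_powr'[OF tendsto_norm[OF elim] tendsto_const]) (use R in auto)
        then have "(\<lambda>i. ennreal (norm (?D (r i) \<omega>) powr R)) \<longlonglongrightarrow> ennreal (norm (F \<omega>) powr R)" by (rule tendsto_ennrealI)
        then show ?case by (rule lim_imp_Liminf[OF sequentially_bot, symmetric])
      qed
    qed
    also have "\<dots> \<le> liminf (\<lambda>i. \<integral>\<^sup>+\<omega>. ennreal (norm (?D (r i) \<omega>) powr R) \<partial>\<nu>)"
      by (rule nn_integral_liminf) measurable
    also have "\<dots> \<le> ennreal B"
    proof (rule Liminf_le[OF sequentially_bot], rule always_eventually, rule allI)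
      fix i
      have "(\<integral>\<^sup>+\<omega>. ennreal (norm (?D (r i) \<omega>) powr R) \<partial>\<nu>) = ennreal (\<integral>\<omega>. norm (?D (r i) \<omega>) powr R \<partial>\<nu>)"
        by (rule nn_integral_eq_integral[OF integral_level_dens_powr(1)]) simp
      then show "(\<integral>\<^sup>+\<omega>. ennreal (norm (?D (r i) \<omega>) powr R) \<partial>\<nu>) \<le> ennreal B" using B by (simp add: ennreal_leI)
    qed
    finally have "(\<integral>\<^sup>+\<omega>. ennreal (norm (norm (F \<omega>) powr R)) \<partial>\<nu>) < \<infinity>"
      by (simp add: le_less_trans[OF _ ennreal_less_top])
    then have "integrable \<nu> (\<lambda>\<omega>. norm (F \<omega>) powr R)" by (intro integrableI_bounded) auto
    then have "F \<in> boundary_Lp adj q x0 (conj_exponent p)"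
      using F(1) False R by (simp add: boundary_Lp_def conj_exponent_def R_def[symmetric])
    moreover have "pois s F = u" using pois_of_sector_mass[OF s0 F(1,4)] by (simp add: fun_eq_iff)
    ultimately show ?thesis by (rule that)
  qed
qed

lemma unique_representation:
  assumes p: "1 \<le> p" "p < 2" "M > 0" and z: "Re (1 / 2 + \<i> * z) = 1 / p"
    and weak: "weak_norm (conj_exponent p) u \<le> ennreal M"
    and eig: "\<And>x. nbr_sum u x = eigval q (qpow (\<i> * z)) * u x"
  shows "unique_poisson_representation adj q x0 (conj_exponent p) z u"
proof -
  let ?s = "1 / 2 + \<i> * z"
  have s0: "Re ?s > 0" unfolding z using p by simp
  obtain F where F: "F \<in> boundary_Lp adj q x0 (conj_exponent p)" "pois ?s F = u"
    using poisson_representation[OF p z weak] eig unfolding eig_eq[symmetric] by blast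
  have "AE \<omega> in \<nu>. G \<omega> = F \<omega>" if "G \<in> boundary_Lp adj q x0 (conj_exponent p)" "u = pois ?s G" for G
    by (rule pois_injective[OF s0 boundary_Lp_integrable[OF p(1,2) F(1)] boundary_Lp_integrable[OF p(1,2) that(1)]])
      (use F(2) that(2) in simp)
  then show ?thesis
    unfolding unique_poisson_representation_def poisson_transform_pois using F by blast
qed

end

section \<open>The extremal spectral point\<close>

lemma delta_conj:
  assumes "1 \<le> p" shows "\<delta> (conj_exponent p) = 1 / 2 - 1 / p"
proof (cases "p = 1")
  case False
  then have "p / (p - 1) > 0" using assms by simp
  then have "1 / ennreal (p / (p - 1)) = ennreal (1 / (p / (p - 1)))" by (metis divide_ennreal ennreal_1 zero_le_one)
  then show ?thesis using False assms by (simp add: \<delta>_def conj_exponent_def field_simps)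
qed (simp add: \<delta>_def conj_exponent_def)

text \<open>
  For \<open>L = ln q\<close> the interval is the period that contains \<open>\<beta>\<close>, and \<open>C\<close> and \<open>S\<close> are the cosine and sine that
  define it.
\<close>

lemma angle_unique_existence:
  assumes L: "L > 0" and CS: "C\<^sup>2 + S\<^sup>2 = (1::real)"
  shows "\<exists>!b. b \<in> {- (2 * pi / L) / 2 <.. (2 * pi / L) / 2} \<and> cos (b * L) = C \<and> sin (b * L) = S"
proof -
  have mem: "b \<in> {- (2 * pi / L) / 2 <.. (2 * pi / L) / 2} \<longleftrightarrow> - pi < b * L \<and> b * L \<le> pi" for b
    using L by (auto simp: field_simps)
  have n1: "norm (Complex C S) = 1" using CS by (simp add: cmod_def)
  have cs: "cos t = C \<and> sin t = S \<longleftrightarrow> cis t = Complex C S" for t by (auto simp: complex_eq_iff)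
  have sg: "sgn (Complex C S) = Complex C S" using n1 by (simp add: sgn_div_norm)
  have nz: "Complex C S \<noteq> 0" using n1 by (metis norm_zero zero_neq_one)
  show ?thesis
  proof (rule ex1I[of _ "Arg (Complex C S) / L"])
    show "Arg (Complex C S) / L \<in> {- (2 * pi / L) / 2 <.. (2 * pi / L) / 2} \<and>
        cos (Arg (Complex C S) / L * L) = C \<and> sin (Arg (Complex C S) / L * L) = S"
      unfolding mem cs using L Arg_bounded[of "Complex C S"] cis_Arg[OF nz] sg by simp
    fix b assume b: "b \<in> {- (2 * pi / L) / 2 <.. (2 * pi / L) / 2} \<and> cos (b * L) = C \<and> sin (b * L) = S"
    then have "Arg (Complex C S) = b * L"
      unfolding mem cs by (intro cis_Arg_unique) (auto simp: sg)
    then show "b = Arg (Complex C S) / L" using L by simp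
  qed
qed

context rooted_tree
begin

lemma qpow_line: "qpow (\<i> * (of_real x + \<i> * of_real D)) = of_real (real q powr (- D)) * cis (x * ln q)"
proof -
  have "\<i> * (of_real x + \<i> * of_real D) * of_real (ln (real q)) = of_real (- D * ln (real q)) + \<i> * of_real (x * ln q)"
    by (simp add: algebra_simps)
  then have "qpow (\<i> * (of_real x + \<i> * of_real D)) = exp (of_real (- D * ln (real q))) * exp (\<i> * of_real (x * ln q))"
    unfolding qpow_exp by (simp only: exp_add)
  moreover have "exp (of_real (- D * ln (real q))) = complex_of_real (real q powr (- D))"
  proof -
    have "real q powr (- D) = exp (- D * ln (real q))" using q_pos by (simp add: powr_def)
    then show ?thesis by (simp only: exp_of_real)
  qed
  ultimately show ?thesis by (simp only: cis_conv_exp)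
qed

lemma eigval_polar:
  assumes "\<rho> > 0"
  shows "eigval q (of_real \<rho> * cis X) = Complex (sqrt q * (\<rho> + inverse \<rho>) * cos X) (sqrt q * (\<rho> - inverse \<rho>) * sin X)"
proof -
  have "inverse (of_real \<rho> * cis X) = of_real (inverse \<rho>) * cis (- X)" by (simp add: cis_inverse)
  then show ?thesis unfolding eigval_def by (simp add: complex_eq_iff algebra_simps del: of_real_inverse inverse_mult_distrib)
qed

lemma dist_circle:
  assumes "\<rho> > 0"
  shows "(norm (of_real \<rho> * cis X - of_real \<rho> * cis Y))\<^sup>2 / (2 * \<rho>\<^sup>2) = 1 - cos (X - Y)"
proof -
  have "(norm (of_real \<rho> * cis X - of_real \<rho> * cis Y))\<^sup>2 = \<rho>\<^sup>2 * ((cos X - cos Y)\<^sup>2 + (sin X - sin Y)\<^sup>2)"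
  proof -
    have "Re (of_real \<rho> * cis X - of_real \<rho> * cis Y) = \<rho> * (cos X - cos Y)"
      "Im (of_real \<rho> * cis X - of_real \<rho> * cis Y) = \<rho> * (sin X - sin Y)"
      by (simp_all add: right_diff_distrib)
    then show ?thesis unfolding cmod_power2 by (simp only: power_mult_distrib distrib_left)
  qed
  also have "(cos X - cos Y)\<^sup>2 + (sin X - sin Y)\<^sup>2 = 2 - 2 * cos (X - Y)"
  proof -
    have "(cos X - cos Y)\<^sup>2 + (sin X - sin Y)\<^sup>2 = ((sin X)\<^sup>2 + (cos X)\<^sup>2) + ((sin Y)\<^sup>2 + (cos Y)\<^sup>2) - 2 * (cos X * cos Y + sin X * sin Y)"
      by (simp add: power2_eq_square algebra_simps del: sin_cos_squared_add sin_cos_squared_add2 sin_cos_squared_add3)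
    then show ?thesis by (simp add: cos_diff)
  qed
  finally show ?thesis using assms by (simp add: power2_eq_square)
qed

lemma laplacian_nbr_sum: "laplacian adj q f x = f x - nbr_sum f x / of_nat (q + 1)"
proof -
  have "{y. d x y = 1} = nbrs x" unfolding nbrs_def by (simp only: gdist_eq_1)
  then show ?thesis by (simp only: laplacian_def nbr_sum_def)
qed

text \<open>
  The eigenvalue traces an ellipse over the circle, with half axes proportional to
  \<open>\<rho> + 1 / \<rho>\<close> and \<open>\<rho> - 1 / \<rho>\<close>. The defining equations of \<open>\<beta>\<close> say that a linear functional on this ellipse,
  written as \<open>\<Phi> cos (X - X1)\<close>, has its maximum at the angle \<open>X1\<close> of \<open>w1\<close>.
\<close>

lemma extremal_point:
  assumes p: "1 \<le> p" "p < 2" and xi: "\<xi> \<noteq> 0"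
  defines "\<rho> \<equiv> real q powr (1 / p - 1 / 2)"
    and "\<kappa> \<equiv> - \<xi> / of_nat (q + 1)"
    and "w1 \<equiv> qpow (\<i> * z_extremal q p \<xi> 1)"
  shows "\<Phi> q p \<xi> > 0" "norm w1 = \<rho>" "Re (\<kappa> * eigval q w1) = \<Phi> q p \<xi>"
    "norm w = \<rho> \<Longrightarrow> Re (\<kappa> * eigval q w) = Re (\<kappa> * eigval q w1) - \<Phi> q p \<xi> * ((norm (w - w1))\<^sup>2 / (2 * \<rho>\<^sup>2))"
proof -
  let ?P = "\<Phi> q p \<xi>"
  define D where "D = \<delta> (conj_exponent p)"
  have D: "D = 1 / 2 - 1 / p" unfolding D_def by (rule delta_conj[OF p(1)])
  have rD: "\<rho> = real q powr (- D)" unfolding \<rho>_def D by simp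
  have lq: "ln (real q) > 0" using q_ge_2 by simp
  have r1: "\<rho> > 1" unfolding \<rho>_def using p q_ge_2 by (intro gr_one_powr) (auto simp: field_simps)
  then have r0: "\<rho> > 0" by simp
  \<comment> \<open>The half axes of the ellipse of eigenvalues divided by \<open>q + 1\<close>.\<close>
  define a where "a = sqrt q * (\<rho> + inverse \<rho>) / (real q + 1)"
  define b where "b = sqrt q * (\<rho> - inverse \<rho>) / (real q + 1)"
  have sq: "sqrt q > 0" using q_pos by simp
  have ir: "inverse \<rho> < 1" using r1 by (simp add: inverse_less_1_iff)
  have a0: "a > 0" unfolding a_def using sq r0 by (intro divide_pos_pos mult_pos_pos add_pos_pos) auto
  have b0: "b > 0" unfolding b_def using sq r1 ir by (intro divide_pos_pos mult_pos_pos) auto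
  have gam: "\<gamma> q (of_real x + \<i> * of_real D) = Complex (1 - a * cos (x * ln q)) (- b * sin (x * ln q))" for x
    unfolding gamma_eq qpow_line rD[symmetric] eigval_polar[OF r0]
    by (simp add: complex_eq_iff a_def b_def Re_divide_of_nat Im_divide_of_nat add.commute)
  have ga: "Re (1 - \<gamma> q (\<i> * D)) = a" using gam[of 0] by simp
  have gb: "Im (\<gamma> q (\<tau> q / 4 + \<i> * D)) = - b"
  proof -
    have "\<tau> q / 4 * ln q = pi / 2" using lq by (simp add: \<tau>_def)
    then show ?thesis using gam[of "\<tau> q / 4"] by simp
  qed
  have th: "(tanh (D * ln q))\<^sup>2 = (b / a)\<^sup>2"
  proof -
    have e: "exp (D * ln q) = inverse \<rho>" "exp (- (D * ln q)) = \<rho>"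
      unfolding rD using q_pos by (simp_all add: powr_def exp_minus)
    have "tanh (D * ln q) = (inverse \<rho> - \<rho>) / (inverse \<rho> + \<rho>)"
      unfolding tanh_def sinh_def cosh_def e by (simp add: divide_simps)
    also have "\<dots> = - (b / a)"
    proof -
      have "b / a = (\<rho> - inverse \<rho>) / (\<rho> + inverse \<rho>)" unfolding a_def b_def using sq by simp
      then show ?thesis by (simp add: add.commute minus_divide_left)
    qed
    finally show ?thesis by simp
  qed
  have P: "?P = sqrt ((a * Re \<xi>)\<^sup>2 + (b * Im \<xi>)\<^sup>2)"
  proof -
    have "?P = a * sqrt ((Re \<xi>)\<^sup>2 + (b / a)\<^sup>2 * (Im \<xi>)\<^sup>2)" unfolding \<Phi>_def D_def[symmetric] ga th ..
    also have "\<dots> = sqrt (a\<^sup>2 * ((Re \<xi>)\<^sup>2 + (b / a)\<^sup>2 * (Im \<xi>)\<^sup>2))" using a0 by (simp add: real_sqrt_mult)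
    also have "a\<^sup>2 * ((Re \<xi>)\<^sup>2 + (b / a)\<^sup>2 * (Im \<xi>)\<^sup>2) = (a * Re \<xi>)\<^sup>2 + (b * Im \<xi>)\<^sup>2"
      using a0 by (simp add: power_mult_distrib power_divide distrib_left)
    finally show ?thesis .
  qed
  have pos: "(a * Re \<xi>)\<^sup>2 + (b * Im \<xi>)\<^sup>2 > 0"
    using xi a0 b0 by (auto simp: complex_eq_iff sum_power2_gt_zero_iff)
  then show Ppos: "?P > 0" unfolding P by simp
  have P2: "?P\<^sup>2 = (a * Re \<xi>)\<^sup>2 + (b * Im \<xi>)\<^sup>2" unfolding P using pos by simp
  define C where "C = - (a * Re \<xi>) / ?P"
  define S where "S = b * Im \<xi> / ?P"
  have CS: "C\<^sup>2 + S\<^sup>2 = 1"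
  proof -
    have "C\<^sup>2 + S\<^sup>2 = ((a * Re \<xi>)\<^sup>2 + (b * Im \<xi>)\<^sup>2) / ?P\<^sup>2"
      by (simp add: C_def S_def power_divide add_divide_distrib)
    also have "\<dots> = ?P\<^sup>2 / ?P\<^sup>2" unfolding P2 ..
    finally show ?thesis using Ppos by simp
  qed
  define \<beta>1 where "\<beta>1 = \<beta> q p \<xi> 1"
  have beq: "\<beta> q p \<xi> 1 = (THE y. y \<in> {- (2 * pi / ln q) / 2 <.. (2 * pi / ln q) / 2} \<and> cos (y * ln q) = C \<and> sin (y * ln q) = S)"
  proof -
    have "(?P * cos t = (-1) ^ 1 * Re \<xi> * Re (1 - \<gamma> q (\<i> * D))) = (cos t = C)"
      "(?P * sin t = (-1) ^ 1 * Im \<xi> * Im (\<gamma> q (\<tau> q / 4 + \<i> * D))) = (sin t = S)" for t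
      unfolding ga gb C_def S_def using Ppos by (auto simp: field_simps)
    then show ?thesis unfolding \<beta>_def D_def[symmetric] \<tau>_def[symmetric] by (simp only:)
  qed
  have "\<beta>1 \<in> {- (2 * pi / ln q) / 2 <.. (2 * pi / ln q) / 2} \<and> cos (\<beta>1 * ln q) = C \<and> sin (\<beta>1 * ln q) = S"
    unfolding \<beta>1_def beq by (rule theI'[OF angle_unique_existence[OF lq CS]])
  then have cs: "?P * cos (\<beta>1 * ln q) = - (a * Re \<xi>)" "?P * sin (\<beta>1 * ln q) = b * Im \<xi>"
    unfolding C_def S_def using Ppos by simp_all
  have w1: "w1 = of_real \<rho> * cis (\<beta>1 * ln q)"
    unfolding w1_def z_extremal_def D_def[symmetric] \<beta>1_def[symmetric] qpow_line rD ..
  show "norm w1 = \<rho>" unfolding w1 using r0 by (simp add: norm_mult)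
  have val: "Re (\<kappa> * eigval q (of_real \<rho> * cis X)) = ?P * cos (X - \<beta>1 * ln q)" for X
  proof -
    have k: "\<kappa> = Complex (- Re \<xi> / (real q + 1)) (- Im \<xi> / (real q + 1))"
      unfolding \<kappa>_def by (simp add: complex_eq_iff Re_divide_of_nat Im_divide_of_nat add.commute)
    have "Re (\<kappa> * eigval q (of_real \<rho> * cis X)) = - (a * Re \<xi>) * cos X + (b * Im \<xi>) * sin X"
      unfolding eigval_polar[OF r0] k by (simp add: a_def b_def mult_ac)
    also have "\<dots> = ?P * cos (X - \<beta>1 * ln q)" unfolding cs[symmetric] cos_diff by (simp add: algebra_simps)
    finally show ?thesis .
  qed
  show v1: "Re (\<kappa> * eigval q w1) = ?P" unfolding w1 val by simp
  assume w: "norm w = \<rho>"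
  have "w = of_real \<rho> * cis (Arg w)" using rcis_cmod_Arg[of w] w by (simp add: rcis_def)
  then obtain X where X: "w = of_real \<rho> * cis X" by blast
  show "Re (\<kappa> * eigval q w) = Re (\<kappa> * eigval q w1) - ?P * ((norm (w - w1))\<^sup>2 / (2 * \<rho>\<^sup>2))"
    unfolding v1 unfolding X w1 val dist_circle[OF r0] by (simp add: algebra_simps)
qed

text \<open>
  The first case of the theorem, with the scalar factor of the heat operator absorbed in \<open>a\<close>.
\<close>

lemma extremal_orbit:
  assumes p: "1 \<le> p" "p < 2" "M > 0" and xi: "\<xi> \<noteq> 0"
    and weak: "\<And>k. weak_norm (conj_exponent p) (g k) \<le> ennreal M"
    and orb: "\<And>k. exp_nbr (- \<xi> / of_nat (q + 1)) (g (Suc k)) = (\<lambda>x. a * g k x)"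
    and a: "norm a = exp (\<Phi> q p \<xi>)"
  shows "laplacian adj q (g 0) = (\<lambda>x. \<gamma> q (z_extremal q p \<xi> 1) * g 0 x) \<and>
          unique_poisson_representation adj q x0 (conj_exponent p) (z_extremal q p \<xi> 1) (g 0)"
proof -
  let ?z = "z_extremal q p \<xi> 1"
  let ?w = "qpow (\<i> * ?z)"
  note ext = extremal_point[OF p(1,2) xi]
  have k0: "- \<xi> / of_nat (q + 1) \<noteq> 0" using xi by (simp del: of_nat_Suc of_nat_add)
  have eig: "nbr_sum (g 0) x = eigval q ?w * g 0 x" for x
    by (rule orbit_extremal_eigenfunction[where g = g, OF p weak orb refl ext(2,1) k0 ext(4)])
      (simp_all only: ext(3) a)
  have "laplacian adj q (g 0) x = \<gamma> q ?z * g 0 x" for x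
    unfolding laplacian_nbr_sum eig gamma_eq by (simp add: left_diff_distrib)
  moreover have "Re (1 / 2 + \<i> * ?z) = 1 / p"
    unfolding z_extremal_def delta_conj[OF p(1)] by simp
  ultimately show ?thesis using unique_representation[OF p _ weak eig] by blast
qed

end

theorem corollary5p5:
  fixes adj :: "'a \<Rightarrow> 'a \<Rightarrow> bool" and q :: nat and x0 :: 'a
    and \<xi> :: complex and p M :: real and f :: "int \<Rightarrow> 'a \<Rightarrow> complex"
  assumes "q \<ge> 2"
    and "homogeneous_tree adj q"
    and "\<xi> \<noteq> 0"
    and "1 \<le> p" and "p < 2"
    and "M > 0"
    and "\<And>k. weak_norm (conj_exponent p) (f k) \<le> ennreal M"
  shows
    "((\<exists>A. cmod A = exp (Re \<xi> + \<Phi> q p \<xi>) \<and>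
           (\<forall>k\<ge>1. heat_operator adj q x0 \<xi> (f (- k)) = (\<lambda>x. A * f (- k + 1) x)))
      \<longrightarrow> laplacian adj q (f 0) = (\<lambda>x. \<gamma> q (z_extremal q p \<xi> 1) * f 0 x) \<and>
          unique_poisson_representation adj q x0 (conj_exponent p) (z_extremal q p \<xi> 1) (f 0))
   \<and> ((\<exists>A. cmod A = exp (Re \<xi> - \<Phi> q p \<xi>) \<and>
           (\<forall>k\<ge>0. heat_operator adj q x0 \<xi> (f k) = (\<lambda>x. A * f (k + 1) x)))
      \<longrightarrow> laplacian adj q (f 0) = (\<lambda>x. \<gamma> q (z_extremal q p \<xi> 2) * f 0 x) \<and>
          unique_poisson_representation adj q x0 (conj_exponent p) (z_extremal q p \<xi> 2) (f 0))"
proof -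
  interpret rooted_tree adj q x0 by unfold_locales (fact assms(1), fact assms(2))
  let ?\<kappa> = "- \<xi> / of_nat (q + 1)"
  have bd: "norm (f k y) \<le> M" for k y by (rule weak_norm_bounded[OF assms(4-7)])
  have heat: "heat_operator adj q x0 \<xi> (f k) = (\<lambda>x. exp \<xi> * exp_nbr ?\<kappa> (f k) x)" for k
    using heat_operator_eq[of "f k" M \<xi>, OF bd] by (simp add: fun_eq_iff)
  show ?thesis
  proof (intro conjI impI)
    assume "\<exists>A. cmod A = exp (Re \<xi> + \<Phi> q p \<xi>) \<and>
           (\<forall>k\<ge>1. heat_operator adj q x0 \<xi> (f (- k)) = (\<lambda>x. A * f (- k + 1) x))"
    then obtain A where A: "cmod A = exp (Re \<xi> + \<Phi> q p \<xi>)"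
      "\<And>k. k \<ge> 1 \<Longrightarrow> heat_operator adj q x0 \<xi> (f (- k)) = (\<lambda>x. A * f (- k + 1) x)" by blast
    have orb: "exp_nbr ?\<kappa> (f (- int (Suc k))) = (\<lambda>x. (A / exp \<xi>) * f (- int k) x)" for k
    proof
      fix x
      have "exp \<xi> * exp_nbr ?\<kappa> (f (- int (Suc k))) x = A * f (- int (Suc k) + 1) x"
        using A(2)[of "int (Suc k)"] unfolding heat by (simp only: fun_eq_iff)
      then show "exp_nbr ?\<kappa> (f (- int (Suc k))) x = (A / exp \<xi>) * f (- int k) x"
        by (simp add: field_simps)
    qed
    have "norm (A / exp \<xi>) = exp (\<Phi> q p \<xi>)" by (simp add: norm_divide A(1) norm_exp_eq_Re exp_add)
    from extremal_orbit[where g = "\<lambda>k. f (- int k)", OF assms(4-6,3,7) orb this]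
    show "laplacian adj q (f 0) = (\<lambda>x. \<gamma> q (z_extremal q p \<xi> 1) * f 0 x)"
      "unique_poisson_representation adj q x0 (conj_exponent p) (z_extremal q p \<xi> 1) (f 0)" by simp_all
  next
    assume "\<exists>A. cmod A = exp (Re \<xi> - \<Phi> q p \<xi>) \<and>
           (\<forall>k\<ge>0. heat_operator adj q x0 \<xi> (f k) = (\<lambda>x. A * f (k + 1) x))"
    then obtain A where A: "cmod A = exp (Re \<xi> - \<Phi> q p \<xi>)"
      "\<And>k. k \<ge> 0 \<Longrightarrow> heat_operator adj q x0 \<xi> (f k) = (\<lambda>x. A * f (k + 1) x)" by blast
    have A0: "A \<noteq> 0" using A(1) by auto
    \<comment> \<open>The exponential with opposite sign undoes one step, so the sequence is a backward orbit for \<open>- \<xi>\<close>.\<close>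
    have orb: "exp_nbr (- (- \<xi>) / of_nat (q + 1)) (f (int (Suc k))) = (\<lambda>x. (exp \<xi> / A) * f (int k) x)" for k
    proof -
      have fS: "f (int (Suc k)) = (\<lambda>x. (exp \<xi> / A) * exp_nbr ?\<kappa> (f (int k)) x)"
      proof
        fix x
        have "exp \<xi> * exp_nbr ?\<kappa> (f (int k)) x = A * f (int k + 1) x"
          using A(2)[of "int k"] unfolding heat by (simp add: fun_eq_iff)
        then show "f (int (Suc k)) x = (exp \<xi> / A) * exp_nbr ?\<kappa> (f (int k)) x"
          using A0 by (simp add: field_simps)
      qed
      obtain C where C: "\<And>x. norm (exp_nbr ?\<kappa> (f (int k)) x) \<le> C"
        using exp_nbr_bound[of "f (int k)" M ?\<kappa>, OF bd] by blast
      have "exp_nbr (- ?\<kappa>) (f (int (Suc k))) = (\<lambda>x. (exp \<xi> / A) * exp_nbr (- ?\<kappa>) (exp_nbr ?\<kappa> (f (int k))) x)"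
        unfolding fS by (rule ext, rule exp_nbr_scale[of "exp_nbr ?\<kappa> (f (int k))" C, OF C])
      also have "exp_nbr (- ?\<kappa>) (exp_nbr ?\<kappa> (f (int k))) = f (int k)"
        unfolding exp_nbr_compose[of "f (int k)" M, OF bd] by (simp add: exp_nbr_0)
      finally show ?thesis by simp
    qed
    have P: "\<Phi> q p (- \<xi>) = \<Phi> q p \<xi>" by (simp add: \<Phi>_def)
    have Z: "z_extremal q p (- \<xi>) 1 = z_extremal q p \<xi> 2" by (simp add: z_extremal_def \<beta>_def P)
    have "norm (exp \<xi> / A) = exp (\<Phi> q p (- \<xi>))" unfolding P by (simp add: norm_divide A(1) norm_exp_eq_Re exp_diff)
    from extremal_orbit[where g = "\<lambda>k. f (int k)" and \<xi> = "- \<xi>", OF assms(4-6) _ assms(7) orb this] assms(3)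
    show "laplacian adj q (f 0) = (\<lambda>x. \<gamma> q (z_extremal q p \<xi> 2) * f 0 x)"
      "unique_poisson_representation adj q x0 (conj_exponent p) (z_extremal q p \<xi> 2) (f 0)" unfolding Z by simp_all
  qed
qed

end
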